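(* Let $(A,B)$ be a commuting dilation pair in $\mathrm{GL}_d(\mathbb{R})$ with $A=A^*$ and $B=B^*$, and let $(\phi,\mathfrak{V})$ be a biscaled multiresolution analysis (rank $2$ multiresolution analysis) in $L^2(\mathbb{R}^d)$ with respect to $(A,B)$. Then there exists a (finite) wavelet set for $(A,B)$, that is, there exist finitely many functions $\psi_1,\dots,\psi_s\in L^2(\mathbb{R}^d)$ such that $$\left\{|\det(A^mB^n)|^{1/2}\,\psi_i(A^mB^nx+k) : (m,n)\in\mathbb{Z}^2,\ k\in\mathbb{Z}^d,\ 1\le i\le s\right\}$$ is an orthonormal basis of $L^2(\mathbb{R}^d)$.
   Context: A dilation matrix is a matrix with integer entries all of whose eigenvalues have absolute value greater than $1$. A commuting dilation pair $(A,B)$ in $\mathrm{GL}_d(\mathbb{R})$ is a pair which, after a suitable permutation of the standard basis of $\mathbb{R}^d$, has the form $A=\begin{bmatrix}A'&0\\0&I_{d-p}\end{bmatrix}$, $B=\begin{bmatrix}I_{d-q}&0\\0&B'\end{bmatrix}$, where $p+q=d$ and $A'\in\mathrm{GL}_p(\mathbb{R})$, $B'\in\mathrm{GL}_q(\mathbb{R})$ are dilation matrices. For $M\in\mathrm{GL}_d(\mathbb{R})$, $D_M$ is the unitary operator on $L^2(\mathbb{R}^d)$ given by $(D_Mf)(x)=|\det M|^{1/2}f(Mx)$. A biscaled multiresolution analysis (BMRA) with respect to $(A,B)$ is a pair $(\phi,\mathfrak{V})$ where $\phi\in L^2(\mathbb{R}^d)$ and $\mathfrak{V}=\{V_{i,j}:(i,j)\in\mathbb{Z}^2\}$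 is a family of closed subspaces of $L^2(\mathbb{R}^d)$ such that: (i) $V_{i,j}\subseteq V_{l,m}$ for $i\le l$, $j\le m$; (ii) $D_A^iD_B^jV_{0,0}=V_{i,j}$ for all $i,j$; (iii) $\bigcap_{(i,j)\in\mathbb{Z}^2}V_{i,j}=\{0\}$; (iv) $\overline{\bigcup_{(i,j)\in\mathbb{Z}^2}V_{i,j}}=L^2(\mathbb{R}^d)$; (v) the orthogonal projections $P_{i,j}$ onto $V_{i,j}$ commute pairwise; (vi) $\{\phi(x-k):k\in\mathbb{Z}^d\}$ is an orthonormal basis of $V_{0,0}$. *)

theory Defs
  imports "HOL-Analysis.Analysis" "Jordan_Normal_Form.Char_Poly"
begin

no_notation Matrix.vec_index (infixl "$" 100)

section \<open>Commuting dilation pairs\<close>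

text \<open>The blocks have sizes \<open>p\<close> and \<open>q\<close> that vary inside the definition, so they are matrices with
  explicit dimensions. The eigenvalues of a real matrix are its complex eigenvalues.\<close>

definition dilation_mat :: "real mat \<Rightarrow> bool" where
  "dilation_mat M \<longleftrightarrow>
     square_mat M \<and> elements_mat M \<subseteq> \<int> \<and>
     (\<forall>c :: complex. eigenvalue (map_mat complex_of_real M) c \<longrightarrow> cmod c > 1)"

text \<open>The matrix of \<open>M\<close> in the standard basis listed in the order \<open>\<sigma> 0, \<sigma> 1, \<dots>\<close>.\<close>

definition reindexed_mat :: "(nat \<Rightarrow> 'n) \<Rightarrow> real^'n^'n \<Rightarrow> real mat" where
  "reindexed_mat \<sigma> M = Matrix.mat CARD('n) CARD('n) (\<lambda>(i, j). M $ \<sigma> i $ \<sigma> j)"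

text \<open>The cases \<open>p = 0\<close> and \<open>q = 0\<close> are allowed; then one of the two matrices is the identity.\<close>

definition commuting_dilation_pair :: "real^'n^'n \<Rightarrow> real^'n^'n \<Rightarrow> bool" where
  "commuting_dilation_pair A B \<longleftrightarrow>
     (\<exists>\<sigma> p q A' B'.
        bij_betw \<sigma> {..<CARD('n)} (UNIV :: 'n set) \<and> p + q = CARD('n) \<and>
        A' \<in> carrier_mat p p \<and> invertible_mat A' \<and> dilation_mat A' \<and>
        B' \<in> carrier_mat q q \<and> invertible_mat B' \<and> dilation_mat B' \<and>
        reindexed_mat \<sigma> A = four_block_mat A' (0\<^sub>m p q) (0\<^sub>m q p) (1\<^sub>m q) \<and>
        reindexed_mat \<sigma> B = four_block_mat (1\<^sub>m p) (0\<^sub>m p q) (0\<^sub>m q p) B')"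

section \<open>Square integrable functions\<close>

text \<open>Elements of $L^2(\mathbb{R}^d)$ are represented by functions, and equality in $L^2$ is
  equality almost everywhere. A subspace of $L^2$ is represented by the set of all representatives
  of its elements; the closedness condition in \<open>closed_L2_subspace\<close> makes such a set
  invariant under changes on null sets.\<close>

definition L2 :: "(real^'n \<Rightarrow> complex) set" where
  "L2 = {f. f \<in> borel_measurable lebesgue \<and> integrable lebesgue (\<lambda>x. (cmod (f x))\<^sup>2)}"

definition L2_inner :: "(real^'n \<Rightarrow> complex) \<Rightarrow> (real^'n \<Rightarrow> complex) \<Rightarrow> complex" where
  "L2_inner f g = (LINT x|lebesgue. f x * cnj (g x))"

definition L2_dist :: "(real^'n \<Rightarrow> complex) \<Rightarrow> (real^'n \<Rightarrow> complex) \<Rightarrow> real" where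
  "L2_dist f g = sqrt (LINT x|lebesgue. (cmod (f x - g x))\<^sup>2)"

definition closed_L2_subspace :: "(real^'n \<Rightarrow> complex) set \<Rightarrow> bool" where
  "closed_L2_subspace V \<longleftrightarrow>
     V \<subseteq> L2 \<and> (\<lambda>x. 0) \<in> V \<and>
     (\<forall>f\<in>V. \<forall>g\<in>V. (\<lambda>x. f x + g x) \<in> V) \<and>
     (\<forall>c. \<forall>f\<in>V. (\<lambda>x. c * f x) \<in> V) \<and>
     (\<forall>X. \<forall>f\<in>L2. (\<forall>n::nat. X n \<in> V) \<and> (\<lambda>n. L2_dist (X n) f) \<longlonglongrightarrow> 0 \<longrightarrow> f \<in> V)"

text \<open>For a closed subspace \<open>V\<close> and \<open>f \<in> L2\<close> this is well defined up to null sets.\<close>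

definition L2_proj :: "(real^'n \<Rightarrow> complex) set \<Rightarrow> (real^'n \<Rightarrow> complex) \<Rightarrow> (real^'n \<Rightarrow> complex)" where
  "L2_proj V f = (SOME g. g \<in> V \<and> (\<forall>h\<in>V. L2_inner (\<lambda>x. f x - g x) h = 0))"

text \<open>The indexed family \<open>e\<close> over \<open>I\<close> is orthonormal, and its closed linear span is \<open>V\<close>.\<close>

definition orthonormal_basis_of ::
  "(real^'n \<Rightarrow> complex) set \<Rightarrow> 'i set \<Rightarrow> ('i \<Rightarrow> real^'n \<Rightarrow> complex) \<Rightarrow> bool" where
  "orthonormal_basis_of V I e \<longleftrightarrow>
     (\<forall>i\<in>I. e i \<in> V) \<and>
     (\<forall>i\<in>I. \<forall>j\<in>I. L2_inner (e i) (e j) = (if i = j then 1 else 0)) \<and>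
     (\<forall>f\<in>V. \<forall>\<epsilon>>0. \<exists>F c. finite F \<and> F \<subseteq> I \<and> L2_dist f (\<lambda>x. \<Sum>i\<in>F. c i * e i x) < \<epsilon>)"

section \<open>Dilations and biscaled multiresolution analyses\<close>

definition dilation_op :: "real^'n^'n \<Rightarrow> (real^'n \<Rightarrow> complex) \<Rightarrow> (real^'n \<Rightarrow> complex)" where
  "dilation_op M f = (\<lambda>x. complex_of_real (sqrt \<bar>Determinants.det M\<bar>) * f (M *v x))"

text \<open>Integer iterates of a bijection; \<open>dilation_op M\<close> is a bijection on all functions
  when \<open>M\<close> is invertible.\<close>

definition int_iterate :: "('a \<Rightarrow> 'a) \<Rightarrow> int \<Rightarrow> 'a \<Rightarrow> 'a" where
  "int_iterate F k = (if k \<ge> 0 then F ^^ nat k else inv_into UNIV F ^^ nat (- k))"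

text \<open>The power operation of the type \<open>real^'n^'n\<close> is entrywise, hence the explicit definition.\<close>

definition matrix_int_power :: "real^'n^'n \<Rightarrow> int \<Rightarrow> real^'n^'n" where
  "matrix_int_power M k =
     (if k \<ge> 0 then (((**) M) ^^ nat k) (Finite_Cartesian_Product.mat 1)
      else (((**) (matrix_inv M)) ^^ nat (- k)) (Finite_Cartesian_Product.mat 1))"

definition int_vec :: "int^'n \<Rightarrow> real^'n" where
  "int_vec k = (\<chi> i. real_of_int (k $ i))"

definition bmra ::
  "real^'n^'n \<Rightarrow> real^'n^'n \<Rightarrow> (real^'n \<Rightarrow> complex) \<Rightarrow> (int \<Rightarrow> int \<Rightarrow> (real^'n \<Rightarrow> complex) set) \<Rightarrow> bool" where
  "bmra A B \<phi> V \<longleftrightarrow>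
     \<phi> \<in> L2 \<and>
     (\<forall>i j. closed_L2_subspace (V i j)) \<and>
     (\<forall>i j l m. i \<le> l \<and> j \<le> m \<longrightarrow> V i j \<subseteq> V l m) \<and>
     (\<forall>i j. int_iterate (dilation_op A) i ` (int_iterate (dilation_op B) j ` V 0 0) = V i j) \<and>
     (\<Inter>i. \<Inter>j. V i j) = {f \<in> L2. AE x in lebesgue. f x = 0} \<and>
     (\<forall>f\<in>L2. \<forall>\<epsilon>>0. \<exists>i j. \<exists>g\<in>V i j. L2_dist f g < \<epsilon>) \<and>
     (\<forall>i j l m. \<forall>f\<in>L2. AE x in lebesgue.
        L2_proj (V i j) (L2_proj (V l m) f) x = L2_proj (V l m) (L2_proj (V i j) f) x) \<and>
     orthonormal_basis_of (V 0 0) UNIV (\<lambda>k x. \<phi> (x - int_vec k))"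

text \<open>The system of all $|\det(A^mB^n)|^{1/2}\psi_i(A^mB^nx+k)$ is indexed by the triples
  $(A^mB^n,k,i)$. If neither \<open>A\<close> nor \<open>B\<close> is the identity, the matrices $A^mB^n$ of a
  commuting dilation pair are pairwise distinct, and this is the same as the
  index set of all $(m,n,k,i)$. If \<open>A\<close> or \<open>B\<close> is the identity, each function occurs once
  and not once for every power of the identity.\<close>

definition wavelet_system ::
  "(nat \<Rightarrow> real^'n \<Rightarrow> complex) \<Rightarrow> ((real^'n^'n) \<times> (int^'n) \<times> nat) \<Rightarrow> real^'n \<Rightarrow> complex" where
  "wavelet_system \<psi> =
     (\<lambda>(M, k, i) x. complex_of_real (sqrt \<bar>Determinants.det M\<bar>) * \<psi> i (M *v x + int_vec k))"

definition wavelet_index ::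
  "real^'n^'n \<Rightarrow> real^'n^'n \<Rightarrow> nat \<Rightarrow> ((real^'n^'n) \<times> (int^'n) \<times> nat) set" where
  "wavelet_index A B s =
     {(matrix_int_power A m ** matrix_int_power B n, k, i) | m n k i. i \<in> {1..s}}"

definition finite_wavelet_set ::
  "real^'n^'n \<Rightarrow> real^'n^'n \<Rightarrow> nat \<Rightarrow> (nat \<Rightarrow> real^'n \<Rightarrow> complex) \<Rightarrow> bool" where
  "finite_wavelet_set A B s \<psi> \<longleftrightarrow>
     (\<forall>i\<in>{1..s}. \<psi> i \<in> L2) \<and>
     orthonormal_basis_of L2 (wavelet_index A B s) (wavelet_system \<psi>)"

end

theory Submission
  imports Defs "HOL-Analysis.Radon_Nikodym"
begin

text \<open>
  The wavelets are tensor products of Haar wavelets for the two blocks. A symmetric dilation matrix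
  expands the norm by a factor \<open>lam > 1\<close>. To a point \<open>x\<close> of the coordinate subspace of a block one
  can therefore attach a label, a finite nonempty set of lattice points near \<open>x\<close>, such that the label of
  \<open>x\<close> is determined by the label of \<open>A x\<close> and labels commute with integer translations. The level sets
  of the labels of \<open>A\<^sup>m x\<close>, \<open>m \<in> \<int>\<close>, are nested partitions into bounded cells, finitely many up to
  translation on each level. Orthonormal mean-zero step functions on the children of one representative of each
  class of cells are the wavelets: they are orthonormal because the partitions are nested and their
  span is dense because the cells shrink to points as \<open>m \<rightarrow> \<infinity>\<close> and their measures tend to infinity as
  \<open>m \<rightarrow> -\<infinity>\<close>. Unlike a Haar multiresolution analysis this needs no lattice tiling by a self-affine set.
\<close>

text \<open>Symmetry makes the minimum of |A v| over the unit vectors of a block the absolute value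
  of an eigenvalue, hence greater than 1. So A expands the Euclidean norm itself at every single
  step, and one radius \<open>rho\<close> serves all levels. Rounding x to one lattice point would
  not give nested cells: the rounded value of A x need not determine that of x. A label therefore
  keeps every lattice point that stays compatible with the whole orbit x, A x, A^2 x, ...; no choice
  is made, so translations cause no trouble. Finiteness of the labels serves twice: it bounds the
  number of types of cells, and a finite nonempty set is fixed by no nonzero translation, so the
  lattice translates of a cell are different cells. The blocks act on complementary coordinates and
  the exponents m, n are independent. Hence the full product of the two one-block systems has
  exactly the required form, and Fubini reduces orthonormality and completeness to one block.
  Everything is real until the last step, where complex coefficients enter.\<close>

abbreviation mdet :: "real^'n^'n \<Rightarrow> real" where "mdet \<equiv> Determinants.det"
abbreviation id_mat :: "real^'n^'n" where "id_mat \<equiv> Finite_Cartesian_Product.mat 1"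
abbreviation mpow :: "real^'n^'n \<Rightarrow> int \<Rightarrow> real^'n^'n" where "mpow \<equiv> matrix_int_power"

subsection \<open>Approximation in mean square\<close>

abbreviation sqint :: "'a measure \<Rightarrow> ('a \<Rightarrow> real) \<Rightarrow> ennreal" where
  "sqint M f \<equiv> \<integral>\<^sup>+x. ennreal ((f x)\<^sup>2) \<partial>M"

text \<open>Errors are nonnegative integrals valued in \<open>ennreal\<close>, so no integrability
  conditions have to be carried along. Functions and coefficients are real; a complex function is
  handled later through its real and imaginary parts.\<close>

definition approximable :: "'a measure \<Rightarrow> 'i set \<Rightarrow> ('i \<Rightarrow> 'a \<Rightarrow> real) \<Rightarrow> ('a \<Rightarrow> real) \<Rightarrow> bool" where
  "approximable M I e f \<longleftrightarrow> f \<in> borel_measurable M \<and>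
     (\<forall>\<epsilon>>0. \<exists>F c. finite F \<and> F \<subseteq> I \<and>
        sqint M (\<lambda>x. f x - (\<Sum>i\<in>F. c i * e i x)) < ennreal \<epsilon>)"

text \<open>The factor 2 comes from (f x - g x)^2 \<ge> 0 and takes the place of Minkowski's
  inequality. It is the reason for the error budgets \<epsilon> / 4 below.\<close>

lemma nn_integral_square_add_le:
  fixes f g :: "'a \<Rightarrow> real"
  assumes [measurable]: "f \<in> borel_measurable M" "g \<in> borel_measurable M"
  shows "sqint M (\<lambda>x. f x + g x) \<le>
    2 * sqint M f + 2 * sqint M g"
proof -
  have "sqint M (\<lambda>x. f x + g x) \<le>
      (\<integral>\<^sup>+x. 2 * ennreal ((f x)\<^sup>2) + 2 * ennreal ((g x)\<^sup>2) \<partial>M)"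
  proof (rule nn_integral_mono)
    fix x
    have "(f x + g x)\<^sup>2 \<le> 2 * (f x)\<^sup>2 + 2 * (g x)\<^sup>2"
      using sum_squares_ge_zero[of "f x - g x" 0] by (simp add: power2_eq_square algebra_simps)
    then have "ennreal ((f x + g x)\<^sup>2) \<le> ennreal (2 * (f x)\<^sup>2 + 2 * (g x)\<^sup>2)"
      by (rule ennreal_leI)
    also have "\<dots> = 2 * ennreal ((f x)\<^sup>2) + 2 * ennreal ((g x)\<^sup>2)"
      by (simp add: ennreal_plus ennreal_mult)
    finally show "ennreal ((f x + g x)\<^sup>2) \<le> 2 * ennreal ((f x)\<^sup>2) + 2 * ennreal ((g x)\<^sup>2)" .
  qed
  also have "\<dots> = 2 * sqint M f + 2 * sqint M g"
    by (subst nn_integral_add) (auto simp: nn_integral_cmult)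
  finally show ?thesis .
qed

lemma two_ennreal_less:
  assumes "a < ennreal (\<epsilon> / 4)" "b < ennreal (\<epsilon> / 4)" "\<epsilon> > 0"
  shows "2 * a + 2 * b < ennreal \<epsilon>"
proof -
  obtain r where r: "a = ennreal r" "r \<ge> 0"
    using assms by (cases a) auto
  obtain s where s: "b = ennreal s" "s \<ge> 0"
    using assms by (cases b) auto
  have "r < \<epsilon> / 4" "s < \<epsilon> / 4"
    using assms r s by (auto simp: ennreal_less_iff)
  then have "2 * r + 2 * s < \<epsilon>" by simp
  then have "ennreal (2 * r + 2 * s) < ennreal \<epsilon>"
    using r s by (subst ennreal_less_iff) auto
  then show ?thesis
    unfolding r(1) s(1) using r(2) s(2) by (metis ennreal_mult'' ennreal_numeral ennreal_plus mult_nonneg_nonneg zero_le_numeral)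
qed

lemma approximable_closed:
  fixes e :: "'i \<Rightarrow> 'a \<Rightarrow> real"
  assumes e: "\<forall>i\<in>I. e i \<in> borel_measurable M"
    and f[measurable]: "f \<in> borel_measurable M"
    and lim: "\<And>\<epsilon>. \<epsilon> > 0 \<Longrightarrow> \<exists>g. approximable M I e g \<and>
        sqint M (\<lambda>x. f x - g x) < ennreal \<epsilon>"
  shows "approximable M I e f"
  unfolding approximable_def
proof (intro conjI allI impI f)
  fix \<epsilon> :: real assume "\<epsilon> > 0"
  then have pos: "\<epsilon> / 4 > 0" by simp
  obtain g where g: "approximable M I e g" "sqint M (\<lambda>x. f x - g x) < ennreal (\<epsilon> / 4)"
    using lim[OF pos] by blast
  obtain F c where F: "finite F" "F \<subseteq> I"
    "sqint M (\<lambda>x. g x - (\<Sum>i\<in>F. c i * e i x)) < ennreal (\<epsilon> / 4)"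
    using g(1) pos unfolding approximable_def by blast
  have [measurable]: "g \<in> borel_measurable M"
    using g(1) by (simp add: approximable_def)
  have [measurable]: "(\<lambda>x. \<Sum>i\<in>F. c i * e i x) \<in> borel_measurable M"
    using F e by (intro borel_measurable_sum borel_measurable_times) auto
  have "sqint M (\<lambda>x. f x - (\<Sum>i\<in>F. c i * e i x)) =
      sqint M (\<lambda>x. (f x - g x) + (g x - (\<Sum>i\<in>F. c i * e i x)))"
    by simp
  also have "\<dots> \<le> 2 * sqint M (\<lambda>x. f x - g x) +
      2 * sqint M (\<lambda>x. g x - (\<Sum>i\<in>F. c i * e i x))"
    by (rule nn_integral_square_add_le) measurable
  also have "\<dots> < ennreal \<epsilon>"
    using g(2) F(3) \<open>\<epsilon> > 0\<close> by (rule two_ennreal_less)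
  finally show "\<exists>F c. finite F \<and> F \<subseteq> I \<and>
      sqint M (\<lambda>x. f x - (\<Sum>i\<in>F. c i * e i x)) < ennreal \<epsilon>"
    using F by blast
qed

lemma approximable_tendsto:
  fixes e :: "'i \<Rightarrow> 'a \<Rightarrow> real" and g :: "nat \<Rightarrow> 'a \<Rightarrow> real"
  assumes e: "\<forall>i\<in>I. e i \<in> borel_measurable M"
    and f: "f \<in> borel_measurable M"
    and g: "\<And>n. approximable M I e (g n)"
    and lim: "(\<lambda>n. sqint M (\<lambda>x. f x - g n x)) \<longlonglongrightarrow> 0"
  shows "approximable M I e f"
proof (rule approximable_closed[OF e f])
  fix \<epsilon> :: real assume "\<epsilon> > 0"
  then have "eventually (\<lambda>n. sqint M (\<lambda>x. f x - g n x) < ennreal \<epsilon>) sequentially"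
    using order_tendstoD(2)[OF lim] by simp
  then show "\<exists>h. approximable M I e h \<and> sqint M (\<lambda>x. f x - h x) < ennreal \<epsilon>"
    using g eventually_happens' sequentially_bot by blast
qed

lemma approximable_cong_AE:
  assumes "approximable M I e f" "g \<in> borel_measurable M" "AE x in M. f x = g x"
  shows "approximable M I e g"
  unfolding approximable_def
proof (intro conjI allI impI assms(2))
  fix \<epsilon> :: real assume "\<epsilon> > 0"
  then obtain F c where F: "finite F" "F \<subseteq> I"
    "sqint M (\<lambda>x. f x - (\<Sum>i\<in>F. c i * e i x)) < ennreal \<epsilon>"
    using assms(1) unfolding approximable_def by blast
  have "sqint M (\<lambda>x. g x - (\<Sum>i\<in>F. c i * e i x)) =
      sqint M (\<lambda>x. f x - (\<Sum>i\<in>F. c i * e i x))"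
    using assms(3) by (intro nn_integral_cong_AE) auto
  then show "\<exists>F c. finite F \<and> F \<subseteq> I \<and>
      sqint M (\<lambda>x. g x - (\<Sum>i\<in>F. c i * e i x)) < ennreal \<epsilon>"
    using F by (intro exI[of _ F] exI[of _ c]) auto
qed

lemma approximable_span:
  assumes "\<forall>i\<in>I. e i \<in> borel_measurable M" "finite F" "F \<subseteq> I"
  shows "approximable M I e (\<lambda>x. \<Sum>i\<in>F. c i * e i x)"
  unfolding approximable_def
proof (intro conjI allI impI)
  show "(\<lambda>x. \<Sum>i\<in>F. c i * e i x) \<in> borel_measurable M"
    using assms by (intro borel_measurable_sum borel_measurable_times) auto
  fix \<epsilon> :: real assume "\<epsilon> > 0"
  then show "\<exists>G d. finite G \<and> G \<subseteq> I \<and>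
      sqint M (\<lambda>x. (\<Sum>i\<in>F. c i * e i x) - (\<Sum>i\<in>G. d i * e i x)) < ennreal \<epsilon>"
    using assms(2,3) by (intro exI[of _ F] exI[of _ c]) auto
qed

lemma approximable_add:
  assumes e: "\<forall>i\<in>I. e i \<in> borel_measurable M"
    and "approximable M I e f" "approximable M I e g"
  shows "approximable M I e (\<lambda>x. f x + g x)"
  unfolding approximable_def
proof (intro conjI allI impI)
  have [measurable]: "f \<in> borel_measurable M" "g \<in> borel_measurable M"
    using assms by (auto simp: approximable_def)
  show "(\<lambda>x. f x + g x) \<in> borel_measurable M" by measurable
  fix \<epsilon> :: real assume "\<epsilon> > 0"
  then have pos: "\<epsilon> / 4 > 0" by simp
  obtain F c where F: "finite F" "F \<subseteq> I"
    "sqint M (\<lambda>x. f x - (\<Sum>i\<in>F. c i * e i x)) < ennreal (\<epsilon> / 4)"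
    using assms(2) pos unfolding approximable_def by blast
  obtain G d where G: "finite G" "G \<subseteq> I"
    "sqint M (\<lambda>x. g x - (\<Sum>i\<in>G. d i * e i x)) < ennreal (\<epsilon> / 4)"
    using assms(3) pos unfolding approximable_def by blast
  have [measurable]: "(\<lambda>x. \<Sum>i\<in>F. c i * e i x) \<in> borel_measurable M"
    "(\<lambda>x. \<Sum>i\<in>G. d i * e i x) \<in> borel_measurable M"
    using F G e by (auto intro!: borel_measurable_sum borel_measurable_times)
  define b where "b i = (if i \<in> F then c i else 0) + (if i \<in> G then d i else 0)" for i
  have b: "(\<Sum>i\<in>F \<union> G. b i * e i x) = (\<Sum>i\<in>F. c i * e i x) + (\<Sum>i\<in>G. d i * e i x)" for x
  proof -
    have "(\<Sum>i\<in>F \<union> G. b i * e i x) = (\<Sum>i\<in>F \<union> G. (if i \<in> F then c i * e i x else 0)) +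
       (\<Sum>i\<in>F \<union> G. (if i \<in> G then d i * e i x else 0))"
      unfolding sum.distrib[symmetric] by (intro sum.cong) (auto simp: b_def algebra_simps)
    also have "(\<Sum>i\<in>F \<union> G. (if i \<in> F then c i * e i x else 0)) = (\<Sum>i\<in>F. c i * e i x)"
      using F G by (subst sum.inter_restrict[symmetric]) (auto intro: arg_cong2[of _ _ _ _ sum])
    also have "(\<Sum>i\<in>F \<union> G. (if i \<in> G then d i * e i x else 0)) = (\<Sum>i\<in>G. d i * e i x)"
      using F G by (subst sum.inter_restrict[symmetric]) (auto intro: arg_cong2[of _ _ _ _ sum])
    finally show ?thesis .
  qed
  have "sqint M (\<lambda>x. f x + g x - (\<Sum>i\<in>F \<union> G. b i * e i x)) =
      sqint M (\<lambda>x. (f x - (\<Sum>i\<in>F. c i * e i x)) + (g x - (\<Sum>i\<in>G. d i * e i x)))"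
    unfolding b by (simp add: algebra_simps)
  also have "\<dots> \<le> 2 * sqint M (\<lambda>x. f x - (\<Sum>i\<in>F. c i * e i x)) +
      2 * sqint M (\<lambda>x. g x - (\<Sum>i\<in>G. d i * e i x))"
    by (rule nn_integral_square_add_le) measurable
  also have "\<dots> < ennreal \<epsilon>"
    using F(3) G(3) \<open>\<epsilon> > 0\<close> by (rule two_ennreal_less)
  finally show "\<exists>F c. finite F \<and> F \<subseteq> I \<and>
      sqint M (\<lambda>x. f x + g x - (\<Sum>i\<in>F. c i * e i x)) < ennreal \<epsilon>"
    using F G by (intro exI[of _ "F \<union> G"] exI[of _ b]) auto
qed

lemma approximable_scale:
  assumes e: "\<forall>i\<in>I. e i \<in> borel_measurable M" and "approximable M I e f"
  shows "approximable M I e (\<lambda>x. a * f x)"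
  unfolding approximable_def
proof (intro conjI allI impI)
  have [measurable]: "f \<in> borel_measurable M"
    using assms by (auto simp: approximable_def)
  show "(\<lambda>x. a * f x) \<in> borel_measurable M" by measurable
  fix \<epsilon> :: real assume "\<epsilon> > 0"
  \<comment> \<open>The summand 1 keeps the quotient meaningful for a = 0, and a^2 / (a^2 + 1) < 1
    gives the strict bound.\<close>
  then have pos: "\<epsilon> / (a\<^sup>2 + 1) > 0" by (simp add: add_nonneg_pos)
  obtain F c where F: "finite F" "F \<subseteq> I"
    "sqint M (\<lambda>x. f x - (\<Sum>i\<in>F. c i * e i x)) < ennreal (\<epsilon> / (a\<^sup>2 + 1))"
    using assms(2) pos unfolding approximable_def by blast
  have [measurable]: "(\<lambda>x. \<Sum>i\<in>F. c i * e i x) \<in> borel_measurable M"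
    using F e by (intro borel_measurable_sum borel_measurable_times) auto
  have "sqint M (\<lambda>x. a * f x - (\<Sum>i\<in>F. a * c i * e i x)) =
      (\<integral>\<^sup>+x. ennreal (a\<^sup>2) * ennreal ((f x - (\<Sum>i\<in>F. c i * e i x))\<^sup>2) \<partial>M)"
    by (simp add: ennreal_mult'[symmetric] power_mult_distrib[symmetric] right_diff_distrib
        sum_distrib_left mult.assoc)
  also have "\<dots> = ennreal (a\<^sup>2) * sqint M (\<lambda>x. f x - (\<Sum>i\<in>F. c i * e i x))"
    by (rule nn_integral_cmult) measurable
  also have "\<dots> \<le> ennreal (a\<^sup>2) * ennreal (\<epsilon> / (a\<^sup>2 + 1))"
    using F(3) by (intro mult_left_mono) auto
  also have "\<dots> = ennreal (a\<^sup>2 * (\<epsilon> / (a\<^sup>2 + 1)))"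
    using pos by (intro ennreal_mult[symmetric]) auto
  also have "\<dots> < ennreal \<epsilon>"
  proof (rule ennreal_lessI)
    have "a\<^sup>2 + 1 > 0" using zero_le_power2[of a] by linarith
    then show "a\<^sup>2 * (\<epsilon> / (a\<^sup>2 + 1)) < \<epsilon>"
      using \<open>\<epsilon> > 0\<close> by (simp add: pos_divide_less_eq algebra_simps)
  qed fact
  finally show "\<exists>F c. finite F \<and> F \<subseteq> I \<and>
      sqint M (\<lambda>x. a * f x - (\<Sum>i\<in>F. c i * e i x)) < ennreal \<epsilon>"
    using F by (intro exI[of _ F] exI[of _ "\<lambda>i. a * c i"]) auto
qed

lemma approximable_sum:
  assumes e: "\<forall>i\<in>I. e i \<in> borel_measurable M"
    and "finite X" "\<And>y. y \<in> X \<Longrightarrow> approximable M I e (f y)"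
  shows "approximable M I e (\<lambda>x. \<Sum>y\<in>X. c y * f y x)"
  using assms(2,3)
proof (induction X rule: finite_induct)
  case empty
  then show ?case using approximable_span[OF e, of "{}"] by simp
next
  case (insert a X)
  then show ?case
    using approximable_add[OF e approximable_scale[OF e] insert.IH, of "f a" "c a"] by simp
qed

lemma approximable_diff:
  assumes e: "\<forall>i\<in>I. e i \<in> borel_measurable M"
    and "approximable M I e f" "approximable M I e g"
  shows "approximable M I e (\<lambda>x. f x - g x)"
  using approximable_add[OF e assms(2) approximable_scale[OF e assms(3), of "-1"]] by simp

subsection \<open>Density of the span of the boxes\<close>

text \<open>Boxes are stable under intersection and generate the Borel sets, so a Dynkin induction
  carries approximability from boxes to bounded Borel sets; simple functions and dominated
  convergence do the rest.\<close>

lemma approximable_if_boxes: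
  fixes e :: "'i \<Rightarrow> 'a::euclidean_space \<Rightarrow> real"
  assumes e: "\<forall>i\<in>I. e i \<in> borel_measurable lborel"
    and box: "\<And>a b. approximable lborel I e (indicator (box a b))"
    and f[measurable]: "f \<in> borel_measurable lborel"
    and fin: "sqint lborel f < \<infinity>"
  shows "approximable lborel I e f"
proof -
  define Q :: "nat \<Rightarrow> 'a set" where "Q n = box (- real n *\<^sub>R One) (real n *\<^sub>R One)" for n
  have [measurable]: "Q n \<in> sets borel" for n by (simp add: Q_def)
  have Qfin: "emeasure lborel (Q n) < \<infinity>" for n
    unfolding Q_def by (rule emeasure_bounded_finite) simp
  \<comment> \<open>Cutting with the cube \<open>Q n\<close> keeps all sets of finite measure,
    without which the complement step would leave the square integrable functions. On boxes the cut
    is harmless, since a box meets \<open>Q n\<close> in a box.\<close>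
  have borel: "approximable lborel I e (indicator (E \<inter> Q n))" if "E \<in> sets borel" for E n
  proof -
    have "Int_stable (range (\<lambda>(a, b). box a b :: 'a set))"
      by (auto simp: Int_stable_def box_Int_box)
    moreover note subset_UNIV[of "range (\<lambda>(a, b). box a b :: 'a set)", folded Pow_UNIV]
    moreover have "E \<in> sigma_sets UNIV (range (\<lambda>(a, b). box a b :: 'a set))"
      using that borel_eq_box[where 'a='a] by (metis sets_measure_of top_greatest Pow_UNIV)
    ultimately show ?thesis
    proof (induction rule: sigma_sets_induct_disjoint)
      case (basic A)
      then obtain a b where "A = box a b" by auto
      then show ?case using box by (simp add: Q_def box_Int_box)
    next
      case empty
      then show ?case using approximable_span[OF e, of "{}"] by (simp add: indicator_def)
    next
      case (compl A)
      have "indicator ((UNIV - A) \<inter> Q n) = (\<lambda>x. indicator (Q n) x - indicator (A \<inter> Q n) x :: real)"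
        by (auto simp: indicator_def)
      then show ?case
        using approximable_diff[OF e _ compl.IH, of "indicator (Q n)"] box by (simp add: Q_def)
    next
      case (union A)
      have A: "A i \<in> sets borel" for i
        using union(2) borel_eq_box[where 'a='a] by (metis UNIV_I image_subset_iff sets_measure_of top_greatest Pow_UNIV)
      define g where "g k x = (\<Sum>i<k. indicator (A i \<inter> Q n) x :: real)" for k :: nat and x
      have g: "g k = indicator ((\<Union>i<k. A i) \<inter> Q n)" for k
      proof
        fix x
        have "g k x = (\<Sum>i<k. indicator (A i) x) * indicator (Q n) x"
          by (simp add: g_def indicator_inter_arith sum_distrib_right)
        also have "(\<Sum>i<k. indicator (A i) x :: real) = indicator (\<Union>i<k. A i) x"
          using union(1) by (intro indicator_UN_disjoint[symmetric])
            (auto simp: disjoint_family_on_def)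
        finally show "g k x = indicator ((\<Union>i<k. A i) \<inter> Q n) x"
          by (simp add: indicator_inter_arith)
      qed
      have [measurable]: "g k \<in> borel_measurable lborel" for k
        unfolding g using A by (auto intro!: borel_measurable_indicator)
      show ?case
      proof (rule approximable_tendsto[OF e, where g = g])
        show "indicator (\<Union> (range A) \<inter> Q n) \<in> borel_measurable lborel"
          using A by (auto intro!: borel_measurable_indicator)
        show "approximable lborel I e (g k)" for k
          using approximable_sum[OF e finite_lessThan, of k "\<lambda>i. indicator (A i \<inter> Q n)" "\<lambda>_. 1"] union.IH
          by (simp add: g_def[abs_def])
        have "(\<lambda>k. sqint lborel (\<lambda>x. indicator (\<Union> (range A) \<inter> Q n) x - g k x)) \<longlonglongrightarrow>
            (\<integral>\<^sup>+x. 0 \<partial>(lborel::'a measure))"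
        proof (rule nn_integral_dominated_convergence[where w = "indicator (Q n)"])
          show "(\<integral>\<^sup>+ x. indicator (Q n) x \<partial>lborel) < \<infinity>"
            using Qfin by (simp add: nn_integral_indicator)
          show "AE x in lborel. ennreal ((indicator (\<Union> (range A) \<inter> Q n) x - g k x)\<^sup>2) \<le> indicator (Q n) x" for k
            unfolding g by (auto simp: indicator_def)
          show "AE x in lborel. (\<lambda>k. ennreal ((indicator (\<Union> (range A) \<inter> Q n) x - g k x)\<^sup>2)) \<longlonglongrightarrow> 0"
          proof (rule AE_I2)
            fix x :: 'a
            obtain i where "x \<in> \<Union> (range A) \<Longrightarrow> x \<in> A i" by blast
            then have "eventually (\<lambda>k. ennreal ((indicator (\<Union> (range A) \<inter> Q n) x - g k x)\<^sup>2) = 0) sequentially"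
              unfolding g by (intro eventually_sequentiallyI[of "Suc i"])
                (auto simp: indicator_def Suc_le_eq)
            then show "(\<lambda>k. ennreal ((indicator (\<Union> (range A) \<inter> Q n) x - g k x)\<^sup>2)) \<longlonglongrightarrow> 0"
              by (rule tendsto_eventually)
          qed
        qed (use A in auto)
        then show "(\<lambda>k. sqint lborel (\<lambda>x. indicator (\<Union> (range A) \<inter> Q n) x - g k x)) \<longlonglongrightarrow> 0"
          by simp
      qed
    qed
  qed
  \<comment> \<open>The bound |G| \<le> 2 |f| survives the cut to \<open>Q n\<close> and gives |f -
    g| \<le> 3 |f|; hence the dominating function 9 f^2.\<close>
  obtain G where G: "\<And>i. simple_function lborel (G i)" "\<And>x. (\<lambda>i. G i x) \<longlonglongrightarrow> f x"
    "\<And>i x. dist (G i x) 0 \<le> 2 * dist (f x) 0"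
    using borel_measurable_implies_sequence_metric[OF f, of 0] by auto
  have [measurable]: "G i \<in> borel_measurable lborel" for i
    using G(1) by (rule borel_measurable_simple_function)
  define g where "g n x = G n x * indicator (Q n) x" for n x
  show ?thesis
  proof (rule approximable_tendsto[OF e f, where g = g])
    fix n
    have "g n x = (\<Sum>y\<in>range (G n). y * indicator (G n -` {y} \<inter> Q n) x)" for x
    proof -
      have fin: "finite (range (G n))"
        using G(1)[of n] by (simp add: simple_function_def)
      have "(\<Sum>y\<in>range (G n). y * indicator (G n -` {y} \<inter> Q n) x) =
          (\<Sum>y\<in>range (G n). if y = G n x then y * indicator (Q n) x else 0)"
        by (intro sum.cong) (auto simp: indicator_def)
      then show ?thesis
        using fin by (simp add: g_def)
    qed
    then have "g n = (\<lambda>x. \<Sum>y\<in>range (G n). y * indicator (G n -` {y} \<inter> Q n) x)" by blast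
    moreover have "G n -` {y} \<in> sets borel" for y
      using measurable_sets[of "G n" lborel borel "{y}"] by simp
    ultimately show "approximable lborel I e (g n)"
      using approximable_sum[OF e simple_functionD(1)[OF G(1)[of n]],
        of "\<lambda>y. indicator (G n -` {y} \<inter> Q n)" "\<lambda>y. y"] borel
      by simp
  next
    have "(\<lambda>n. sqint lborel (\<lambda>x. f x - g n x)) \<longlonglongrightarrow> (\<integral>\<^sup>+x. 0 \<partial>(lborel::'a measure))"
    proof (rule nn_integral_dominated_convergence[where w = "\<lambda>x. 9 * ennreal ((f x)\<^sup>2)"])
      show "(\<integral>\<^sup>+ x. 9 * ennreal ((f x)\<^sup>2) \<partial>lborel) < \<infinity>"
        using fin by (simp add: nn_integral_cmult ennreal_mult_less_top)
      show "AE x in lborel. ennreal ((f x - g n x)\<^sup>2) \<le> 9 * ennreal ((f x)\<^sup>2)" for n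
      proof (rule AE_I2)
        fix x
        have "\<bar>G n x\<bar> \<le> 2 * \<bar>f x\<bar>" using G(3)[of n x] by simp
        then have "\<bar>f x - g n x\<bar> \<le> \<bar>3 * f x\<bar>"
          by (auto simp: g_def indicator_def abs_le_iff)
        then have "(f x - g n x)\<^sup>2 \<le> 9 * (f x)\<^sup>2"
          by (simp add: abs_le_square_iff power_mult_distrib)
        then have "ennreal ((f x - g n x)\<^sup>2) \<le> ennreal (9 * (f x)\<^sup>2)" by (rule ennreal_leI)
        then show "ennreal ((f x - g n x)\<^sup>2) \<le> 9 * ennreal ((f x)\<^sup>2)"
          by (simp add: ennreal_mult)
      qed
      show "AE x in lborel. (\<lambda>n. ennreal ((f x - g n x)\<^sup>2)) \<longlonglongrightarrow> 0"
      proof (rule AE_I2)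
        fix x :: 'a
        obtain N :: nat where N: "norm x < real N" using reals_Archimedean2 by blast
        have "eventually (\<lambda>n. G n x = g n x) sequentially"
        proof (rule eventually_sequentiallyI[of N])
          fix n assume "N \<le> n"
          then have "\<bar>x \<bullet> i\<bar> < real n" if "i \<in> Basis" for i
            using Basis_le_norm[OF that, of x] N by linarith
          then have "x \<in> Q n" by (auto simp: Q_def mem_box abs_less_iff) (smt (verit))+
          then show "G n x = g n x" by (simp add: g_def)
        qed
        then have "(\<lambda>n. g n x) \<longlonglongrightarrow> f x"
          using G(2)[of x] by (rule Lim_transform_eventually[rotated])
        then have "(\<lambda>n. ennreal ((f x - g n x)\<^sup>2)) \<longlonglongrightarrow> ennreal ((f x - f x)\<^sup>2)"
          by (intro tendsto_intros tendsto_ennrealI)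
        then show "(\<lambda>n. ennreal ((f x - g n x)\<^sup>2)) \<longlonglongrightarrow> 0" by simp
      qed
    qed (auto simp: g_def[abs_def])
    then show "(\<lambda>n. sqint lborel (\<lambda>x. f x - g n x)) \<longlonglongrightarrow> 0" by simp
  qed
qed

subsection \<open>Lebesgue measure as a product over a set of coordinates\<close>

lemmas cart_eq_iff = Finite_Cartesian_Product.vec_eq_iff

text \<open>Lebesgue measure on the coordinates in \<open>S\<close>, carried by the whole space: the other coordinates
  are confined to an interval of length \<open>1\<close>, so that no type of dimension \<open>card S\<close> is needed.\<close>

definition slab :: "'n set \<Rightarrow> (real^'n) measure" where
  "slab S = density lborel (indicator {x. \<forall>i. i \<notin> S \<longrightarrow> 0 < x $ i \<and> x $ i < 1})"

definition glue :: "'n set \<Rightarrow> real^'n \<Rightarrow> real^'n \<Rightarrow> real^'n" where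
  "glue S x y = (\<chi> i. if i \<in> S then x $ i else y $ i)"

definition depends_on :: "'n set \<Rightarrow> (real^'n \<Rightarrow> 'b) \<Rightarrow> bool" where
  "depends_on S f \<longleftrightarrow> (\<forall>x y. (\<forall>i\<in>S. x $ i = y $ i) \<longrightarrow> f x = f y)"

lemma slab_eq_box:
  "{x :: real^'n. \<forall>i. i \<notin> S \<longrightarrow> l $ i < x $ i \<and> x $ i < u $ i} \<in> sets borel"
proof -
  have "{x :: real^'n. \<forall>i. i \<notin> S \<longrightarrow> l $ i < x $ i \<and> x $ i < u $ i} =
     (\<Inter>i\<in>-S. {x. l $ i < x $ i} \<inter> {x. x $ i < u $ i})" by auto
  moreover have "open \<dots>"
    by (intro open_INT ballI open_Int open_Collect_less continuous_intros) auto
  ultimately show ?thesis by simp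
qed

lemma slab_sets [measurable]:
  "{x :: real^'n. \<forall>i. i \<notin> S \<longrightarrow> 0 < x $ i \<and> x $ i < 1} \<in> sets borel"
  using slab_eq_box[of S 0 1] by simp

lemma sets_slab [simp, measurable_cong]: "sets (slab S) = sets borel"
  by (simp add: slab_def)

lemma space_slab [simp]: "space (slab S) = UNIV"
  by (simp add: slab_def)

lemma emeasure_slab:
  assumes "E \<in> sets borel"
  shows "emeasure (slab S) E =
    emeasure lborel (E \<inter> {x. \<forall>i. i \<notin> S \<longrightarrow> 0 < x $ i \<and> x $ i < 1})"
  using assms by (simp add: slab_def emeasure_density indicator_inter_arith[symmetric]
      Int_commute)

lemma prod_Basis_cart: "(\<Prod>b\<in>Basis. inner x b) = (\<Prod>i\<in>UNIV. x $ i)" for x :: "real^'n"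
  by (rule prod.reindex_bij_witness[of _ "\<lambda>i. axis i 1" "\<lambda>b. SOME i. b = axis i 1"])
    (auto simp: Basis_vec_def inner_axis axis_eq_axis)

lemma emeasure_slab_box:
  fixes l u :: "real^'n"
  assumes "\<And>i. i \<in> S \<Longrightarrow> l $ i \<le> u $ i"
  shows "emeasure (slab S) {x. \<forall>i\<in>S. l $ i < x $ i \<and> x $ i < u $ i} =
    ennreal (\<Prod>i\<in>S. u $ i - l $ i)"
proof -
  have "{x :: real^'n. \<forall>i\<in>S. l $ i < x $ i \<and> x $ i < u $ i} \<in> sets borel"
    using slab_eq_box[of "- S" l u] by (simp add: Ball_def)
  then have "emeasure (slab S) {x. \<forall>i\<in>S. l $ i < x $ i \<and> x $ i < u $ i} =
      emeasure lborel (box (glue S l 0) (glue S u 1))"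
    by (subst emeasure_slab)
      (auto simp: mem_box_cart glue_def split: if_splits intro!: arg_cong[where f = "emeasure lborel"])
  also have "\<dots> = ennreal (\<Prod>b\<in>Basis. (glue S u 1 - glue S l 0) \<bullet> b)"
    using assms by (subst emeasure_lborel_box) (auto simp: glue_def Basis_vec_def inner_axis)
  also have "(\<Prod>b\<in>Basis. (glue S u 1 - glue S l 0) \<bullet> b) =
      (\<Prod>i\<in>UNIV. (glue S u 1 - glue S l 0) $ i)"
    by (rule prod_Basis_cart)
  also have "\<dots> = (\<Prod>i\<in>UNIV. if i \<in> S then u $ i - l $ i else 1)"
    by (intro prod.cong) (auto simp: glue_def)
  also have "\<dots> = (\<Prod>i\<in>S. u $ i - l $ i)"
    by (simp add: prod.If_cases)
  finally show ?thesis .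
qed

lemma sigma_finite_slab: "sigma_finite_measure (slab S :: (real^'n) measure)"
  unfolding slab_def
  by (subst sigma_finite_measure.sigma_finite_iff_density_finite'[OF sigma_finite_lborel]) (auto simp: indicator_def)

lemma continuous_on_glue:
  fixes f g :: "'a::topological_space \<Rightarrow> real^'n"
  assumes "continuous_on T f" "continuous_on T g"
  shows "continuous_on T (\<lambda>x. glue S (f x) (g x))"
  unfolding glue_def
proof (rule continuous_on_vec_lambda)
  fix i
  show "continuous_on T (\<lambda>x. if i \<in> S then f x $ i else g x $ i)"
    using assms by (cases "i \<in> S") (auto intro!: continuous_intros)
qed

lemma measurable_glue [measurable]:
  "(\<lambda>(x :: real^'n, y). glue S x y) \<in> borel_measurable (slab S' \<Otimes>\<^sub>M slab S'')"
proof -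
  have "continuous_on UNIV (\<lambda>p :: (real^'n) \<times> (real^'n). glue S (fst p) (snd p))"
    by (intro continuous_on_glue continuous_intros)
  then have "(\<lambda>p. glue S (fst p) (snd p)) \<in> borel_measurable borel"
    by (rule borel_measurable_continuous_onI)
  moreover have "sets (slab S' \<Otimes>\<^sub>M slab S'' :: ((real^'n) \<times> (real^'n)) measure) =
      sets borel"
    unfolding borel_prod[symmetric] by (rule sets_pair_measure_cong) auto
  ultimately show ?thesis
    unfolding case_prod_unfold by (metis measurable_cong_sets)
qed

text \<open>It suffices to compare boxes: a box restricts the coordinates in S and those outside
  independently, and the coordinates that a slab merely carries along range over a unit interval and
  contribute the factor 1.\<close>

lemma lborel_eq_glue:
  "(lborel :: (real^'n) measure) =
    distr (slab S \<Otimes>\<^sub>M slab (- S)) borel (\<lambda>(x, y). glue S x y)"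
proof (rule lborel_eqI)
  fix l u :: "real^'n"
  assume lu: "\<And>b. b \<in> Basis \<Longrightarrow> l \<bullet> b \<le> u \<bullet> b"
  have lu: "l $ i \<le> u $ i" for i
    using lu[of "axis i 1"] by (simp add: inner_axis axis_in_Basis_iff)
  interpret sigma_finite_measure "slab (- S) :: (real^'n) measure"
    by (rule sigma_finite_slab)
  have s: "{x :: real^'n. \<forall>i\<in>T. l $ i < x $ i \<and> x $ i < u $ i} \<in> sets borel" for T
    using slab_eq_box[of "- T" l u] by (simp add: Ball_def)
  have "emeasure (distr (slab S \<Otimes>\<^sub>M slab (- S)) borel (\<lambda>(x, y). glue S x y)) (box l u) =
      emeasure (slab S \<Otimes>\<^sub>M slab (- S))
        ({x. \<forall>i\<in>S. l $ i < x $ i \<and> x $ i < u $ i} \<times> {x. \<forall>i\<in>-S. l $ i < x $ i \<and> x $ i < u $ i})"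
    by (subst emeasure_distr)
      (auto simp: mem_box_cart glue_def space_pair_measure split: if_splits intro!: arg_cong2[where f = emeasure])
  also have "\<dots> = emeasure (slab S) {x. \<forall>i\<in>S. l $ i < x $ i \<and> x $ i < u $ i} *
      emeasure (slab (- S)) {x. \<forall>i\<in>-S. l $ i < x $ i \<and> x $ i < u $ i}"
    using s by (intro emeasure_pair_measure_Times) auto
  also have "\<dots> = ennreal ((\<Prod>i\<in>S. u $ i - l $ i) * (\<Prod>i\<in>-S. u $ i - l $ i))"
    using lu by (simp add: emeasure_slab_box ennreal_mult prod_nonneg)
  also have "(\<Prod>i\<in>S. u $ i - l $ i) * (\<Prod>i\<in>-S. u $ i - l $ i) = (\<Prod>i\<in>UNIV. u $ i - l $ i)"
    by (subst prod.union_disjoint[symmetric]) (auto simp: Compl_partition)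
  also have "\<dots> = (\<Prod>b\<in>Basis. (u - l) \<bullet> b)"
    by (simp add: prod_Basis_cart)
  finally show "emeasure (distr (slab S \<Otimes>\<^sub>M slab (- S)) borel (\<lambda>(x, y). glue S x y)) (box l u) =
    ennreal (\<Prod>b\<in>Basis. (u - l) \<bullet> b)" .
qed simp

lemma depends_on_glue:
  "depends_on S f \<Longrightarrow> f (glue S x y) = f x" "depends_on (- S) g \<Longrightarrow> g (glue S x y) = g y"
  unfolding depends_on_def by (auto simp: glue_def)

lemma nn_integral_tensor:
  fixes f g :: "real^'n \<Rightarrow> ennreal"
  assumes "depends_on S f" "depends_on (- S) g"
    and [measurable]: "f \<in> borel_measurable borel" "g \<in> borel_measurable borel"
  shows "(\<integral>\<^sup>+x. f x * g x \<partial>lborel) =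
    (\<integral>\<^sup>+x. f x \<partial>slab S) * (\<integral>\<^sup>+x. g x \<partial>slab (- S))"
proof -
  interpret sigma_finite_measure "slab (- S) :: (real^'n) measure"
    by (rule sigma_finite_slab)
  have "(\<integral>\<^sup>+x. f x * g x \<partial>lborel) =
      (\<integral>\<^sup>+z. f (fst z) * g (snd z) \<partial>(slab S \<Otimes>\<^sub>M slab (- S)))"
    using assms(1,2)
    by (subst lborel_eq_glue[of S], subst nn_integral_distr) (auto simp: depends_on_glue case_prod_unfold)
  also have "\<dots> = (\<integral>\<^sup>+x. \<integral>\<^sup>+y. f x * g y \<partial>slab (- S) \<partial>slab S)"
    by (subst nn_integral_fst[symmetric]) simp_all
  also have "\<dots> = (\<integral>\<^sup>+x. f x \<partial>slab S) * (\<integral>\<^sup>+x. g x \<partial>slab (- S))"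
    by (simp add: nn_integral_cmult nn_integral_multc)
  finally show ?thesis .
qed

lemma integral_tensor:
  fixes f g :: "real^'n \<Rightarrow> real"
  assumes "depends_on S f" "depends_on (- S) g"
    and f: "integrable (slab S) f" and g: "integrable (slab (- S)) g"
  shows "integrable lborel (\<lambda>x. f x * g x)"
    and "(\<integral>x. f x * g x \<partial>lborel) =
      (\<integral>x. f x \<partial>slab S) * (\<integral>x. g x \<partial>slab (- S))"
proof -
  interpret A: sigma_finite_measure "slab S :: (real^'n) measure"
    by (rule sigma_finite_slab)
  interpret B: sigma_finite_measure "slab (- S) :: (real^'n) measure"
    by (rule sigma_finite_slab)
  interpret pair_sigma_finite "slab S :: (real^'n) measure" "slab (- S)" ..
  have [measurable]: "f \<in> borel_measurable borel" "g \<in> borel_measurable borel"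
    using f g by (auto dest!: borel_measurable_integrable cong: measurable_cong_sets)
  have int: "integrable (slab S \<Otimes>\<^sub>M slab (- S)) (\<lambda>z. f (fst z) * g (snd z))"
    using f g by (intro Fubini_integrable) (auto simp: abs_mult)
  then show "integrable lborel (\<lambda>x. f x * g x)"
    using assms(1,2)
    by (subst lborel_eq_glue[of S], subst integrable_distr_eq) (auto simp: depends_on_glue case_prod_unfold)
  have "(\<integral>x. f x * g x \<partial>lborel) =
      (\<integral>z. f (fst z) * g (snd z) \<partial>(slab S \<Otimes>\<^sub>M slab (- S)))"
    using assms(1,2)
    by (subst lborel_eq_glue[of S], subst integral_distr) (auto simp: depends_on_glue case_prod_unfold)
  also have "\<dots> = (\<integral>x. f x \<partial>slab S) * (\<integral>x. g x \<partial>slab (- S))"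
    using int by (subst integral_fst'[symmetric]) auto
  finally show "(\<integral>x. f x * g x \<partial>lborel) =
      (\<integral>x. f x \<partial>slab S) * (\<integral>x. g x \<partial>slab (- S))" .
qed

subsection \<open>Orthonormal mean-zero functions on a finite weighted set\<close>

text \<open>Induction on the set. An added point \<open>a\<close> brings one new function, with one
  value on X and another at \<open>a\<close>, their ratio being fixed by mean zero. It is orthogonal
  to the old ones because these have mean zero on X and are extended by 0 to
  \<open>a\<close>.\<close>

lemma weighted_haar_functions:
  fixes w :: "'a \<Rightarrow> real"
  assumes "finite X" "X \<noteq> {}" "\<And>x. x \<in> X \<Longrightarrow> w x > 0"
  shows "\<exists>N (h :: nat \<Rightarrow> 'a \<Rightarrow> real).
    (\<forall>j<N. (\<Sum>x\<in>X. w x * h j x) = 0) \<and>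
    (\<forall>j<N. \<forall>k<N. (\<Sum>x\<in>X. w x * (h j x * h k x)) = (if j = k then 1 else 0)) \<and>
    (\<forall>g. (\<Sum>x\<in>X. w x * g x) = 0 \<longrightarrow> (\<exists>c. \<forall>x\<in>X. g x = (\<Sum>j<N. c j * h j x)))"
  using assms
proof (induction X rule: finite_ne_induct)
  case (singleton a)
  then show ?case by (intro exI[of _ 0]) auto
next
  case (insert a X)
  then obtain N and h :: "nat \<Rightarrow> 'a \<Rightarrow> real" where
    h0: "\<And>j. j < N \<Longrightarrow> (\<Sum>x\<in>X. w x * h j x) = 0" and
    h1: "\<And>j k. j < N \<Longrightarrow> k < N \<Longrightarrow> (\<Sum>x\<in>X. w x * (h j x * h k x)) = (if j = k then 1 else 0)" and
    h2: "\<And>g. (\<Sum>x\<in>X. w x * g x) = 0 \<Longrightarrow> \<exists>c. \<forall>x\<in>X. g x = (\<Sum>j<N. c j * h j x)"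
    using insert.IH insert.prems by (simp only: insert_iff) blast
  define W where "W = sum w X"
  define v where "v = w a"
  have W: "W > 0" unfolding W_def using insert by (intro sum_pos) auto
  have v: "v > 0" unfolding v_def using insert by auto
  \<comment> \<open>With the values v t on X and - W t at \<open>a\<close> the squared norm is W (v
    t)^2 + v (W t)^2 = W v (W + v) t^2, so this t normalizes the new function.\<close>
  define t where "t = 1 / sqrt (W * v * (W + v))"
  have t0: "t > 0" unfolding t_def using W v by simp
  have t: "W * (v * t)\<^sup>2 + v * (W * t)\<^sup>2 = 1"
  proof -
    have "t\<^sup>2 = 1 / (W * v * (W + v))"
      unfolding t_def using W v by (simp add: power_divide)
    moreover have "W * (v * t)\<^sup>2 + v * (W * t)\<^sup>2 = (W * v * (W + v)) * t\<^sup>2"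
      by (simp add: power2_eq_square algebra_simps)
    moreover have "W * v * (W + v) \<noteq> 0" using W v by simp
    ultimately show ?thesis by simp
  qed
  define h' where "h' j x = (if j < N then (if x = a then 0 else h j x)
      else if x = a then - W * t else v * t)" for j x
  have X: "(\<Sum>x\<in>X. f x) = (\<Sum>x\<in>X. g x)" if "\<And>x. x \<in> X \<Longrightarrow> x \<noteq> a \<Longrightarrow> f x = g x" for f g :: "'a \<Rightarrow> real"
    using insert that by (intro sum.cong) auto
  have s: "(\<Sum>x\<in>insert a X. f x) = f a + (\<Sum>x\<in>X. f x)" for f :: "'a \<Rightarrow> real"
    using insert by simp
  have XN: "(\<Sum>x\<in>X. w x * (f x * h' N x)) = (\<Sum>x\<in>X. w x * f x) * (v * t)" for f
    unfolding sum_distrib_right by (rule X) (simp add: h'_def)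
  have Xj: "(\<Sum>x\<in>X. w x * (f x * h' j x)) = (\<Sum>x\<in>X. w x * (f x * h j x))" if "j < N" for f j
    by (rule X) (simp add: h'_def that)
  have a0: "(\<Sum>x\<in>insert a X. w x * h' j x) = 0" if "j < Suc N" for j
  proof (cases "j = N")
    case True
    then show ?thesis
      using XN[of "\<lambda>_. 1"] unfolding s by (simp add: h'_def W_def v_def)
  next
    case False
    then show ?thesis
      using that Xj[of j "\<lambda>_. 1"] h0[of j] unfolding s by (simp add: h'_def)
  qed
  have a1: "(\<Sum>x\<in>insert a X. w x * (h' j x * h' k x)) = (if j = k then 1 else 0)"
    if jk: "j < Suc N" "k < Suc N" for j k
  proof -
    have sym: "(\<Sum>x\<in>insert a X. w x * (h' j x * h' N x)) = 0" if "j < N" for j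
    proof -
      have "(\<Sum>x\<in>X. w x * h' j x) = 0"
        using that Xj[of j "\<lambda>_. 1"] h0[of j] by simp
      then show ?thesis unfolding s XN using that by (simp add: h'_def)
    qed
    have NN: "(\<Sum>x\<in>insert a X. w x * (h' N x * h' N x)) = 1"
    proof -
      have "(\<Sum>x\<in>X. w x * h' N x) = W * (v * t)"
        using XN[of "\<lambda>_. 1"] by (simp add: W_def)
      then show ?thesis
        unfolding s XN using t by (simp add: h'_def v_def[symmetric] power2_eq_square algebra_simps)
    qed
    have jk': "(\<Sum>x\<in>insert a X. w x * (h' j x * h' k x)) = (if j = k then 1 else 0)"
      if "j < N" "k < N"
    proof -
      have "(\<Sum>x\<in>X. w x * (h' j x * h' k x)) = (\<Sum>x\<in>X. w x * (h j x * h k x))"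
        by (rule X) (simp add: h'_def that)
      then show ?thesis unfolding s using h1[OF that] that by (simp add: h'_def)
    qed
    consider "j < N" "k < N" | "j = N" "k < N" | "j < N" "k = N" | "j = N" "k = N"
      using jk by linarith
    then show ?thesis
      by cases (use sym[of k] sym[of j] NN jk' in \<open>simp_all add: mult.commute\<close>)
  qed
  have a2: "\<exists>c. \<forall>x\<in>insert a X. g x = (\<Sum>j<Suc N. c j * h' j x)"
    if g: "(\<Sum>x\<in>insert a X. w x * g x) = 0" for g
  proof -
    \<comment> \<open>The new function takes the value - W t at \<open>a\<close>, so b times it
      agrees with g there. The remainder vanishes at \<open>a\<close>, hence has mean zero on X
      alone, and the induction hypothesis applies.\<close>
    define b where "b = - g a / (W * t)"
    have "(\<Sum>x\<in>X. w x * (g x - b * (v * t))) = (\<Sum>x\<in>X. w x * g x) - W * (b * (v * t))"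
      by (simp add: W_def right_diff_distrib sum_subtractf sum_distrib_right)
    also have "\<dots> = 0"
      using g W t0 v unfolding s by (simp add: b_def v_def mult.commute)
    finally have "(\<Sum>x\<in>X. w x * (g x - b * (v * t))) = 0" .
    from h2[OF this] obtain c where c: "\<And>x. x \<in> X \<Longrightarrow> g x - b * (v * t) = (\<Sum>j<N. c j * h j x)"
      by blast
    define d where "d j = (if j < N then c j else b)" for j
    have "g x = (\<Sum>j<Suc N. d j * h' j x)" if "x \<in> insert a X" for x
    proof (cases "x = a")
      case True
      then show ?thesis using W t0 by (simp add: d_def h'_def b_def)
    next
      case False
      then have "(\<Sum>j<N. d j * h' j x) = (\<Sum>j<N. c j * h j x)"
        by (intro sum.cong) (auto simp: d_def h'_def)
      then show ?thesis using c[of x] that False by (simp add: d_def h'_def)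
    qed
    then show ?thesis by blast
  qed
  show ?case
    using a0 a1 a2 by (intro exI[of _ "Suc N"] exI[of _ h']) blast
qed

subsection \<open>Linear change of variables\<close>

lemma measurable_affine [measurable]:
  "(\<lambda>x :: real^'n. A *v x + z) \<in> borel_measurable borel"
  by (intro borel_measurable_continuous_onI continuous_intros matrix_vector_mult_linear_continuous_on)

lemma measurable_matrix_vector [measurable]:
  "(\<lambda>x :: real^'n. A *v x) \<in> borel_measurable borel"
  using measurable_affine[of A 0] by simp

lemma slab_translate:
  fixes z :: "real^'n"
  assumes z: "\<And>i. i \<notin> S \<Longrightarrow> z $ i = 0" and [measurable]: "f \<in> borel_measurable borel"
  shows "(\<integral>\<^sup>+x. f (x + z) \<partial>slab S) = (\<integral>\<^sup>+x. f x \<partial>slab S)"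
proof -
  let ?B = "{x. \<forall>i. i \<notin> S \<longrightarrow> 0 < x $ i \<and> x $ i < 1}"
  have "(\<integral>\<^sup>+x. f (x + z) \<partial>slab S) = (\<integral>\<^sup>+x. indicator ?B (z + x) * f (z + x) \<partial>lborel)"
    unfolding slab_def using z
    by (subst nn_integral_density) (auto simp: indicator_def add.commute intro!: nn_integral_cong)
  also have "\<dots> = (\<integral>\<^sup>+x. indicator ?B x * f x \<partial>distr lborel borel ((+) z))"
    by (subst nn_integral_distr) auto
  also have "\<dots> = (\<integral>\<^sup>+x. f x \<partial>slab S)"
    unfolding slab_def lborel_distr_plus by (subst nn_integral_density) auto
  finally show ?thesis .
qed

text \<open>The change of variables theorems of the library assume a well-ordered index type.\<close>

lemma emeasure_lborel_shear:
  fixes m n :: "'n::finite"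
  assumes mn: "m \<noteq> n" and E[measurable]: "E \<in> sets borel"
  shows "emeasure lborel {x. (\<chi> i. if i = m then x $ m + x $ n else x $ i) \<in> E} = emeasure lborel (E :: (real^'n) set)"
proof -
  let ?T = "\<lambda>x :: real^'n. x + axis m (x $ n)"
  interpret A: sigma_finite_measure "slab {m} :: (real^'n) measure"
    by (rule sigma_finite_slab)
  interpret B: sigma_finite_measure "slab (- {m}) :: (real^'n) measure"
    by (rule sigma_finite_slab)
  interpret pair_sigma_finite "slab {m} :: (real^'n) measure" "slab (- {m})" ..
  have T: "(\<chi> i. if i = m then x $ m + x $ n else x $ i) = ?T x" for x :: "real^'n"
    using mn by (auto simp: cart_eq_iff axis_def)
  have [measurable]: "?T \<in> borel_measurable borel"
    unfolding T[symmetric]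
  proof (intro borel_measurable_continuous_onI continuous_on_vec_lambda)
    fix i show "continuous_on UNIV (\<lambda>x :: real^'n. if i = m then x $ m + x $ n else x $ i)"
      by (cases "i = m") (auto intro!: continuous_intros)
  qed
  \<comment> \<open>With all coordinates but m frozen, the shear is a translation by y $ n in the
    direction m, under which \<open>slab {m}\<close> is invariant.\<close>
  have g: "?T (glue {m} x y) = glue {m} (x + axis m (y $ n)) y" for x y :: "real^'n"
    using mn by (auto simp: cart_eq_iff glue_def axis_def)
  have fub: "(\<integral>\<^sup>+x. F x \<partial>lborel) =
      (\<integral>\<^sup>+y. \<integral>\<^sup>+x. F (glue {m} x y) \<partial>slab {m} \<partial>slab (- {m}))"
    if [measurable]: "F \<in> borel_measurable borel" for F :: "real^'n \<Rightarrow> ennreal"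
    by (subst lborel_eq_glue[of "{m}"], subst nn_integral_distr)
      (auto simp: nn_integral_snd[symmetric] case_prod_unfold)
  have "emeasure lborel {x. ?T x \<in> E} = (\<integral>\<^sup>+x. indicator E (?T x) \<partial>lborel)"
    by (subst nn_integral_indicator[of "{x. ?T x \<in> E}", symmetric])
      (auto simp: indicator_def simp del: nn_integral_indicator intro!: nn_integral_cong)
  also have "\<dots> = (\<integral>\<^sup>+y. \<integral>\<^sup>+x. indicator E (glue {m} (x + axis m (y $ n)) y) \<partial>slab {m} \<partial>slab (- {m}))"
    by (subst fub) (auto simp: g)
  also have "\<dots> = (\<integral>\<^sup>+y. \<integral>\<^sup>+x. indicator E (glue {m} x y) \<partial>slab {m} \<partial>slab (- {m}))"
  proof (rule nn_integral_cong)
    fix y :: "real^'n"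
    have "continuous_on UNIV (\<lambda>x. glue {m} x y)"
      by (intro continuous_on_glue continuous_intros)
    then have "(\<lambda>x. glue {m} x y) \<in> borel_measurable borel"
      by (rule borel_measurable_continuous_onI)
    then have "(\<lambda>x. indicator E (glue {m} x y) :: ennreal) \<in> borel_measurable borel" by simp
    then show "(\<integral>\<^sup>+x. indicator E (glue {m} (x + axis m (y $ n)) y) \<partial>slab {m}) =
        (\<integral>\<^sup>+x. indicator E (glue {m} x y) \<partial>slab {m})"
      by (intro slab_translate[where f = "\<lambda>x. indicator E (glue {m} x y)"]) (auto simp: axis_def)
  qed
  also have "\<dots> = emeasure lborel E"
    by (subst fub[symmetric]) auto
  finally show ?thesis by (simp add: T)
qed

lemma emeasure_lborel_swap:
  fixes m n :: "'n::finite"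
  assumes "m \<noteq> n" and E[measurable]: "E \<in> sets borel"
  shows "emeasure lborel {x. (\<chi> i. x $ Transposition.transpose m n i) \<in> E} = emeasure lborel (E :: (real^'n) set)"
proof -
  let ?T = "\<lambda>x :: real^'n. \<chi> i. x $ Transposition.transpose m n i"
  have [measurable]: "?T \<in> borel_measurable borel"
    by (intro borel_measurable_continuous_onI continuous_intros)
  have "lborel = distr lborel borel ?T"
  proof (rule lborel_eqI)
    fix l u :: "real^'n"
    assume lu: "\<And>b. b \<in> Basis \<Longrightarrow> l \<bullet> b \<le> u \<bullet> b"
    have lu: "l $ i \<le> u $ i" for i
      using lu[of "axis i 1"] by (simp add: inner_axis axis_in_Basis_iff)
    have eq: "?T -` box l u = box (?T l) (?T u)"
      by (auto simp: mem_box_cart) (metis transpose_involutory)+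
    have "emeasure (distr lborel borel ?T) (box l u) = emeasure lborel (box (?T l) (?T u))"
      by (subst emeasure_distr) (auto simp: eq)
    also have "\<dots> = ennreal (\<Prod>b\<in>Basis. (?T u - ?T l) \<bullet> b)"
      using lu by (subst emeasure_lborel_box) (auto simp: Basis_vec_def inner_axis)
    also have "(\<Prod>b\<in>Basis. (?T u - ?T l) \<bullet> b) = (\<Prod>b\<in>Basis. (u - l) \<bullet> b)"
      unfolding prod_Basis_cart
      by (rule prod.reindex_bij_witness[of _ "Transposition.transpose m n" "Transposition.transpose m n"]) auto
    finally show "emeasure (distr lborel borel ?T) (box l u) = ennreal (\<Prod>b\<in>Basis. (u - l) \<bullet> b)" .
  qed simp
  then have "emeasure lborel E = emeasure (distr lborel borel ?T) E" by simp
  also have "\<dots> = emeasure lborel {x. ?T x \<in> E}"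
    by (subst emeasure_distr) (auto simp: vimage_def)
  finally show ?thesis by simp
qed

lemma emeasure_lborel_diagonal:
  fixes A :: "real^'n^'n"
  assumes 3: "\<And>i j. i \<noteq> j \<Longrightarrow> A $ i $ j = 0" and d: "mdet A \<noteq> 0" and E: "E \<in> sets borel"
  shows "emeasure lborel E = ennreal \<bar>mdet A\<bar> * emeasure lborel {x. A *v x \<in> E}"
proof -
  have det: "mdet A = (\<Prod>i\<in>UNIV. A $ i $ i)" using 3 by (rule det_diagonal)
  define c where "c b = A $ (SOME i. b = axis i (1::real)) $ (SOME i. b = axis i (1::real))" for b :: "real^'n"
  have c: "c (axis i 1) = A $ i $ i" for i by (simp add: c_def axis_eq_axis)
  have T: "0 + (\<Sum>j\<in>Basis. (c j * (x \<bullet> j)) *\<^sub>R j) = A *v x" for x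
  proof -
    have "(\<Sum>j\<in>Basis. (c j * (x \<bullet> j)) *\<^sub>R j) = (\<Sum>i\<in>UNIV. (A $ i $ i * x $ i) *\<^sub>R axis i 1)"
      by (rule sum.reindex_bij_witness[of _ "\<lambda>i. axis i 1" "\<lambda>b. SOME i. b = axis i 1"])
        (auto simp: Basis_vec_def inner_axis axis_eq_axis c)
    also have "\<dots> = A *v x"
    proof (simp add: cart_eq_iff axis_def if_distrib matrix_vector_mult_def cong: if_cong, intro allI)
      fix i
      have "(\<Sum>j\<in>UNIV. A $ i $ j * x $ j) = (\<Sum>j\<in>UNIV. if j = i then A $ i $ i * x $ i else 0)"
        using 3 by (intro sum.cong) auto
      then show "A $ i $ i * x $ i = (\<Sum>j\<in>UNIV. A $ i $ j * x $ j)" by simp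
    qed
    finally show ?thesis by simp
  qed
  have "c j \<noteq> 0" if "j \<in> Basis" for j
    using that d unfolding det by (auto simp: Basis_vec_def c)
  then have "lborel = density (distr lborel borel (\<lambda>x. 0 + (\<Sum>j\<in>Basis. (c j * (x \<bullet> j)) *\<^sub>R j)))
      (\<lambda>_. (\<Prod>j\<in>Basis. \<bar>c j\<bar>))"
    by (rule lborel_affine_euclidean)
  moreover have "(\<Prod>j\<in>Basis. \<bar>c j\<bar>) = \<bar>mdet A\<bar>"
    unfolding det abs_prod
    by (rule prod.reindex_bij_witness[of _ "\<lambda>i. axis i 1" "\<lambda>b. SOME i. b = axis i 1"])
      (auto simp: Basis_vec_def axis_eq_axis c)
  ultimately have "lborel = density (distr lborel borel (\<lambda>x. A *v x)) (\<lambda>_. \<bar>mdet A\<bar>)"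
    unfolding T by simp
  then have "emeasure lborel E = emeasure (density (distr lborel borel (\<lambda>x. A *v x)) (\<lambda>_. \<bar>mdet A\<bar>)) E"
    by simp
  also have "\<dots> = ennreal \<bar>mdet A\<bar> * emeasure lborel {x. A *v x \<in> E}"
    using E by (subst emeasure_density) (auto simp: nn_integral_cmult emeasure_distr vimage_def)
  finally show "emeasure lborel E = ennreal \<bar>mdet A\<bar> * emeasure lborel {x. A *v x \<in> E}" .
qed

text \<open>Row reduction: every matrix is a product of matrices that have a zero row, are diagonal,
  swap two coordinates or shear one along another, and the formula is multiplicative.\<close>

lemma emeasure_lborel_linear:
  fixes A :: "real^'n^'n"
  assumes "mdet A \<noteq> 0" "E \<in> sets borel"
  shows "emeasure lborel E = ennreal \<bar>mdet A\<bar> * emeasure lborel {x. A *v x \<in> E}"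
proof -
  \<comment> \<open>The determinant condition belongs inside the induction: it makes the factors
    with a zero row vacuous, and for a product it passes to both factors.\<close>
  have "mdet A \<noteq> 0 \<longrightarrow> (\<forall>E\<in>sets borel. emeasure lborel E =
      ennreal \<bar>mdet A\<bar> * emeasure lborel {x. A *v x \<in> E})"
  proof (induction A rule: induct_matrix_elementary_alt)
    case (1 A B)
    show ?case
    proof (intro impI ballI)
      fix E :: "(real^'n) set" assume d: "mdet (A ** B) \<noteq> 0" and E[measurable]: "E \<in> sets borel"
      have E': "{x. A *v x \<in> E} \<in> sets borel" by measurable
      have "mdet A \<noteq> 0" "mdet B \<noteq> 0" using d by (auto simp: det_mul)
      note A = 1(1)[rule_format, OF this(1) E] and B = 1(2)[rule_format, OF this(2) E']
      have "emeasure lborel E = ennreal \<bar>mdet A\<bar> *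
          (ennreal \<bar>mdet B\<bar> * emeasure lborel {x. B *v x \<in> {x. A *v x \<in> E}})"
        by (subst A, subst B) (rule refl)
      then show "emeasure lborel E = ennreal \<bar>mdet (A ** B)\<bar> * emeasure lborel {x. (A ** B) *v x \<in> E}"
        by (simp add: det_mul abs_mult ennreal_mult matrix_vector_mul_assoc mult.assoc)
    qed
  next
    case (2 A i)
    then show ?case using det_zero_row(1)[of i A] by simp
  next
    case (3 A)
    then show ?case using emeasure_lborel_diagonal[of A] by blast
  next
    case (4 m n)
    define M :: "real^'n^'n" where "M = (\<chi> i j. id_mat $ i $ Transposition.transpose m n j)"
    have Ax: "M *v x = (\<chi> i. x $ Transposition.transpose m n i)" for x
    proof -
      have "(\<Sum>j\<in>UNIV. id_mat $ i $ Transposition.transpose m n j * x $ j) =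
          (\<Sum>j\<in>UNIV. if j = Transposition.transpose m n i then x $ j else 0)" for i
        by (intro sum.cong) (auto simp: Finite_Cartesian_Product.mat_def)
      then show ?thesis by (simp add: M_def matrix_vector_mult_def)
    qed
    have "M *v (M *v x) = x" for x
      unfolding Ax by (simp add: cart_eq_iff)
    then have "M ** M = id_mat"
      by (simp add: matrix_eq matrix_vector_mul_assoc[symmetric])
    \<comment> \<open>A swap is its own inverse, which gives |det| = 1 without the sign of a
      permutation.\<close>
    then have "mdet M * mdet M = 1"
      by (metis det_I det_mul)
    then have "\<bar>mdet M\<bar> = 1"
      by (simp add: abs_square_eq_1[symmetric] power2_eq_square)
    then show ?case using 4 unfolding M_def[symmetric] by (simp add: Ax emeasure_lborel_swap)
  next
    case (5 m n)
    define M :: "real^'n^'n" where "M = (\<chi> i j. of_bool (i = m \<and> j = n \<or> i = j))"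
    have Ax: "M *v x = (\<chi> i. if i = m then x $ m + x $ n else x $ i)" for x
    proof -
      have "(\<Sum>j\<in>UNIV. of_bool (i = m \<and> j = n \<or> i = j) * x $ j) =
          (\<Sum>j\<in>UNIV. (if j = i then x $ j else 0) + (if j = n then (if i = m then x $ j else 0) else 0))" for i
        using 5 by (intro sum.cong) auto
      then show ?thesis by (auto simp: M_def matrix_vector_mult_def cart_eq_iff sum.distrib)
    qed
    have "M = (\<chi> k. if k = m then Finite_Cartesian_Product.row m (id_mat) + 1 *s Finite_Cartesian_Product.row n (id_mat)
        else Finite_Cartesian_Product.row k (id_mat))"
      using 5 by (auto simp: M_def cart_eq_iff Finite_Cartesian_Product.row_def Finite_Cartesian_Product.mat_def)
    then have "mdet M = 1"
      using det_row_operation[OF 5, of "id_mat :: real^'n^'n" 1] by simp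
    then show ?case using 5 unfolding M_def[symmetric] by (simp add: Ax emeasure_lborel_shear)
  qed
  then show ?thesis using assms by blast
qed

text \<open>The map leaves the coordinates outside S alone, hence preserves the strip of unit width
  that defines the slab, and the change of variables for \<open>lborel\<close> restricts to
  it.\<close>

lemma slab_affine:
  fixes A :: "real^'n^'n"
  assumes det: "mdet A \<noteq> 0"
    and A: "\<And>x i. i \<notin> S \<Longrightarrow> (A *v x + z) $ i = x $ i"
  shows "slab S = density (distr (slab S) borel (\<lambda>x. A *v x + z)) (\<lambda>_. ennreal \<bar>mdet A\<bar>)"
proof (rule measure_eqI)
  fix E assume "E \<in> sets (slab S)"
  then have E[measurable]: "E \<in> sets borel" by simp
  let ?B = "{x :: real^'n. \<forall>i. i \<notin> S \<longrightarrow> 0 < x $ i \<and> x $ i < 1}"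
  have m: "{x. A *v x + z \<in> E} \<in> sets borel" by measurable
  have "(+) z \<in> lborel \<rightarrow>\<^sub>M borel" by measurable
  have "emeasure (slab S) E = emeasure (distr lborel borel ((+) z)) (E \<inter> ?B)"
    by (simp add: emeasure_slab lborel_distr_plus)
  also have "\<dots> = emeasure lborel {x. z + x \<in> E \<inter> ?B}"
    by (subst emeasure_distr) (auto simp: vimage_def)
  also have "\<dots> = ennreal \<bar>mdet A\<bar> * emeasure lborel {x. A *v x \<in> {x. z + x \<in> E \<inter> ?B}}"
    by (intro emeasure_lborel_linear det) measurable
  also have "{x. A *v x \<in> {x. z + x \<in> E \<inter> ?B}} = {x. A *v x + z \<in> E} \<inter> ?B"
    using A by (auto simp: add.commute)
  also have "emeasure lborel \<dots> = emeasure (slab S) {x. A *v x + z \<in> E}"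
    using m by (simp add: emeasure_slab)
  also have "ennreal \<bar>mdet A\<bar> * \<dots> =
      emeasure (density (distr (slab S) borel (\<lambda>x. A *v x + z)) (\<lambda>_. ennreal \<bar>mdet A\<bar>)) E"
    using E by (subst emeasure_density) (auto simp: nn_integral_cmult emeasure_distr vimage_def)
  finally show "emeasure (slab S) E =
      emeasure (density (distr (slab S) borel (\<lambda>x. A *v x + z)) (\<lambda>_. ennreal \<bar>mdet A\<bar>)) E" .
qed simp

lemma integral_slab_affine:
  fixes A :: "real^'n^'n" and f :: "real^'n \<Rightarrow> real"
  assumes det: "mdet A \<noteq> 0"
    and A: "\<And>x i. i \<notin> S \<Longrightarrow> (A *v x + z) $ i = x $ i"
    and int: "integrable (slab S) f"
  shows "integrable (slab S) (\<lambda>x. f (A *v x + z))"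
    and "(\<integral>x. f (A *v x + z) \<partial>slab S) = (\<integral>x. f x \<partial>slab S) / \<bar>mdet A\<bar>"
proof -
  have [measurable]: "f \<in> borel_measurable borel"
    using int by (auto dest!: borel_measurable_integrable cong: measurable_cong_sets)
  have [measurable]: "(\<lambda>x. A *v x + z) \<in> slab S \<rightarrow>\<^sub>M borel" by measurable
  note eq = slab_affine[of A S z, OF det A]
  have "integrable (density (distr (slab S) borel (\<lambda>x. A *v x + z)) (\<lambda>_. ennreal \<bar>mdet A\<bar>)) f"
    using int eq by simp
  then have "integrable (distr (slab S) borel (\<lambda>x. A *v x + z)) f"
    using det by (subst (asm) integrable_density) auto
  then show "integrable (slab S) (\<lambda>x. f (A *v x + z))"
    by (subst (asm) integrable_distr_eq) auto
  have "(\<integral>x. f x \<partial>slab S) =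
      (\<integral>x. f x \<partial>density (distr (slab S) borel (\<lambda>x. A *v x + z)) (\<lambda>_. ennreal \<bar>mdet A\<bar>))"
    using eq by simp
  also have "\<dots> = \<bar>mdet A\<bar> * (\<integral>x. f (A *v x + z) \<partial>slab S)"
    by (subst integral_density) (auto simp: integral_distr)
  finally show "(\<integral>x. f (A *v x + z) \<partial>slab S) = (\<integral>x. f x \<partial>slab S) / \<bar>mdet A\<bar>"
    using det by simp
qed

lemma emeasure_slab_affine:
  fixes A :: "real^'n^'n"
  assumes det: "mdet A \<noteq> 0"
    and A: "\<And>x i. i \<notin> S \<Longrightarrow> (A *v x + z) $ i = x $ i"
    and E: "E \<in> sets borel"
  shows "emeasure (slab S) E =
    ennreal \<bar>mdet A\<bar> * emeasure (slab S) {x. A *v x + z \<in> E}"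
  by (subst slab_affine[of A S z, OF det A], assumption, subst emeasure_density)
    (use E in \<open>auto simp: nn_integral_cmult emeasure_distr vimage_def\<close>)

subsection \<open>Integer powers of a matrix\<close>

lemma matrix_int_power_0 [simp]: "mpow A 0 = id_mat"
  by (simp add: matrix_int_power_def)

lemma matrix_inv_left_right:
  fixes A :: "real^'n^'n"
  assumes "mdet A \<noteq> 0"
  shows "A ** matrix_inv A = id_mat" "matrix_inv A ** A = id_mat"
proof -
  have "\<exists>B. A ** B = id_mat \<and> B ** A = id_mat"
    using assms by (simp add: invertible_det_nz[symmetric] invertible_def)
  from someI_ex[OF this]
  show "A ** matrix_inv A = id_mat" "matrix_inv A ** A = id_mat"
    by (simp_all add: matrix_inv_def)
qed

lemma matrix_int_power_plus_1:
  fixes A :: "real^'n^'n"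
  assumes "mdet A \<noteq> 0"
  shows "mpow A (m + 1) = A ** mpow A m"
proof (cases "m \<ge> 0")
  case True
  then show ?thesis by (simp add: matrix_int_power_def nat_add_distrib)
next
  case False
  then have "nat (- m) = Suc (nat (- (m + 1)))" by simp
  with False show ?thesis
    by (cases "m = - 1")
      (auto simp: matrix_int_power_def matrix_mul_assoc matrix_inv_left_right[OF assms])
qed

lemma matrix_int_power_det:
  fixes A :: "real^'n^'n"
  assumes A: "mdet A \<noteq> 0"
  shows "mdet (mpow A m) = mdet A powi m"
proof (induction m rule: int_induct[where k = 0])
  case base
  show ?case by simp
next
  case (step1 i)
  then show ?case using A by (simp add: matrix_int_power_plus_1 det_mul power_int_add_1)
next
  case (step2 i)
  have "mdet (mpow A i) = mdet A * mdet (mpow A (i - 1))"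
    using matrix_int_power_plus_1[OF A, of "i - 1"] by (simp add: det_mul)
  then show ?case using step2 A by (simp add: power_int_diff field_simps)
qed

lemma matrix_int_power_add_nat:
  fixes A :: "real^'n^'n"
  assumes A: "mdet A \<noteq> 0"
  shows "mpow A (m + int d) *v x = ((\<lambda>x. A *v x) ^^ d) (mpow A m *v x)"
proof (induction d)
  case (Suc d)
  have "mpow A (m + int (Suc d)) = A ** mpow A (m + int d)"
    using matrix_int_power_plus_1[OF A, of "m + int d"] by (simp add: algebra_simps)
  then show ?case by (simp add: matrix_vector_mul_assoc[symmetric] Suc)
qed simp

text \<open>Negative powers are reached through the last premise, which cancels a factor A on the
  left: \<open>mpow A i = A ** mpow A (i - 1)\<close>.\<close>

lemma matrix_int_power_induct:
  fixes A :: "real^'n^'n"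
  assumes A: "mdet A \<noteq> 0" and "P (id_mat)"
    and "\<And>M. P M \<Longrightarrow> P (A ** M)" and "\<And>M. P (A ** M) \<Longrightarrow> P M"
  shows "P (mpow A m)"
proof (induction m rule: int_induct[where k = 0])
  case base
  show ?case using assms(2) by simp
next
  case (step1 i)
  then show ?case using assms(3) by (simp add: matrix_int_power_plus_1[OF A])
next
  case (step2 i)
  then show ?case using assms(4) matrix_int_power_plus_1[OF A, of "i - 1"] by simp
qed

subsection \<open>Integer lattices in coordinate subspaces\<close>

definition int_lattice :: "'n set \<Rightarrow> (real^'n) set" where
  "int_lattice S = {z. \<forall>i. z $ i \<in> \<int> \<and> (i \<notin> S \<longrightarrow> z $ i = 0)}"

definition proj :: "'n set \<Rightarrow> real^'n \<Rightarrow> real^'n" where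
  "proj S x = glue S x 0"

lemma proj_nth [simp]: "proj S x $ i = (if i \<in> S then x $ i else 0)"
  by (simp add: proj_def glue_def)

lemma proj_add: "proj S (x + y) = proj S x + proj S y"
  by (simp add: cart_eq_iff)

lemma proj_diff: "proj S (x - y) = proj S x - proj S y"
  by (simp add: cart_eq_iff)

lemma proj_lattice [simp]: "z \<in> int_lattice S \<Longrightarrow> proj S z = z"
  by (auto simp: cart_eq_iff int_lattice_def)

lemma continuous_proj: "continuous_on UNIV (proj S :: real^'n \<Rightarrow> real^'n)"
  unfolding proj_def by (intro continuous_on_glue continuous_intros)

lemma measurable_proj [measurable]: "(proj S :: real^'n \<Rightarrow> real^'n) \<in> borel_measurable borel"
  by (rule borel_measurable_continuous_onI[OF continuous_proj])

lemma lattice_add [intro]: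
  "x \<in> int_lattice S \<Longrightarrow> y \<in> int_lattice S \<Longrightarrow> x + y \<in> int_lattice S"
  by (auto simp: int_lattice_def)

lemma lattice_diff [intro]:
  "x \<in> int_lattice S \<Longrightarrow> y \<in> int_lattice S \<Longrightarrow> x - y \<in> int_lattice S"
  by (auto simp: int_lattice_def)

lemma lattice_uminus [intro]: "x \<in> int_lattice S \<Longrightarrow> - x \<in> int_lattice S"
  by (auto simp: int_lattice_def)

lemma lattice_0 [simp]: "0 \<in> int_lattice S"
  by (auto simp: int_lattice_def)

lemma finite_lattice_ball: "finite {z \<in> int_lattice S. norm (z :: real^'n) \<le> r}"
proof (rule finite_subset)
  let ?F = "PiE (UNIV :: 'n set) (\<lambda>_. {- \<lceil>r\<rceil>..\<lceil>r\<rceil>})"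
  show "{z \<in> int_lattice S. norm (z :: real^'n) \<le> r} \<subseteq> (\<lambda>f. \<chi> i. real_of_int (f i)) ` ?F"
  proof
    fix z :: "real^'n" assume z: "z \<in> {z \<in> int_lattice S. norm z \<le> r}"
    have eq: "z $ i = real_of_int \<lfloor>z $ i\<rfloor>" for i
      using z by (auto simp: int_lattice_def Ints_def)
    have "\<lfloor>z $ i\<rfloor> \<in> {- \<lceil>r\<rceil>..\<lceil>r\<rceil>}" for i
    proof -
      have "\<bar>z $ i\<bar> \<le> r" using component_le_norm_cart[of z i] z by simp
      then show ?thesis using eq[of i] by (simp add: le_floor_iff abs_le_iff) linarith
    qed
    then show "z \<in> (\<lambda>f. \<chi> i. real_of_int (f i)) ` ?F"
      using eq by (intro image_eqI[where x = "\<lambda>i. \<lfloor>z $ i\<rfloor>"])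
        (auto simp: cart_eq_iff)
  qed
  show "finite ((\<lambda>f. \<chi> i. real_of_int (f i)) ` ?F :: (real^'n) set)"
    by (intro finite_imageI finite_PiE) auto
qed

lemma countable_lattice: "countable (int_lattice S :: (real^'n) set)"
proof -
  have "int_lattice S = (\<Union>n::nat. {z \<in> int_lattice S. norm (z :: real^'n) \<le> real n})"
  proof (intro equalityI subsetI)
    fix z :: "real^'n" assume "z \<in> int_lattice S"
    moreover obtain n :: nat where "norm z \<le> real n" using real_arch_simple by blast
    ultimately show "z \<in> (\<Union>n::nat. {z \<in> int_lattice S. norm z \<le> real n})" by auto
  qed auto
  also have "countable \<dots>"
    by (rule countable_UN) (auto intro: countable_finite finite_lattice_ball)
  finally show ?thesis .
qed

lemma block_nth:
  fixes A :: "real^'n^'n"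
  assumes block: "\<And>i j. i \<notin> S \<or> j \<notin> S \<Longrightarrow> A $ i $ j = (if i = j then 1 else 0)"
  shows "i \<notin> S \<Longrightarrow> (A *v x) $ i = x $ i" "proj S (A *v x) = A *v proj S x"
proof -
  show off: "(A *v x) $ i = x $ i" if i: "i \<notin> S" for i x
  proof -
    have "(\<Sum>j\<in>UNIV. A $ i $ j * x $ j) = (\<Sum>j\<in>UNIV. if j = i then x $ i else 0)"
      using i block[of i] by (intro sum.cong) auto
    then show ?thesis by (simp add: matrix_vector_mult_def)
  qed
  show "proj S (A *v x) = A *v proj S x"
    unfolding cart_eq_iff
  proof
    fix i
    show "proj S (A *v x) $ i = (A *v proj S x) $ i"
    proof (cases "i \<in> S")
      case True
      have "(\<Sum>j\<in>UNIV. A $ i $ j * x $ j) = (\<Sum>j\<in>UNIV. A $ i $ j * proj S x $ j)"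
        using True block[of i] by (intro sum.cong) auto
      then show ?thesis using True by (simp add: matrix_vector_mult_def)
    qed (simp add: off)
  qed
qed

definition block_matrix :: "'n set \<Rightarrow> real^'n^'n \<Rightarrow> bool" where
  "block_matrix S A \<longleftrightarrow> mdet A \<noteq> 0 \<and>
     (\<forall>i j. i \<notin> S \<or> j \<notin> S \<longrightarrow> A $ i $ j = (if i = j then 1 else 0))"

lemma block_matrix_power:
  fixes A :: "real^'n^'n"
  assumes A: "block_matrix S A"
  shows "i \<notin> S \<Longrightarrow> (mpow A m *v x) $ i = x $ i"
    "proj S (mpow A m *v x) = mpow A m *v proj S x"
proof -
  have det: "mdet A \<noteq> 0"
    and entries: "\<And>i j. i \<notin> S \<or> j \<notin> S \<Longrightarrow> A $ i $ j = (if i = j then 1 else 0)"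
    using A unfolding block_matrix_def by blast+
  have off: "i \<notin> S \<Longrightarrow> (A *v x) $ i = x $ i" for i x using entries by (rule block_nth(1))
  have proj_A: "proj S (A *v x) = A *v proj S x" for x using entries by (rule block_nth(2))
  show "(mpow A m *v x) $ i = x $ i" if "i \<notin> S"
    using that by (induction arbitrary: x rule: matrix_int_power_induct[OF det])
      (auto simp: matrix_vector_mul_assoc[symmetric] off)
  have inj: "A *v x = A *v y \<Longrightarrow> x = y" for x y
    by (metis det invertible_det_nz inj_matrix_vector_mult injD)
  show "proj S (mpow A m *v x) = mpow A m *v proj S x"
    by (induction arbitrary: x rule: matrix_int_power_induct[OF det])
      (auto simp: matrix_vector_mul_assoc[symmetric] proj_A intro: inj)
qed

lemma lattice_round:
  "\<exists>k\<in>int_lattice S. norm (proj S x - k) \<le> real CARD('n)" for x :: "real^'n"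
proof
  let ?k = "(\<chi> i. if i \<in> S then real_of_int \<lfloor>x $ i\<rfloor> else 0) :: real^'n"
  show "?k \<in> int_lattice S" by (auto simp: int_lattice_def)
  have "norm (proj S x - ?k) \<le> (\<Sum>i\<in>UNIV. \<bar>(proj S x - ?k) $ i\<bar>)"
    by (rule norm_le_l1_cart)
  also have "\<dots> \<le> (\<Sum>i\<in>(UNIV :: 'n set). 1)"
    by (intro sum_mono) (auto simp: abs_if; linarith)
  finally show "norm (proj S x - ?k) \<le> real CARD('n)" by simp
qed

text \<open>A translation by z changes the sum of the elements by card L times z. Applied to labels,
  this separates the lattice translates of a cell.\<close>

lemma translate_finite_fixed:
  fixes L :: "(real^'n) set"
  assumes "finite L" "L \<noteq> {}" "(+) z ` L = L"
  shows "z = 0"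
proof -
  have "sum (\<lambda>x. x) L = (\<Sum>x\<in>L. z + x)"
    using assms(3) by (metis (no_types, lifting) inj_on_add sum.reindex_cong)
  also have "\<dots> = real (card L) *\<^sub>R z + sum (\<lambda>x. x) L"
    by (simp add: sum.distrib sum_constant_scaleR del: sum_constant)
  finally have "real (card L) *\<^sub>R z = 0" by simp
  then show ?thesis using assms by simp
qed

subsection \<open>A nested family of partitions\<close>

locale block_dilation =
  fixes S :: "'n::finite set" and A :: "real^'n^'n" and lam :: real
  assumes lam: "lam > 1"
    and A_int: "\<And>i j. A $ i $ j \<in> \<int>"
    and A_block: "\<And>i j. i \<notin> S \<or> j \<notin> S \<Longrightarrow> A $ i $ j = (if i = j then 1 else 0)"
    and A_expand: "\<And>v. (\<And>i. i \<notin> S \<Longrightarrow> v $ i = 0) \<Longrightarrow> lam * norm v \<le> norm (A *v v)"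
    and S_nonempty: "S \<noteq> {}"
begin

abbreviation "\<Lambda> \<equiv> int_lattice S"
abbreviation "\<mu> \<equiv> slab S"
abbreviation "P \<equiv> mpow A"

lemma A_off: "i \<notin> S \<Longrightarrow> (A *v x) $ i = x $ i"
  using A_block by (rule block_nth(1))

lemma proj_A: "proj S (A *v x) = A *v proj S x"
  using A_block by (rule block_nth(2))

lemma A_lattice: "z \<in> \<Lambda> \<Longrightarrow> A *v z \<in> \<Lambda>"
  using A_off by (auto simp: int_lattice_def) (auto simp: matrix_vector_mult_def intro!: Ints_sum Ints_mult A_int)

lemma det_A: "mdet A \<noteq> 0"
proof -
  have "x = 0" if "A *v x = 0" for x
  proof -
    have "x $ i = 0" if "i \<notin> S" for i using A_off[OF that, of x] \<open>A *v x = 0\<close> by simp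
    from A_expand[OF this] have "lam * norm x \<le> 0" using that by simp
    then show "x = 0" using lam by (simp add: mult_le_0_iff)
  qed
  then show ?thesis
    by (metis invertible_det_nz invertible_left_inverse matrix_left_invertible_ker)
qed

lemma block_matrix_A: "block_matrix S A"
  unfolding block_matrix_def using det_A A_block by blast

lemma P_off: "i \<notin> S \<Longrightarrow> (P m *v x) $ i = x $ i"
  by (rule block_matrix_power(1)[OF block_matrix_A])

lemma proj_P: "proj S (P m *v x) = P m *v proj S x"
  by (rule block_matrix_power(2)[OF block_matrix_A])

lemma A_surj: "\<exists>x. A *v x = y"
  by (metis det_A matrix_inv_left_right(1) matrix_vector_mul_assoc matrix_vector_mul_lid)

lemma det_P: "\<bar>mdet (P m)\<bar> = \<bar>mdet A\<bar> powi m"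
  by (simp add: matrix_int_power_det[OF det_A] power_int_abs)

lemma det_P_nonzero: "mdet (P m) \<noteq> 0"
  using det_A by (simp add: matrix_int_power_det[OF det_A])

lemma P_Suc: "P (m + 1) *v x = A *v (P m *v x)"
  by (simp add: matrix_int_power_plus_1[OF det_A] matrix_vector_mul_assoc)

lemma lattice_off: "z \<in> \<Lambda> \<Longrightarrow> i \<notin> S \<Longrightarrow> z $ i = 0"
  by (auto simp: int_lattice_def)

lemma Bd: "norm (A *v x) \<le> onorm ((*v) A) * norm x"
  by (rule onorm[OF matrix_vector_mul_bounded_linear])

lemma Bd_nonneg: "0 \<le> onorm ((*v) A)"
  by (rule onorm_pos_le[OF matrix_vector_mul_bounded_linear])

text \<open>The radii satisfy \<open>lam * rho = rho + rad\<close>: if \<open>A x\<close> is within \<open>rho\<close> of \<open>l\<close> and \<open>A k\<close> within \<open>rad\<close>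
  of \<open>l\<close>, then \<open>x\<close> is within \<open>rho\<close> of \<open>k\<close>. Hence the prelabels below decrease and stabilize.\<close>

definition "rad = real CARD('n) * (lam + onorm ((*v) A))"
definition "rho = rad / (lam - 1)"

lemma rho: "lam * rho = rho + rad"
  using lam by (simp add: rho_def field_simps)

text \<open>The summand \<open>lam\<close> in \<open>rad\<close> is there for this bound: the ball
  of radius \<open>rho\<close> around any point of the block then contains a lattice point, so stage
  0 of a label is nonempty.\<close>

lemma CARD_le_rho: "real CARD('n) \<le> rho"
proof -
  have "real CARD('n) * (lam - 1) \<le> rad"
    unfolding rad_def using Bd_nonneg by (intro mult_left_mono) auto
  then show ?thesis using lam by (simp add: rho_def pos_le_divide_eq)
qed

text \<open>The summand \<open>onorm\<close> in \<open>rad\<close> is there for this bound: rounding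
  a preimage of l under A to a lattice point k costs at most CARD('n), and A stretches this error by
  at most its operator norm. So every l is within \<open>rad\<close> of some A k.\<close>

lemma CARD_le_rad: "onorm ((*v) A) * real CARD('n) \<le> rad"
  unfolding rad_def using lam by (simp add: algebra_simps)

text \<open>Leads from the label of A x to that of x, hence from a cell to the coarser cell
  containing it.\<close>

definition parent :: "(real^'n) set \<Rightarrow> (real^'n) set" where
  "parent L = {k \<in> \<Lambda>. \<exists>l\<in>L. norm (l - A *v k) \<le> rad}"

text \<open>Unfolded, k lies in \<open>prelabel n x\<close> if some chain k = k_0, ..., k_n of
  lattice points with steps |k_{i+1} - A k_i| \<le> \<open>rad\<close> ends within
  \<open>rho\<close> of the projection of A^n x. All such k are kept: a selection among them would
  have to be compatible with every level and every translation.\<close>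

primrec prelabel :: "nat \<Rightarrow> real^'n \<Rightarrow> (real^'n) set" where
  "prelabel 0 x = {k \<in> \<Lambda>. norm (proj S x - k) \<le> rho}"
| "prelabel (Suc n) x = parent (prelabel n (A *v x))"

definition label :: "real^'n \<Rightarrow> (real^'n) set" where
  "label x = (\<Inter>n. prelabel n x)"

lemma prelabel_lattice: "prelabel n x \<subseteq> \<Lambda>"
  by (cases n) (auto simp: parent_def)

lemma prelabel_Suc: "prelabel (Suc n) x \<subseteq> prelabel n x"
proof (induction n arbitrary: x)
  case 0
  show ?case
  proof
    fix k assume "k \<in> prelabel (Suc 0) x"
    then obtain l where k: "k \<in> \<Lambda>" and l: "norm (proj S (A *v x) - l) \<le> rho" "norm (l - A *v k) \<le> rad"
      by (auto simp: parent_def)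
    have "lam * norm (proj S x - k) \<le> norm (A *v (proj S x - k))"
      using k by (intro A_expand) (auto simp: lattice_off)
    also have "A *v (proj S x - k) = (proj S (A *v x) - l) + (l - A *v k)"
      by (simp add: proj_A matrix_vector_mult_diff_distrib)
    also have "norm \<dots> \<le> lam * rho"
      using l norm_triangle_ineq[of "proj S (A *v x) - l" "l - A *v k"] rho by linarith
    finally show "k \<in> prelabel 0 x"
      using k lam by simp
  qed
next
  case (Suc n)
  then have "parent (prelabel (Suc n) (A *v x)) \<subseteq> parent (prelabel n (A *v x))"
    unfolding parent_def by blast
  then show ?case by (metis prelabel.simps(2))
qed

lemma prelabel_antimono: "m \<le> n \<Longrightarrow> prelabel n x \<subseteq> prelabel m x"
  by (rule lift_Suc_antimono_le[of "\<lambda>n. prelabel n x", OF prelabel_Suc])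

lemma finite_prelabel: "finite (prelabel n x)"
proof (rule finite_subset)
  show "prelabel n x \<subseteq> {z \<in> \<Lambda>. norm z \<le> norm (proj S x) + rho}"
  proof
    fix k assume "k \<in> prelabel n x"
    then have "k \<in> prelabel 0 x" using prelabel_antimono[of 0 n x] by auto
    then have k: "k \<in> \<Lambda>" "norm (proj S x - k) \<le> rho" by auto
    have "norm k \<le> norm (proj S x) + norm (proj S x - k)"
      by (metis norm_triangle_sub add.commute norm_minus_commute)
    then show "k \<in> {z \<in> \<Lambda>. norm z \<le> norm (proj S x) + rho}"
      using k by auto
  qed
qed (rule finite_lattice_ball)

lemma parent_nonempty:
  assumes "L \<subseteq> \<Lambda>" "L \<noteq> {}"
  shows "parent L \<noteq> {}"
proof -
  obtain l where l: "l \<in> L" using assms by blast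
  obtain x where x: "A *v x = l" using A_surj by blast
  obtain k where k: "k \<in> \<Lambda>" "norm (proj S x - k) \<le> real CARD('n)"
    using lattice_round by blast
  have "l = A *v proj S x"
    using proj_A[of x] l assms by (auto simp: x)
  then have "l - A *v k = A *v (proj S x - k)" by (simp add: matrix_vector_mult_diff_distrib)
  then have "norm (l - A *v k) \<le> onorm ((*v) A) * norm (proj S x - k)"
    by (metis Bd)
  also have "\<dots> \<le> onorm ((*v) A) * real CARD('n)"
    using k Bd_nonneg by (intro mult_left_mono) auto
  finally have "norm (l - A *v k) \<le> rad" using CARD_le_rad by linarith
  then show ?thesis using k l by (auto simp: parent_def)
qed

lemma prelabel_nonempty: "prelabel n x \<noteq> {}"
proof (induction n arbitrary: x)
  case 0
  obtain k where "k \<in> \<Lambda>" "norm (proj S x - k) \<le> real CARD('n)"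
    using lattice_round by blast
  then have "k \<in> prelabel 0 x" using CARD_le_rho by auto
  then show ?case by blast
next
  case (Suc n)
  then show ?case using parent_nonempty[OF prelabel_lattice] by simp
qed

declare prelabel.simps [simp del]

text \<open>The stages decrease and are finite, and N is a time at which the finitely many points of
  stage 0 outside the label are all gone. Because the limit is attained, labels inherit nonemptiness
  and the recursion from the stages.\<close>

lemma label_eq_prelabel: "\<exists>N. \<forall>n\<ge>N. prelabel n x = label x"
proof -
  define n where "n k = (SOME n. k \<notin> prelabel n x)" for k
  have n: "k \<notin> prelabel (n k) x" if "k \<in> prelabel 0 x - label x" for k
  proof -
    have "\<exists>n. k \<notin> prelabel n x" using that by (simp add: label_def)
    then show ?thesis unfolding n_def by (rule someI_ex)
  qed
  define N where "N = Max (insert 0 (n ` (prelabel 0 x - label x)))"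
  have N: "n k \<le> N" if "k \<in> prelabel 0 x - label x" for k
    unfolding N_def
  proof (rule Max_ge)
    show "finite (insert 0 (n ` (prelabel 0 x - label x)))"
      using finite_prelabel[of 0 x] by simp
  qed (use that in blast)
  have "prelabel m x = label x" if "m \<ge> N" for m
  proof
    show "prelabel m x \<subseteq> label x"
    proof (rule ccontr)
      assume "\<not> prelabel m x \<subseteq> label x"
      then obtain k where k: "k \<in> prelabel m x" "k \<notin> label x" by blast
      then have 0: "k \<in> prelabel 0 x - label x" using prelabel_antimono[of 0 m x] by blast
      have "prelabel m x \<subseteq> prelabel (n k) x"
        using N[OF 0] that by (intro prelabel_antimono) simp
      then show False using n[OF 0] k by blast
    qed
    show "label x \<subseteq> prelabel m x" unfolding label_def by blast
  qed
  then show ?thesis by blast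
qed

text \<open>This is the nesting of the partitions. Beyond both stabilization indices the recursion
  for \<open>prelabel\<close> becomes an identity between labels.\<close>

lemma label_parent: "label x = parent (label (A *v x))"
proof -
  obtain N1 where N1: "\<And>n. n \<ge> N1 \<Longrightarrow> prelabel n x = label x"
    using label_eq_prelabel[of x] by blast
  obtain N2 where N2: "\<And>n. n \<ge> N2 \<Longrightarrow> prelabel n (A *v x) = label (A *v x)"
    using label_eq_prelabel[of "A *v x"] by blast
  from N1[of "Suc (max N1 N2)"] N2[of "max N1 N2"] show ?thesis by (simp add: prelabel.simps)
qed

lemma finite_label: "finite (label x)"
  using label_eq_prelabel[of x] finite_prelabel[of _ x] by (metis order_refl)

lemma label_nonempty: "label x \<noteq> {}"
  using label_eq_prelabel[of x] prelabel_nonempty[of _ x] by (metis order_refl)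

lemma label_lattice: "label x \<subseteq> \<Lambda>"
  using label_eq_prelabel[of x] prelabel_lattice[of _ x] by (metis order_refl)

lemma label_near: "k \<in> label x \<Longrightarrow> norm (proj S x - k) \<le> rho"
proof -
  assume "k \<in> label x"
  then have "k \<in> prelabel 0 x" unfolding label_def by blast
  then show ?thesis by (simp add: prelabel.simps)
qed

text \<open>The condition on k involves only l - A k, so moving k by z is matched by moving l by A
  z. This covariance is behind all later reductions to representatives.\<close>

lemma parent_translate:
  assumes "z \<in> \<Lambda>" shows "parent ((+) (A *v z) ` L) = (+) z ` parent L"
proof (intro equalityI subsetI)
  fix k assume "k \<in> parent ((+) (A *v z) ` L)"
  then obtain l where l: "k \<in> \<Lambda>" "l \<in> L" "norm (A *v z + l - A *v k) \<le> rad"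
    by (auto simp: parent_def)
  have "A *v z + l - A *v k = l - A *v (k - z)"
    by (simp add: matrix_vector_mult_diff_distrib)
  with l(3) have "norm (l - A *v (k - z)) \<le> rad" by (simp only:)
  then have "k - z \<in> parent L"
    using l(1,2) assms by (auto simp: parent_def)
  then show "k \<in> (+) z ` parent L" by (metis add_diff_cancel_left' diff_add_cancel add.commute imageI)
next
  fix k assume "k \<in> (+) z ` parent L"
  then obtain k' l where k: "k = z + k'" "k' \<in> \<Lambda>" "l \<in> L" "norm (l - A *v k') \<le> rad"
    by (auto simp: parent_def)
  have "A *v z + l - A *v k = l - A *v k'"
    by (simp add: k(1) matrix_vector_right_distrib)
  with k(4) have "norm (A *v z + l - A *v k) \<le> rad" by (simp only:)
  then show "k \<in> parent ((+) (A *v z) ` L)"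
    using k(1-3) assms by (auto simp: parent_def)
qed

lemma prelabel_translate: "z \<in> \<Lambda> \<Longrightarrow> prelabel n (x + z) = (+) z ` prelabel n x"
proof (induction n arbitrary: x z)
  case 0
  show ?case
  proof (intro equalityI subsetI)
    fix k assume "k \<in> prelabel 0 (x + z)"
    then have "k - z \<in> prelabel 0 x" using 0 by (auto simp: prelabel.simps proj_add algebra_simps)
    then show "k \<in> (+) z ` prelabel 0 x" by (metis add_diff_cancel_left' diff_add_cancel add.commute imageI)
  qed (use 0 in \<open>auto simp: prelabel.simps proj_add algebra_simps\<close>)
next
  case (Suc n)
  then show ?case
    by (simp add: prelabel.simps matrix_vector_right_distrib Suc.IH[OF A_lattice] parent_translate)
qed

lemma label_translate: "z \<in> \<Lambda> \<Longrightarrow> label (x + z) = (+) z ` label x"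
  unfolding label_def by (simp add: prelabel_translate image_INT[of _ UNIV] inj_on_add)

lemma depends_on_label: "depends_on S label"
proof -
  have "prelabel n x = prelabel n y" if "proj S x = proj S y" for n x y
    using that
  proof (induction n arbitrary: x y)
    case (Suc n)
    have "proj S (A *v x) = proj S (A *v y)" using Suc.prems by (simp add: proj_A)
    from Suc.IH[OF this] show ?case by (simp add: prelabel.simps)
  qed (simp add: prelabel.simps)
  moreover have "proj S x = proj S y" if "\<forall>i\<in>S. x $ i = y $ i" for x y :: "real^'n"
    using that by (auto simp: cart_eq_iff)
  ultimately show ?thesis unfolding depends_on_def label_def by (intro allI impI INF_cong refl) blast
qed

lemma prelabel_sets: "{x. k \<in> prelabel n x} \<in> sets borel"
proof (induction n arbitrary: k)
  case 0
  have "{x. norm (proj S x - k) \<le> rho} \<in> sets borel" by measurable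
  then show ?case by (cases "k \<in> \<Lambda>") (simp_all add: prelabel.simps)
next
  case (Suc n)
  have "{x. k \<in> prelabel (Suc n) x} =
      (if k \<in> \<Lambda> then (\<Union>l\<in>{l \<in> \<Lambda>. norm (l - A *v k) \<le> rad}. (\<lambda>x. A *v x) -` {x. l \<in> prelabel n x}) else {})"
    using prelabel_lattice by (auto simp: prelabel.simps parent_def)
  moreover have "(\<lambda>x. A *v x) -` {x. l \<in> prelabel n x} \<in> sets borel" for l
    using measurable_sets[OF measurable_matrix_vector Suc.IH[of l], of A] by simp
  moreover have "countable {l \<in> \<Lambda>. norm (l - A *v k) \<le> rad}"
    using countable_lattice by (rule countable_subset[rotated]) auto
  ultimately show ?case by (auto intro!: sets.countable_UN')
qed

section \<open>Cells, their measures, and integrals of functions of the label\<close>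

definition cell :: "(real^'n) set \<Rightarrow> (real^'n) set" where
  "cell L = {x. label x = L}"

text \<open>Equality of labels amounts to countably many membership conditions, one for each lattice
  point.\<close>

lemma cell_sets [measurable]: "cell L \<in> sets borel"
proof (cases "L \<subseteq> \<Lambda>")
  case True
  have m: "{x. k \<in> label x} \<in> sets borel" for k
  proof -
    have "{x. k \<in> label x} = (\<Inter>n. {x. k \<in> prelabel n x})" by (auto simp: label_def)
    then show ?thesis by (auto intro!: sets.countable_INT prelabel_sets)
  qed
  have "cell L = (\<Inter>k\<in>\<Lambda>. if k \<in> L then {x. k \<in> label x} else UNIV - {x. k \<in> label x})"
  proof (intro equalityI subsetI)
    fix x assume x: "x \<in> (\<Inter>k\<in>\<Lambda>. if k \<in> L then {x. k \<in> label x} else UNIV - {x. k \<in> label x})"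
    have "k \<in> label x \<longleftrightarrow> k \<in> L" if "k \<in> \<Lambda>" for k
      using INT_D[OF x that] by (simp split: if_splits)
    then show "x \<in> cell L" using True label_lattice[of x] by (auto simp: cell_def)
  qed (auto simp: cell_def)
  also have "\<dots> \<in> sets borel"
  proof (intro sets.countable_INT'' countable_lattice)
    show "(if k \<in> L then {x. k \<in> label x} else UNIV - {x. k \<in> label x}) \<in> sets borel" for k
      using m[of k] sets.compl_sets[of "{x. k \<in> label x}" borel] by simp
  qed auto
  finally show ?thesis .
next
  case False
  then have "cell L = {}" using label_lattice by (auto simp: cell_def)
  then show ?thesis by simp
qed

lemma emeasure_bounded_cylinder: "emeasure \<mu> {x. norm (proj S x) \<le> r} < \<infinity>"
proof -
  let ?l = "\<chi> i. - (\<bar>r\<bar> + 1) :: real^'n" and ?u = "\<chi> i. \<bar>r\<bar> + 1 :: real^'n"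
  have "{x :: real^'n. \<forall>i\<in>S. ?l $ i < x $ i \<and> x $ i < ?u $ i} \<in> sets borel"
    using slab_eq_box[of "- S" ?l ?u] by (simp add: Ball_def)
  moreover have "{x. norm (proj S x) \<le> r} \<subseteq> {x. \<forall>i\<in>S. ?l $ i < x $ i \<and> x $ i < ?u $ i}"
  proof (intro subsetI CollectI ballI)
    fix x i assume "x \<in> {x. norm (proj S x) \<le> r}" "i \<in> S"
    then have "\<bar>x $ i\<bar> \<le> r" using component_le_norm_cart[of "proj S x" i] by simp
    then show "?l $ i < x $ i \<and> x $ i < ?u $ i" by auto
  qed
  ultimately have "emeasure \<mu> {x. norm (proj S x) \<le> r} \<le> emeasure \<mu> {x. \<forall>i\<in>S. ?l $ i < x $ i \<and> x $ i < ?u $ i}"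
    by (intro emeasure_mono) auto
  also have "\<dots> < \<infinity>"
    by (subst emeasure_slab_box) auto
  finally show ?thesis .
qed

lemma emeasure_cell_finite: "emeasure \<mu> (cell L) < \<infinity>"
proof (cases "cell L = {}")
  case False
  then obtain x where x: "label x = L" by (auto simp: cell_def)
  then obtain k where k: "k \<in> L" using label_nonempty by blast
  have "cell L \<subseteq> {x. norm (proj S x) \<le> rho + norm k}"
  proof
    fix y assume "y \<in> cell L"
    then have "norm (proj S y - k) \<le> rho" using k by (auto simp: cell_def intro: label_near)
    then show "y \<in> {x. norm (proj S x) \<le> rho + norm k}"
      using norm_triangle_sub[of "proj S y" k] by simp
  qed
  then have "emeasure \<mu> (cell L) \<le> emeasure \<mu> {x. norm (proj S x) \<le> rho + norm k}"
    by (intro emeasure_mono) auto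
  then show ?thesis using emeasure_bounded_cylinder[of "rho + norm k"] by (simp add: order_le_less_trans)
qed auto

definition weight :: "(real^'n) set \<Rightarrow> real" where
  "weight L = measure \<mu> (cell L)"

lemma weight_nonneg [simp]: "weight L \<ge> 0"
  by (simp add: weight_def)

text \<open>Such a function is a finite combination of indicators of cells, so integrals over the
  block become weighted sums over labels.\<close>

lemma integral_label:
  fixes G :: "(real^'n) set \<Rightarrow> real"
  assumes "finite F" "\<And>L. L \<in> range label \<Longrightarrow> L \<notin> F \<Longrightarrow> G L = 0"
  shows "integrable \<mu> (\<lambda>x. G (label x))" "(\<integral>x. G (label x) \<partial>\<mu>) = (\<Sum>L\<in>F. weight L * G L)"
    "(\<lambda>x. G (label x)) \<in> borel_measurable borel"
proof -
  have eq: "G (label x) = (\<Sum>L\<in>F. G L * indicator (cell L) x)" for x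
  proof -
    have "(\<Sum>L\<in>F. G L * indicator (cell L) x) = (\<Sum>L\<in>F. if L = label x then G L else 0)"
      by (intro sum.cong) (auto simp: indicator_def cell_def)
    then show ?thesis using assms by auto
  qed
  have int: "integrable \<mu> (\<lambda>x. G L * indicator (cell L) x)" for L
    using emeasure_cell_finite[of L] by (intro integrable_mult_right integrable_real_indicator) auto
  show "integrable \<mu> (\<lambda>x. G (label x))"
    unfolding eq using int by (intro Bochner_Integration.integrable_sum)
  show "(\<integral>x. G (label x) \<partial>\<mu>) = (\<Sum>L\<in>F. weight L * G L)"
    unfolding eq using int by (subst Bochner_Integration.integral_sum) (auto simp: weight_def mult.commute)
  show "(\<lambda>x. G (label x)) \<in> borel_measurable borel"
    unfolding eq by measurable
qed

lemma integral_label_affine: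
  fixes G :: "(real^'n) set \<Rightarrow> real"
  assumes "finite F" "\<And>L. L \<in> range label \<Longrightarrow> L \<notin> F \<Longrightarrow> G L = 0" "z \<in> \<Lambda>"
  shows "integrable \<mu> (\<lambda>x. G (label (P m *v x + z)))"
    "(\<integral>x. G (label (P m *v x + z)) \<partial>\<mu>) = (\<Sum>L\<in>F. weight L * G L) / \<bar>mdet A\<bar> powi m"
proof -
  have off: "(P m *v x + z) $ i = x $ i" if "i \<notin> S" for x i
    using that assms(3) by (simp add: P_off lattice_off)
  note 1 = integral_slab_affine[OF det_P_nonzero off integral_label(1)[of F G, OF assms(1,2)]]
  show "integrable \<mu> (\<lambda>x. G (label (P m *v x + z)))" using 1(1) by blast
  show "(\<integral>x. G (label (P m *v x + z)) \<partial>\<mu>) = (\<Sum>L\<in>F. weight L * G L) / \<bar>mdet A\<bar> powi m"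
    using 1(2) integral_label(2)[of F G, OF assms(1,2)] by (simp add: det_P)
qed

lemma range_label_translate: "L \<in> range label \<Longrightarrow> z \<in> \<Lambda> \<Longrightarrow> (+) z ` L \<in> range label"
  by (auto simp: label_translate[symmetric])

lemma label_diff: "z \<in> \<Lambda> \<Longrightarrow> label (x - z) = (+) (- z) ` label x"
  using label_translate[of "- z" x] by (simp add: lattice_uminus)

lemma translate_inverse [simp]: "(+) (- z) ` (+) z ` L = L" "(+) z ` (+) (- z) ` L = L" for z :: "real^'n"
  by (auto simp: image_image)

lemma weight_translate: "z \<in> \<Lambda> \<Longrightarrow> weight ((+) z ` L) = weight L"
proof -
  assume z: "z \<in> \<Lambda>"
  have "label x = (+) z ` L \<longleftrightarrow> label (x - z) = L" for x
    unfolding label_diff[OF z] using translate_inverse(1)[of z L] translate_inverse(2)[of z "label x"] by auto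
  then have "cell ((+) z ` L) = {x. id_mat *v x + (- z) \<in> cell L}"
    by (simp add: cell_def)
  then show ?thesis
    using emeasure_slab_affine[of "id_mat" S "- z" "cell L"] z
    by (simp add: weight_def measure_def lattice_off)
qed

section \<open>Translation classes of cells and the children of a cell\<close>

definition orbit :: "(real^'n) set \<Rightarrow> (real^'n) set set" where
  "orbit L = {(+) z ` L | z. z \<in> \<Lambda>}"

text \<open>The choice is made from the orbit as a set, so all lattice translates of L share one
  representative.\<close>

definition rep :: "(real^'n) set \<Rightarrow> (real^'n) set" where
  "rep L = (SOME L'. L' \<in> orbit L)"

definition Reps :: "(real^'n) set set" where
  "Reps = rep ` {L \<in> range label. weight L > 0}"

definition children :: "(real^'n) set \<Rightarrow> (real^'n) set set" where
  "children R = {L \<in> range label. parent L = R \<and> weight L > 0}"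

lemma rep_in_orbit: "\<exists>z\<in>\<Lambda>. rep L = (+) z ` L"
proof -
  have "(+) 0 ` L \<in> orbit L" unfolding orbit_def using lattice_0 by blast
  then have "rep L \<in> orbit L" unfolding rep_def by (rule someI)
  then show ?thesis by (auto simp: orbit_def)
qed

lemma rep_translate: "z \<in> \<Lambda> \<Longrightarrow> rep ((+) z ` L) = rep L"
proof -
  assume z: "z \<in> \<Lambda>"
  have "orbit ((+) z ` L) = orbit L"
  proof (intro equalityI subsetI)
    fix M assume "M \<in> orbit ((+) z ` L)"
    then obtain y where "y \<in> \<Lambda>" "M = (+) (y + z) ` L"
      by (auto simp: orbit_def image_image add.assoc)
    then show "M \<in> orbit L" using z by (auto simp: orbit_def)
  next
    fix M assume "M \<in> orbit L"
    then obtain y where "y \<in> \<Lambda>" "M = (+) (y - z) ` (+) z ` L"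
      by (auto simp: orbit_def image_image)
    then show "M \<in> orbit ((+) z ` L)" using z by (auto simp: orbit_def)
  qed
  then show ?thesis by (simp add: rep_def)
qed

lemma Reps:
  assumes "R \<in> Reps" shows "R \<in> range label" "weight R > 0" "rep R = R"
proof -
  obtain L where L: "L \<in> range label" "weight L > 0" "R = rep L"
    using assms unfolding Reps_def by blast
  obtain z where z: "z \<in> \<Lambda>" "rep L = (+) z ` L" using rep_in_orbit by blast
  have R: "R = (+) z ` L" using L(3) z(2) by (rule trans)
  show "R \<in> range label" unfolding R by (rule range_label_translate[OF L(1) z(1)])
  show "weight R > 0" unfolding R weight_translate[OF z(1)] by (rule L(2))
  show "rep R = R" using rep_translate[OF z(1), of L] unfolding R[symmetric] L(3)[symmetric] .
qed

text \<open>All points of a label are within \<open>rho\<close> of one point, so a label translated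
  to contain 0 lies in the ball of radius 2 \<open>rho\<close>, and this ball has finitely many sets
  of lattice points.\<close>

lemma finite_Reps: "finite Reps"
proof (rule finite_subset)
  let ?F = "Pow {z \<in> \<Lambda>. norm z \<le> 2 * rho}"
  show "finite (rep ` ?F)"
    by (intro finite_imageI finite_Pow_iff[THEN iffD2] finite_lattice_ball)
  show "Reps \<subseteq> rep ` ?F"
  proof
    fix R assume "R \<in> Reps"
    then obtain x where R: "R = rep (label x)" by (auto simp: Reps_def)
    obtain k where k: "k \<in> label x" using label_nonempty by blast
    then have kL: "k \<in> \<Lambda>" using label_lattice by blast
    have "(+) (- k) ` label x \<in> ?F"
    proof (safe)
      fix l assume l: "l \<in> label x"
      then show "- k + l \<in> \<Lambda>" using kL label_lattice by (auto simp: lattice_diff)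
      show "norm (- k + l) \<le> 2 * rho"
        using label_near[OF k] label_near[OF l] norm_triangle_ineq4[of "proj S x - k" "proj S x - l"]
        by (simp add: algebra_simps)
    qed
    moreover have "R = rep ((+) (- k) ` label x)"
      using R rep_translate[of "- k"] kL by (simp add: lattice_uminus)
    ultimately show "R \<in> rep ` ?F" by blast
  qed
qed

text \<open>By surjectivity of A, each such L is the label of some A x where x has label R. Then x
  stays within \<open>rho\<close> of any k in R, so A x and with it all points of L are
  bounded.\<close>

lemma finite_parent_fibre: "finite {L \<in> range label. parent L = R}"
proof (cases "R \<in> range label")
  case True
  then obtain k where k: "k \<in> R" using label_nonempty by blast
  let ?b = "rho + onorm ((*v) A) * (rho + norm k)"
  show ?thesis
  proof (rule finite_subset)
    show "finite (Pow {z \<in> \<Lambda>. norm z \<le> ?b})"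
      by (intro finite_Pow_iff[THEN iffD2] finite_lattice_ball)
    show "{L \<in> range label. parent L = R} \<subseteq> Pow {z \<in> \<Lambda>. norm z \<le> ?b}"
    proof (intro subsetI PowI)
      fix L l assume L: "L \<in> {L \<in> range label. parent L = R}" and l: "l \<in> L"
      then obtain y where y: "L = label y" by blast
      obtain x where x: "A *v x = y" using A_surj by blast
      have "label x = R" using L label_parent[of x] by (simp add: x y)
      then have "norm (proj S x - k) \<le> rho" using k label_near by blast
      then have "norm (proj S x) \<le> rho + norm k" using norm_triangle_sub[of "proj S x" k] by linarith
      then have "onorm ((*v) A) * norm (proj S x) \<le> onorm ((*v) A) * (rho + norm k)"
        using Bd_nonneg by (rule mult_left_mono)
      then have "norm (proj S y) \<le> onorm ((*v) A) * (rho + norm k)"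
        using Bd[of "proj S x"] proj_A[of x] x by simp
      moreover have "norm (proj S y - l) \<le> rho" using l y label_near by blast
      ultimately have "norm l \<le> ?b"
        using norm_triangle_sub[of l "proj S y"] by (simp add: norm_minus_commute)
      then show "l \<in> {z \<in> \<Lambda>. norm z \<le> ?b}" using l y label_lattice by blast
    qed
  qed
next
  case False
  have "R \<in> range label" if L: "L \<in> range label" "parent L = R" for L
  proof -
    obtain y where y: "L = label y" using L(1) by blast
    obtain x where "A *v x = y" using A_surj by blast
    then have "label x = R" using label_parent[of x] L y by simp
    then show ?thesis by blast
  qed
  then have "{L \<in> range label. parent L = R} = {}" using False by blast
  then show ?thesis by (simp only: finite.emptyI)
qed

lemma finite_children: "finite (children R)"
  by (rule finite_subset[OF _ finite_parent_fibre[of R]]) (auto simp: children_def)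

lemma P_1: "P 1 = A"
  using matrix_int_power_plus_1[OF det_A, of 0] by simp

text \<open>Up to null cells, the cell of R is the preimage under A of the union of the cells of its
  children, and taking preimages under A divides measures by |det A|.\<close>

lemma sum_children: "(\<Sum>L\<in>children R. weight L) = \<bar>mdet A\<bar> * weight R"
proof -
  let ?F = "{L \<in> range label. parent L = R}"
  define G where "G L = (if parent L = R then 1 else 0 :: real)" for L
  have "weight R = (\<integral>x. indicator (cell R) x \<partial>\<mu>)"
    by (simp add: weight_def)
  also have "\<dots> = (\<integral>x. G (label (P 1 *v x + 0)) \<partial>\<mu>)"
    by (intro Bochner_Integration.integral_cong) (auto simp: indicator_def cell_def P_1 G_def label_parent[symmetric])
  also have "\<dots> = (\<Sum>L\<in>?F. weight L * G L) / \<bar>mdet A\<bar>"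
    using integral_label_affine(2)[of ?F G 0 1] finite_parent_fibre by (simp add: G_def)
  also have "(\<Sum>L\<in>?F. weight L * G L) = (\<Sum>L\<in>children R. weight L)"
    using finite_parent_fibre weight_nonneg
    by (intro sum.mono_neutral_cong_right) (auto simp: children_def G_def less_le)
  finally show ?thesis using det_A by (simp add: field_simps)
qed

end

subsection \<open>The Haar system of the partitions\<close>

context block_dilation
begin

abbreviation "D \<equiv> \<bar>mdet A\<bar>"

lemma D_pos: "D > 0"
  using det_A by simp

lemma P_expand: "lam ^ n * norm (proj S x) \<le> norm (proj S (P (int n) *v x))"
proof (induction n)
  case (Suc n)
  have "lam ^ Suc n * norm (proj S x) \<le> lam * norm (proj S (P (int n) *v x))"
    using Suc lam by (simp add: mult.assoc)
  also have "\<dots> \<le> norm (A *v proj S (P (int n) *v x))"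
    by (rule A_expand) simp
  also have "A *v proj S (P (int n) *v x) = proj S (P (int (Suc n)) *v x)"
    using P_Suc[of "int n" x] by (simp add: proj_A add.commute)
  finally show ?case .
qed simp

lemma lam_power_gt: "\<exists>n0. \<forall>n\<ge>n0. b < lam ^ n" for b :: real
proof -
  obtain n0 where "b < lam ^ n0" using real_arch_pow[OF lam] by blast
  moreover have "lam ^ n0 \<le> lam ^ n" if "n \<ge> n0" for n
    using that lam by (intro power_increasing) auto
  ultimately show ?thesis by (meson less_le_trans)
qed

text \<open>A volume comparison: for large n the preimage of \<open>Q 1\<close> under A^n lies in
  \<open>Q (1 / 2)\<close>, which has measure 1, while \<open>Q 1\<close> has measure 2^card S.
  Hence D^n \<ge> 2^card S \<ge> 2.\<close>

lemma D_gt_1: "D > 1"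
proof -
  define Q where "Q r = {x :: real^'n. \<forall>i\<in>S. (\<chi> i. - r) $ i < x $ i \<and> x $ i < (\<chi> i. r) $ i}" for r :: real
  have Q: "Q r \<in> sets borel" "r > 0 \<Longrightarrow> emeasure \<mu> (Q r) = ennreal ((2 * r) ^ card S)" for r
    using slab_eq_box[of "- S" "\<chi> i. - r" "\<chi> i. r"]
      emeasure_slab_box[of S "\<chi> i. - r" "\<chi> i. r"] by (simp_all add: Q_def Ball_def)
  \<comment> \<open>Points of \<open>Q 1\<close> have projected norm at most CARD('n), so an
    expansion by more than twice that puts the preimage into norm < 1/2.\<close>
  obtain n where n: "2 * real CARD('n) < lam ^ n" using lam_power_gt by blast
  have "{x. P (int n) *v x + 0 \<in> Q 1} \<subseteq> Q (1 / 2)"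
  proof
    fix x assume "x \<in> {x. P (int n) *v x + 0 \<in> Q 1}"
    then have x: "\<bar>(P (int n) *v x) $ i\<bar> < 1" if "i \<in> S" for i
      using that by (auto simp: Q_def abs_less_iff)
    have "norm (proj S (P (int n) *v x)) \<le> (\<Sum>i\<in>UNIV. \<bar>proj S (P (int n) *v x) $ i\<bar>)"
      by (rule norm_le_l1_cart)
    also have "\<dots> \<le> (\<Sum>i\<in>(UNIV :: 'n set). 1)"
      using x by (intro sum_mono) (auto intro: less_imp_le)
    finally have "lam ^ n * norm (proj S x) \<le> real CARD('n)"
      using P_expand[of n x] by simp
    then have "lam ^ n * norm (proj S x) < lam ^ n * (1 / 2)" using n by linarith
    moreover have "0 < lam ^ n" using lam by simp
    ultimately have half: "norm (proj S x) < 1 / 2" by (simp only: mult_less_cancel_left_pos)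
    have "- (1 / 2) < x $ i \<and> x $ i < 1 / 2" if "i \<in> S" for i
      using component_le_norm_cart[of "proj S x" i] that half by (auto simp: abs_le_iff)
    then show "x \<in> Q (1 / 2)" by (simp add: Q_def)
  qed
  then have "emeasure \<mu> {x. P (int n) *v x + 0 \<in> Q 1} \<le> emeasure \<mu> (Q (1 / 2))"
    using Q(1) by (intro emeasure_mono) auto
  also have "\<dots> = 1" using Q(2)[of "1 / 2"] by simp
  finally have le: "emeasure \<mu> {x. P (int n) *v x + 0 \<in> Q 1} \<le> 1" .
  have "emeasure \<mu> (Q 1) = ennreal \<bar>mdet (P (int n))\<bar> * emeasure \<mu> {x. P (int n) *v x + 0 \<in> Q 1}"
    using Q(1) by (intro emeasure_slab_affine det_P_nonzero) (auto simp: P_off)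
  also have "\<dots> \<le> ennreal (D ^ n) * 1"
    using le by (intro mult_mono) (auto simp: det_P)
  finally have "2 ^ card S \<le> D ^ n" using Q(2)[of 1] by simp
  moreover have "(2::real) ^ 1 \<le> 2 ^ card S"
    using S_nonempty by (intro power_increasing) (auto simp: Suc_le_eq card_gt_0_iff)
  ultimately have "1 < D ^ n" by simp
  show ?thesis
  proof (rule ccontr)
    assume "\<not> ?thesis"
    then have "D ^ n \<le> 1" by (intro power_le_one) auto
    then show False using \<open>1 < D ^ n\<close> by simp
  qed
qed

lemma measurable_label_affine:
  fixes G :: "(real^'n) set \<Rightarrow> real"
  assumes "finite F" "\<And>L. L \<in> range label \<Longrightarrow> L \<notin> F \<Longrightarrow> G L = 0"
  shows "(\<lambda>x. G (label (P m *v x + z))) \<in> borel_measurable borel"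
  using measurable_compose[OF measurable_affine integral_label(3)[of F G, OF assms]] by simp

lemma measurable_of_bool_label: "(\<lambda>x. of_bool (label (P m *v x) = L) :: real) \<in> borel_measurable \<mu>"
  using measurable_label_affine[of "{L}" "\<lambda>M. of_bool (M = L)" m 0] by (simp cong: measurable_cong_sets)

lemma AE_label:
  assumes "weight M = 0" "z \<in> \<Lambda>"
  shows "AE x in \<mu>. label (P m *v x + z) \<noteq> M"
proof -
  have "emeasure \<mu> (cell M) = ennreal \<bar>mdet (P m)\<bar> * emeasure \<mu> {x. P m *v x + z \<in> cell M}"
    using assms(2) by (intro emeasure_slab_affine det_P_nonzero) (auto simp: P_off lattice_off)
  moreover have "emeasure \<mu> (cell M) = 0"
    using assms(1) emeasure_cell_finite[of M] emeasure_eq_ennreal_measure[of \<mu> "cell M"]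
    by (simp add: weight_def)
  ultimately have "emeasure \<mu> {x. P m *v x + z \<in> cell M} = 0"
    using det_P_nonzero[of m] by simp
  moreover have "{x. P m *v x + z \<in> cell M} \<in> sets \<mu>" by simp measurable
  ultimately show ?thesis
    by (intro AE_I[where N = "{x. P m *v x + z \<in> cell M}"]) (auto simp: cell_def)
qed

lemma funpow_A_add: "((*v) A ^^ d) (x + y) = ((*v) A ^^ d) x + ((*v) A ^^ d) y"
  by (induction d) (simp_all add: matrix_vector_right_distrib)

lemma funpow_A_lattice: "z \<in> \<Lambda> \<Longrightarrow> ((*v) A ^^ d) z \<in> \<Lambda>"
  by (induction d) (simp_all add: A_lattice)

lemma funpow_A_eq_P: "((*v) A ^^ d) x = P (int d) *v x"
  using matrix_int_power_add_nat[OF det_A, of 0 d x] by simp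

lemma label_funpow: "label y = (parent ^^ d) (label (((*v) A ^^ d) y))"
proof (induction d arbitrary: y)
  case (Suc d)
  have "label y = (parent ^^ d) (label (((*v) A ^^ d) y))" by (rule Suc)
  also have "\<dots> = (parent ^^ d) (parent (label (A *v (((*v) A ^^ d) y))))"
    by (subst label_parent) (rule refl)
  finally show ?case by (simp add: funpow_swap1)
qed simp

text \<open>A child is one summand of \<open>sum_children\<close>, so a parent of weight 0 could not
  have a child of positive weight.\<close>

lemma weight_parent_pos:
  assumes "L \<in> range label" "weight L > 0"
  shows "weight (parent L) > 0" "parent L \<in> range label" "L \<in> children (parent L)"
proof -
  show 1: "L \<in> children (parent L)" using assms by (simp add: children_def)
  have "weight L \<le> (\<Sum>M\<in>children (parent L). weight M)"
    using 1 finite_children by (intro member_le_sum) auto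
  then show "weight (parent L) > 0"
    using assms(2) D_pos unfolding sum_children by (metis less_le_trans zero_less_mult_pos)
  obtain x where "L = label x" using assms by blast
  moreover obtain y where "A *v y = x" using A_surj by blast
  ultimately show "parent L \<in> range label" using label_parent[of y] by auto
qed

lemma rep_mem_Reps: "L \<in> range label \<Longrightarrow> weight L > 0 \<Longrightarrow> rep L \<in> Reps"
  by (auto simp: Reps_def)

text \<open>The weight is constant on translation classes, of which there are finitely many. The
  bound keeps the ancestors of a cell from becoming small, which would spoil the decay in the
  telescoping argument.\<close>

lemma weight_bounded_below:
  "\<exists>\<delta>>0. \<forall>L\<in>range label. weight L > 0 \<longrightarrow> \<delta> \<le> weight L"
proof (intro exI conjI ballI impI)
  let ?d = "Min (insert 1 (weight ` Reps))"
  show "?d > 0" using finite_Reps Reps(2) by (subst Min_gr_iff) auto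
  fix L assume L: "L \<in> range label" "weight L > 0"
  obtain z where "z \<in> \<Lambda>" "rep L = (+) z ` L" using rep_in_orbit by blast
  then have "weight L = weight (rep L)" by (simp add: weight_translate)
  also have "\<dots> \<ge> ?d" using finite_Reps rep_mem_Reps[OF L] by (intro Min_le) auto
  finally show "?d \<le> weight L" .
qed

end

text \<open>\<open>h R j\<close> lives on the children of the representative R and is extended by 0.
  The square sums are D and not 1 because the wavelet evaluates \<open>h R j\<close> at the label of
  A x, and substituting A divides the integral by D.\<close>

locale haar_system = block_dilation S A lam for S :: "'n::finite set" and A :: "real^'n^'n" and lam :: real +
  fixes N :: "(real^'n) set \<Rightarrow> nat" and h :: "(real^'n) set \<Rightarrow> nat \<Rightarrow> (real^'n) set \<Rightarrow> real"
  assumes h_zero: "\<And>R j L. R \<in> Reps \<Longrightarrow> L \<notin> children R \<Longrightarrow> h R j L = 0"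
    and h_mean: "\<And>R j. R \<in> Reps \<Longrightarrow> j < N R \<Longrightarrow> (\<Sum>L\<in>children R. weight L * h R j L) = 0"
    and h_orthonormal: "\<And>R j k. R \<in> Reps \<Longrightarrow> j < N R \<Longrightarrow> k < N R \<Longrightarrow>
      (\<Sum>L\<in>children R. weight L * (h R j L * h R k L)) = (if j = k then D else 0)"
    and h_span: "\<And>R g. R \<in> Reps \<Longrightarrow> (\<Sum>L\<in>children R. weight L * g L) = 0 \<Longrightarrow>
      \<exists>c. \<forall>L\<in>children R. g L = (\<Sum>j<N R. c j * h R j L)"
begin

section \<open>The wavelets of one block and their orthonormality\<close>

definition mother :: "(real^'n) set \<times> nat \<Rightarrow> real^'n \<Rightarrow> real" where
  "mother = (\<lambda>(R, j) x. h R j (label (A *v x)))"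

definition wav :: "int \<times> (real^'n) \<times> ((real^'n) set \<times> nat) \<Rightarrow> real^'n \<Rightarrow> real" where
  "wav = (\<lambda>(m, k, a) x. sqrt \<bar>mdet (P m)\<bar> * mother a (P m *v x + k))"

definition idx :: "((real^'n) set \<times> nat) set" where
  "idx = Sigma Reps (\<lambda>R. {..<N R})"

lemma finite_idx: "finite idx"
  unfolding idx_def using finite_Reps by (intro finite_SigmaI) auto

lemma mother_affine: "mother (R, j) (P m *v x + k) = h R j (label (P (m + 1) *v x + A *v k))"
  by (simp add: mother_def P_Suc matrix_vector_right_distrib)

lemma measurable_mother:
  assumes "a \<in> idx" shows "mother a \<in> borel_measurable borel"
proof -
  obtain R j where a: "a = (R, j)" "R \<in> Reps" using assms by (auto simp: idx_def)
  have "(\<lambda>x. h R j (label (P 1 *v x + 0))) \<in> borel_measurable borel"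
    by (rule measurable_label_affine[OF finite_children[of R]]) (simp add: h_zero[OF a(2)])
  then show ?thesis by (simp add: a mother_def P_1)
qed

lemma measurable_wav:
  assumes "a \<in> idx" shows "wav (m, k, a) \<in> borel_measurable borel"
  unfolding wav_def prod.case
  by (intro borel_measurable_times borel_measurable_const
      measurable_compose[OF measurable_affine measurable_mother[OF assms]])

text \<open>Here d is the difference of the scales and z the remaining translation once the coarser
  wavelet has been brought to scale 0. For d = 0 a nonzero product makes R' the translate of R by z;
  both are representatives, so R' = R, and a finite nonempty set allows only z = 0. For d > 0 the
  coarser factor is constant on the support of the finer one, which has mean zero.\<close>

lemma mother_inner:
  fixes d :: nat and z :: "real^'n"
  assumes R: "R \<in> Reps" "j < N R" and R': "R' \<in> Reps" "j' < N R'" and z: "z \<in> \<Lambda>"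
  defines "f \<equiv> \<lambda>y. mother (R, j) y * mother (R', j') (((*v) A ^^ d) y + z)"
  shows "integrable \<mu> f" "(\<integral>y. f y \<partial>\<mu>) = (if d = 0 \<and> z = 0 \<and> R = R' \<and> j = j' then 1 else 0)"
proof -
  have "integrable \<mu> f \<and> (\<integral>y. f y \<partial>\<mu>) = (if d = 0 \<and> z = 0 \<and> R = R' \<and> j = j' then 1 else 0)"
  proof (cases d)
    case 0
    define G where "G L = h R j L * h R' j' ((+) (A *v z) ` L)" for L
    have f: "f y = G (label (P 1 *v y + 0))" for y
      using A_lattice[OF z] by (simp add: f_def 0 G_def mother_def P_1 matrix_vector_right_distrib label_translate)
    have G0: "G L = 0" if "L \<notin> children R" for L
      using h_zero[OF R(1) that] by (simp add: G_def)
    have int: "integrable \<mu> f" "(\<integral>y. f y \<partial>\<mu>) = (\<Sum>L\<in>children R. weight L * G L) / D"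
      unfolding f using integral_label_affine[OF finite_children[of R], of G 0 1] G0 by simp_all
    show ?thesis
    proof (cases "z = 0 \<and> R = R'")
      case True
      then have "(\<Sum>L\<in>children R. weight L * G L) = (if j = j' then D else 0)"
        using h_orthonormal[OF R R'(2)[folded True[THEN conjunct2]]] by (simp add: G_def)
      then show ?thesis using int True D_pos 0 by auto
    next
      case False
      have "G L = 0" if L: "L \<in> children R" for L
      proof (rule ccontr)
        assume "G L \<noteq> 0"
        then have "(+) (A *v z) ` L \<in> children R'"
          using h_zero[OF R'(1)] by (auto simp: G_def)
        then have R'eq: "R' = (+) z ` R"
          using L parent_translate[OF z] by (simp add: children_def)
        then have "R' = R" using Reps(3)[OF R(1)] Reps(3)[OF R'(1)] rep_translate[OF z, of R] by simp
        moreover have "finite R" "R \<noteq> {}"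
          using Reps(1)[OF R(1)] finite_label label_nonempty by auto
        ultimately show False using False translate_finite_fixed[of R z] R'eq by simp
      qed
      then have "(\<Sum>L\<in>children R. weight L * G L) = 0" by simp
      then show ?thesis using int False by auto
    qed
  next
    case (Suc e)
    \<comment> \<open>The coarser factor is rewritten through the finer label L: one step up,
      undoing z, and e = d - 1 further steps up lead to the label of A y. On the children of R' the
      first step always gives R', so this factor is constant there.\<close>
    define G where "G L = h R j ((parent ^^ e) ((+) (- z) ` parent L)) * h R' j' L" for L
    have f: "f y = G (label (P (int (Suc d)) *v y + A *v z))" for y
    proof -
      let ?y = "((*v) A ^^ d) y + z"
      have "label (A *v y) = (parent ^^ e) (label (((*v) A ^^ d) y))"
        using label_funpow[of "A *v y" e] by (simp add: Suc funpow_swap1)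
      also have "label (((*v) A ^^ d) y) = (+) (- z) ` label ?y"
        using label_diff[OF z, of ?y] by simp
      also have "label ?y = parent (label (A *v ?y))" by (rule label_parent)
      finally have 1: "label (A *v y) = (parent ^^ e) ((+) (- z) ` parent (label (A *v ?y)))" .
      have 2: "A *v ?y = P (int (Suc d)) *v y + A *v z"
        unfolding funpow_A_eq_P[symmetric] by (simp add: matrix_vector_right_distrib)
      show ?thesis unfolding f_def mother_def G_def 2[symmetric] using 1 by simp
    qed
    have G0: "G L = 0" if "L \<notin> children R'" for L
      using h_zero[OF R'(1) that] by (simp add: G_def)
    have int: "integrable \<mu> f" "(\<integral>y. f y \<partial>\<mu>) = (\<Sum>L\<in>children R'. weight L * G L) / D powi (int (Suc d))"
      unfolding f using integral_label_affine[OF finite_children[of R'], of G "A *v z" "int (Suc d)"] G0 A_lattice[OF z]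
      by simp_all
    have "(\<Sum>L\<in>children R'. weight L * G L) =
        (\<Sum>L\<in>children R'. weight L * h R' j' L) * h R j ((parent ^^ e) ((+) (- z) ` R'))"
      unfolding sum_distrib_right by (intro sum.cong) (auto simp: G_def children_def)
    then have "(\<Sum>L\<in>children R'. weight L * G L) = 0" using h_mean[OF R'] by simp
    then show ?thesis using int Suc by simp
  qed
  then show "integrable \<mu> f" "(\<integral>y. f y \<partial>\<mu>) = (if d = 0 \<and> z = 0 \<and> R = R' \<and> j = j' then 1 else 0)"
    by blast+
qed

text \<open>The substitution y = P m x + k turns the coarser wavelet into a mother function and
  leaves the translation l - A^d k in the finer one; for equal scales the Jacobian cancels the two
  normalizing factors.\<close>

lemma wav_inner_le:
  assumes a: "a \<in> idx" "b \<in> idx" and k: "k \<in> \<Lambda>" "l \<in> \<Lambda>" and "m \<le> n"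
  shows "integrable \<mu> (\<lambda>x. wav (m, k, a) x * wav (n, l, b) x)"
    "(\<integral>x. wav (m, k, a) x * wav (n, l, b) x \<partial>\<mu>) = (if (m, k, a) = (n, l, b) then 1 else 0)"
proof -
  obtain R j R' j' where ab: "a = (R, j)" "b = (R', j')" "R \<in> Reps" "j < N R" "R' \<in> Reps" "j' < N R'"
    using a by (auto simp: idx_def)
  define d where "d = nat (n - m)"
  have n: "n = m + int d" using \<open>m \<le> n\<close> by (simp add: d_def)
  define z where "z = l - ((*v) A ^^ d) k"
  have z: "z \<in> \<Lambda>" unfolding z_def using k by (intro lattice_diff funpow_A_lattice)
  define f where "f y = mother (R, j) y * mother (R', j') (((*v) A ^^ d) y + z)" for y
  define C where "C = sqrt \<bar>mdet (P m)\<bar> * sqrt \<bar>mdet (P n)\<bar>"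
  have eq: "wav (m, k, a) x * wav (n, l, b) x = C * f (P m *v x + k)" for x
  proof -
    have "P n *v x + l = ((*v) A ^^ d) (P m *v x + k) + z"
      unfolding n matrix_int_power_add_nat[OF det_A] by (simp add: z_def funpow_A_add)
    then show ?thesis by (simp add: wav_def f_def C_def ab)
  qed
  note f = mother_inner[OF ab(3-6) z, of d, folded f_def]
  have off: "(P m *v x + k) $ i = x $ i" if "i \<notin> S" for x i
    using that k by (simp add: P_off lattice_off)
  note g = integral_slab_affine[of "P m" S k f, OF det_P_nonzero off f(1)]
  show "integrable \<mu> (\<lambda>x. wav (m, k, a) x * wav (n, l, b) x)"
    unfolding eq using g(1) by simp
  have "(\<integral>x. wav (m, k, a) x * wav (n, l, b) x \<partial>\<mu>) = C * ((\<integral>y. f y \<partial>\<mu>) / \<bar>mdet (P m)\<bar>)"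
    unfolding eq using g(2) by simp
  also have "\<dots> = (if (m, k, a) = (n, l, b) then 1 else 0)"
  proof (cases "d = 0")
    case True
    then have "C = \<bar>mdet (P m)\<bar>" by (simp add: C_def n)
    then show ?thesis using True f(2) det_P_nonzero[of m] by (auto simp: n z_def ab)
  next
    case False
    then show ?thesis using f(2) by (simp add: n)
  qed
  finally show "(\<integral>x. wav (m, k, a) x * wav (n, l, b) x \<partial>\<mu>) = (if (m, k, a) = (n, l, b) then 1 else 0)" .
qed

lemma wav_orthonormal:
  assumes "a \<in> idx" "b \<in> idx" "k \<in> \<Lambda>" "l \<in> \<Lambda>"
  shows "integrable \<mu> (\<lambda>x. wav (m, k, a) x * wav (n, l, b) x)"
    "(\<integral>x. wav (m, k, a) x * wav (n, l, b) x \<partial>\<mu>) = (if (m, k, a) = (n, l, b) then 1 else 0)"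
proof -
  show "integrable \<mu> (\<lambda>x. wav (m, k, a) x * wav (n, l, b) x)"
    using wav_inner_le(1)[of a b k l m n] wav_inner_le(1)[of b a l k n m] assms
    by (cases "m \<le> n") (simp_all add: mult.commute)
  show "(\<integral>x. wav (m, k, a) x * wav (n, l, b) x \<partial>\<mu>) = (if (m, k, a) = (n, l, b) then 1 else 0)"
    using wav_inner_le(2)[of a b k l m n] wav_inner_le(2)[of b a l k n m] assms
    by (cases "m \<le> n") (auto simp: mult.commute)
qed

section \<open>Completeness of the Haar system in one block\<close>

definition widx :: "(int \<times> (real^'n) \<times> ((real^'n) set \<times> nat)) set" where
  "widx = UNIV \<times> \<Lambda> \<times> idx"

lemma measurable_widx: "\<forall>i\<in>widx. wav i \<in> borel_measurable \<mu>"
  by (auto simp: widx_def intro!: measurable_wav cong: measurable_cong_sets)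

text \<open>The factor weight L / (D * weight (parent L)) is the share of L in the measure of its
  parent, so the difference has mean zero on the parent. Moved to the representative cell it is a
  combination of the functions \<open>h\<close>.\<close>

lemma approximable_detail:
  assumes L: "L \<in> range label" "weight L > 0"
  shows "approximable \<mu> widx wav (\<lambda>x. of_bool (label (P (m + 1) *v x) = L) -
    weight L / (D * weight (parent L)) * of_bool (label (P m *v x) = parent L))"
proof -
  define q where "q = weight L / (D * weight (parent L))"
  note par = weight_parent_pos[OF L]
  obtain z where z: "z \<in> \<Lambda>" "rep (parent L) = (+) z ` parent L" using rep_in_orbit by blast
  define R where "R = rep (parent L)"
  define L' where "L' = (+) (A *v z) ` L"
  have R: "R \<in> Reps" unfolding R_def using par by (intro rep_mem_Reps)
  have wR: "weight R = weight (parent L)" unfolding R_def z(2) by (rule weight_translate[OF z(1)])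
  have wL: "weight L' = weight L" unfolding L'_def by (rule weight_translate[OF A_lattice[OF z(1)]])
  have pL: "parent L' = R" unfolding L'_def R_def z(2) by (rule parent_translate[OF z(1)])
  have L': "L' \<in> children R"
    using wL pL L(2) range_label_translate[OF L(1) A_lattice[OF z(1)]] by (simp add: children_def L'_def)
  define g where "g M = of_bool (M = L') - q" for M
  have "(\<Sum>M\<in>children R. weight M * g M) =
      (\<Sum>M\<in>children R. if M = L' then weight M else 0) - (\<Sum>M\<in>children R. weight M) * q"
    unfolding sum_distrib_right sum_subtractf[symmetric] by (intro sum.cong) (auto simp: g_def algebra_simps)
  also have "\<dots> = weight L - D * weight R * q"
    using L' finite_children[of R] by (simp add: wL sum_children)
  also have "\<dots> = 0"
    using par(1) D_pos by (simp add: q_def wR)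
  finally obtain c where c: "\<And>M. M \<in> children R \<Longrightarrow> g M = (\<Sum>j<N R. c j * h R j M)"
    using h_span[OF R] by blast
  define s where "s = sqrt \<bar>mdet (P m)\<bar>"
  have s: "s \<noteq> 0" using det_P_nonzero[of m] by (simp add: s_def)
  define F where "F = (\<lambda>j. (m, z, (R, j))) ` {..<N R}"
  define d where "d = (\<lambda>(m :: int, z :: real^'n, R :: (real^'n) set, j). c j / s)"
  have F: "finite F" "F \<subseteq> widx"
    using z R by (auto simp: F_def widx_def idx_def)
  have lhs: "(\<Sum>i\<in>F. d i * wav i x) = (\<Sum>j<N R. c j * h R j (label (P (m + 1) *v x + A *v z)))" for x
    unfolding F_def using s
    by (subst sum.reindex) (auto simp: inj_on_def d_def wav_def s_def[symmetric] mother_affine)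
  have ap: "approximable \<mu> widx wav (\<lambda>x. \<Sum>i\<in>F. d i * wav i x)"
    using measurable_widx F by (intro approximable_span) auto
  show ?thesis
  proof (rule approximable_cong_AE[OF ap])
    show "(\<lambda>x. of_bool (label (P (m + 1) *v x) = L) -
        weight L / (D * weight (parent L)) * of_bool (label (P m *v x) = parent L)) \<in> borel_measurable \<mu>"
      by (intro borel_measurable_diff borel_measurable_times borel_measurable_const measurable_of_bool_label)
    \<comment> \<open>Labels of weight 0 with parent R are not in \<open>children R\<close>, so the
      expansion in the functions \<open>h\<close> may fail on them; they are discarded as a null
      set.\<close>
    define Z where "Z = {M \<in> {M \<in> range label. parent M = R}. weight M = 0}"
    have "finite Z"
      unfolding Z_def by (rule finite_subset[OF _ finite_parent_fibre[of R]]) blast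
    then have "AE x in \<mu>. \<forall>M\<in>Z. label (P (m + 1) *v x + A *v z) \<noteq> M"
      using A_lattice[OF z(1)] by (intro AE_finite_allI AE_label) (auto simp: Z_def)
    then show "AE x in \<mu>. (\<Sum>i\<in>F. d i * wav i x) = of_bool (label (P (m + 1) *v x) = L) -
        weight L / (D * weight (parent L)) * of_bool (label (P m *v x) = parent L)"
    proof eventually_elim
      fix x assume x: "\<forall>M\<in>Z. label (P (m + 1) *v x + A *v z) \<noteq> M"
      define M where "M = label (P (m + 1) *v x + A *v z)"
      have M: "M = (+) (A *v z) ` label (P (m + 1) *v x)"
        unfolding M_def by (rule label_translate[OF A_lattice[OF z(1)]])
      have inj: "(+) y ` X = (+) y ` Y \<longleftrightarrow> X = Y" for y :: "real^'n" and X Y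
        by (rule inj_image_eq_iff) simp
      have 1: "label (P (m + 1) *v x) = L \<longleftrightarrow> M = L'"
        unfolding M L'_def inj ..
      have "parent M = (+) z ` parent (label (P (m + 1) *v x))"
        unfolding M by (rule parent_translate[OF z(1)])
      also have "parent (label (P (m + 1) *v x)) = label (P m *v x)"
        unfolding P_Suc by (rule label_parent[symmetric])
      finally have 2: "label (P m *v x) = parent L \<longleftrightarrow> parent M = R"
        unfolding R_def z(2) using inj by metis
      have "(\<Sum>j<N R. c j * h R j M) = of_bool (M = L') - q * of_bool (parent M = R)"
      proof (cases "parent M = R")
        case True
        have "M \<in> range label" by (simp add: M_def)
        then have "weight M \<noteq> 0" using x True unfolding M_def[symmetric] Z_def by blast
        then have "weight M > 0" using weight_nonneg[of M] by linarith
        then have "M \<in> children R" using True \<open>M \<in> range label\<close> by (simp add: children_def)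
        from c[OF this] show ?thesis using True by (simp add: g_def)
      next
        case False
        then have "M \<notin> children R" by (simp add: children_def)
        moreover have "M \<noteq> L'" using False pL by blast
        ultimately show ?thesis using False h_zero[OF R] by simp
      qed
      then show "(\<Sum>i\<in>F. d i * wav i x) = of_bool (label (P (m + 1) *v x) = L) -
          weight L / (D * weight (parent L)) * of_bool (label (P m *v x) = parent L)"
        unfolding lhs M_def[symmetric] 1 2 q_def .
    qed
  qed
qed

text \<open>Telescoping over the ancestors of a cell leaves a multiple of the indicator of an ancestor
  whose norm tends to \<open>0\<close>.\<close>

lemma approximable_ancestor:
  assumes L: "L \<in> range label" "weight L > 0"
  shows "\<exists>M\<in>range label. weight M > 0 \<and> approximable \<mu> widx wav (\<lambda>x. of_bool (label (P m *v x) = L) -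
    weight L / (D ^ n * weight M) * of_bool (label (P (m - int n) *v x) = M))"
proof (induction n)
  case 0
  have "approximable \<mu> widx wav (\<lambda>x. 0)"
    using approximable_span[OF measurable_widx, of "{}"] by simp
  then show ?case using L by (intro bexI[of _ L]) auto
next
  case (Suc n)
  then obtain M where M: "M \<in> range label" "weight M > 0"
    "approximable \<mu> widx wav (\<lambda>x. of_bool (label (P m *v x) = L) -
      weight L / (D ^ n * weight M) * of_bool (label (P (m - int n) *v x) = M))" by blast
  note par = weight_parent_pos[OF M(1,2)]
  have "approximable \<mu> widx wav (\<lambda>x. of_bool (label (P (m - int n) *v x) = M) -
    weight M / (D * weight (parent M)) * of_bool (label (P (m - int (Suc n)) *v x) = parent M))"
    using approximable_detail[OF M(1,2), of "m - int (Suc n)"] by (simp add: algebra_simps)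
  from approximable_add[OF measurable_widx M(3) approximable_scale[OF measurable_widx this, of "weight L / (D ^ n * weight M)"]]
  have "approximable \<mu> widx wav (\<lambda>x. of_bool (label (P m *v x) = L) -
      weight L / (D ^ Suc n * weight (parent M)) * of_bool (label (P (m - int (Suc n)) *v x) = parent M))"
    using M(2) D_pos by (simp add: algebra_simps)
  then show ?case using par by blast
qed

text \<open>The ancestor term left after n steps has squared norm (weight L)^2 / (weight M * D^m *
  D^n). It tends to 0, although M changes with n, because weight M is bounded below and D >
  1.\<close>

lemma approximable_label:
  assumes L: "L \<in> range label" "weight L > 0"
  shows "approximable \<mu> widx wav (\<lambda>x. of_bool (label (P m *v x) = L))"
proof (rule approximable_closed[OF measurable_widx])
  show "(\<lambda>x. of_bool (label (P m *v x) = L) :: real) \<in> borel_measurable \<mu>"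
    by (rule measurable_of_bool_label)
  fix \<epsilon> :: real assume "\<epsilon> > 0"
  obtain \<delta> where \<delta>: "\<delta> > 0" "\<And>M. M \<in> range label \<Longrightarrow> weight M > 0 \<Longrightarrow> \<delta> \<le> weight M"
    using weight_bounded_below by blast
  \<comment> \<open>A bound, uniform in the ancestor M, for D^n times the squared norm of the
    remaining term.\<close>
  define b where "b = (weight L)\<^sup>2 / (\<delta> * D powi m)"
  have b: "b \<ge> 0" using \<delta>(1) D_pos by (simp add: b_def)
  obtain n where n: "b / \<epsilon> < D ^ n" using real_arch_pow[OF D_gt_1] by blast
  obtain M where M: "M \<in> range label" "weight M > 0"
    "approximable \<mu> widx wav (\<lambda>x. of_bool (label (P m *v x) = L) -
      weight L / (D ^ n * weight M) * of_bool (label (P (m - int n) *v x) = M))"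
    using approximable_ancestor[OF L] by blast
  define q where "q = weight L / (D ^ n * weight M)"
  define G where "G K = (q * of_bool (K = M))\<^sup>2" for K
  have G0: "G K = 0" if "K \<notin> {M}" for K using that by (simp add: G_def)
  have G: "integrable \<mu> (\<lambda>x. G (label (P (m - int n) *v x)))"
    "(\<integral>x. G (label (P (m - int n) *v x)) \<partial>\<mu>) = weight M * q\<^sup>2 / D powi (m - int n)"
    using integral_label_affine[of "{M}" G 0 "m - int n"] G0 by (simp_all add: G_def)
  have nn: "(\<integral>\<^sup>+x. ennreal (G (label (P (m - int n) *v x))) \<partial>\<mu>) = ennreal (weight M * q\<^sup>2 / D powi (m - int n))"
    using G by (subst nn_integral_eq_integral) (auto simp: G_def)
  have "weight M * q\<^sup>2 / D powi (m - int n) = (weight L)\<^sup>2 / (weight M * D powi m) / D ^ n"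
    using M(2) D_pos by (simp add: q_def power_int_diff power2_eq_square field_simps)
  also have "\<dots> \<le> b / D ^ n"
    unfolding b_def using M \<delta> D_pos
    by (intro divide_right_mono divide_left_mono mult_right_mono mult_pos_pos) auto
  also have "\<dots> < \<epsilon>"
    using n \<open>\<epsilon> > 0\<close> D_pos by (simp add: field_simps)
  finally have "(\<integral>\<^sup>+x. ennreal (G (label (P (m - int n) *v x))) \<partial>\<mu>) < ennreal \<epsilon>"
    unfolding nn by (intro ennreal_lessI \<open>\<epsilon> > 0\<close>)
  then show "\<exists>g. approximable \<mu> widx wav g \<and>
      sqint \<mu> (\<lambda>x. of_bool (label (P m *v x) = L) - g x) < ennreal \<epsilon>"
    using M(3) by (intro exI[of _ "\<lambda>x. of_bool (label (P m *v x) = L) -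
      weight L / (D ^ n * weight M) * of_bool (label (P (m - int n) *v x) = M)"]) (simp add: G_def q_def)
qed

lemma approximable_label':
  assumes L: "L \<in> range label"
  shows "approximable \<mu> widx wav (\<lambda>x. of_bool (label (P m *v x) = L))"
proof (cases "weight L = 0")
  case True
  have "approximable \<mu> widx wav (\<lambda>x. 0)"
    using approximable_span[OF measurable_widx, of "{}"] by simp
  then show ?thesis
  proof (rule approximable_cong_AE[OF _ measurable_of_bool_label])
    show "AE x in \<mu>. 0 = (of_bool (label (P m *v x) = L) :: real)"
      using AE_label[OF True lattice_0, of m] by eventually_elim simp
  qed
next
  case False
  then have "weight L > 0" using weight_nonneg[of L] by linarith
  then show ?thesis using L by (rule approximable_label[rotated])
qed

text \<open>In the block coordinates a cell of level n has diameter at most 2 \<open>rho\<close> /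
  \<open>lam\<close>^n, so the cells contained in the open box exhaust it as n grows.\<close>

lemma approximable_box:
  fixes l u :: "real^'n"
  shows "approximable \<mu> widx wav (indicator {x. \<forall>i\<in>S. l $ i < x $ i \<and> x $ i < u $ i})"
proof -
  define G where "G = {x. \<forall>i\<in>S. l $ i < x $ i \<and> x $ i < u $ i}"
  have G_sets[measurable]: "G \<in> sets borel"
    unfolding G_def using slab_eq_box[of "- S" l u] by (simp add: Ball_def)
  have "G = (\<Inter>i\<in>S. {x. l $ i < x $ i} \<inter> {x. x $ i < u $ i})" by (auto simp: G_def)
  moreover have "open \<dots>"
    by (intro open_INT ballI open_Int open_Collect_less continuous_intros) auto
  ultimately have "open G" by simp
  have proj_G: "proj S x \<in> G \<longleftrightarrow> x \<in> G" for x by (auto simp: G_def)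
  define b where "b = (\<Sum>i\<in>UNIV. \<bar>l $ i\<bar> + \<bar>u $ i\<bar>)"
  have bound: "norm (proj S x) \<le> b" if "x \<in> G" for x
  proof -
    have "norm (proj S x) \<le> (\<Sum>i\<in>UNIV. \<bar>proj S x $ i\<bar>)" by (rule norm_le_l1_cart)
    also have "\<dots> \<le> b" unfolding b_def
    proof (rule sum_mono)
      fix i
      have "\<bar>x $ i\<bar> \<le> \<bar>l $ i\<bar> + \<bar>u $ i\<bar>" if "i \<in> S"
      proof -
        have "l $ i < x $ i" "x $ i < u $ i" using \<open>x \<in> G\<close> that by (auto simp: G_def)
        then show ?thesis by linarith
      qed
      then show "\<bar>proj S x $ i\<bar> \<le> \<bar>l $ i\<bar> + \<bar>u $ i\<bar>" by simp
    qed
    finally show ?thesis .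
  qed
  \<comment> \<open>Labels of the cells of level n that lie entirely in the box; there are finitely
    many since the box is bounded in the block coordinates. The sum of their indicators never
    exceeds that of the box, which serves as the dominating function.\<close>
  define F where "F n = {L \<in> (\<lambda>x. label (P (int n) *v x)) ` G. \<forall>y. label (P (int n) *v y) = L \<longrightarrow> y \<in> G}" for n
  define g where "g n x = (\<Sum>L\<in>F n. 1 * of_bool (label (P (int n) *v x) = L) :: real)" for n x
  have finF: "finite (F n)" for n
  proof (rule finite_subset)
    let ?B = "onorm ((*v) (P (int n))) * b + rho"
    show "finite (Pow {z \<in> \<Lambda>. norm z \<le> ?B})"
      by (intro finite_Pow_iff[THEN iffD2] finite_lattice_ball)
    show "F n \<subseteq> Pow {z \<in> \<Lambda>. norm z \<le> ?B}"
    proof (intro subsetI PowI)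
      fix L k assume "L \<in> F n" and k: "k \<in> L"
      then obtain x where x: "x \<in> G" "L = label (P (int n) *v x)" by (auto simp: F_def)
      have "norm (proj S (P (int n) *v x)) \<le> onorm ((*v) (P (int n))) * norm (proj S x)"
        unfolding proj_P by (rule onorm[OF matrix_vector_mul_bounded_linear])
      also have "\<dots> \<le> onorm ((*v) (P (int n))) * b"
        using bound[OF x(1)] by (intro mult_left_mono onorm_pos_le matrix_vector_mul_bounded_linear)
      finally have "norm k \<le> ?B"
        using label_near[of k "P (int n) *v x"] k x(2) norm_triangle_sub[of k "proj S (P (int n) *v x)"]
        by (simp add: norm_minus_commute)
      then show "k \<in> {z \<in> \<Lambda>. norm z \<le> ?B}" using k x(2) label_lattice by blast
    qed
  qed
  have g: "g n x = of_bool (label (P (int n) *v x) \<in> F n)" for n x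
    unfolding g_def using finF[of n] by (simp add: of_bool_def)
  have F_G: "label (P (int n) *v x) \<in> F n \<Longrightarrow> x \<in> G" for n x by (auto simp: F_def)
  have ev: "\<exists>n0. \<forall>n\<ge>n0. label (P (int n) *v x) \<in> F n" if x: "x \<in> G" for x
  proof -
    obtain r where r: "r > 0" "ball (proj S x) r \<subseteq> G"
      using \<open>open G\<close> x proj_G open_contains_ball by blast
    \<comment> \<open>Two points with a common label at level n are at most 2 \<open>rho\<close>
      apart after P n, hence less than r apart before it (in the block coordinates).\<close>
    obtain n0 where n0: "\<And>n. n \<ge> n0 \<Longrightarrow> 2 * rho / r < lam ^ n" using lam_power_gt by blast
    have "label (P (int n) *v x) \<in> F n" if "n \<ge> n0" for n
    proof -
      have "y \<in> G" if y: "label (P (int n) *v y) = label (P (int n) *v x)" for y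
      proof -
        obtain k where k: "k \<in> label (P (int n) *v x)" using label_nonempty by blast
        have "norm (proj S (P (int n) *v x) - k) \<le> rho" "norm (proj S (P (int n) *v y) - k) \<le> rho"
          using k y by (auto intro: label_near)
        then have "norm (proj S (P (int n) *v x) - proj S (P (int n) *v y)) \<le> 2 * rho"
          using norm_triangle_ineq4[of "proj S (P (int n) *v x) - k" "proj S (P (int n) *v y) - k"] by simp
        then have "norm (proj S (P (int n) *v (x - y))) \<le> 2 * rho"
          by (simp add: proj_diff matrix_vector_mult_diff_distrib)
        then have "lam ^ n * norm (proj S (x - y)) \<le> 2 * rho"
          using P_expand[of n "x - y"] by linarith
        also have "\<dots> < lam ^ n * r" using n0[OF \<open>n \<ge> n0\<close>] r(1) by (simp add: field_simps)
        finally have "norm (proj S x - proj S y) < r"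
          using lam by (simp add: proj_diff)
        then have "proj S y \<in> ball (proj S x) r" by (simp add: dist_norm)
        then show "y \<in> G" using r(2) proj_G by blast
      qed
      then show ?thesis using x by (auto simp: F_def)
    qed
    then show ?thesis by blast
  qed
  have ap: "approximable \<mu> widx wav (g n)" for n
    unfolding g_def[abs_def]
    by (rule approximable_sum[OF measurable_widx finF]) (auto simp: F_def intro!: approximable_label')
  have [measurable]: "g n \<in> borel_measurable \<mu>" for n using ap[of n] by (simp add: approximable_def)
  have "(\<lambda>n. sqint \<mu> (\<lambda>x. indicator G x - g n x)) \<longlonglongrightarrow> (\<integral>\<^sup>+x. 0 \<partial>\<mu>)"
  proof (rule nn_integral_dominated_convergence[where w = "indicator G"])
    have "emeasure \<mu> G \<le> emeasure \<mu> {x. norm (proj S x) \<le> b}"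
      using bound by (intro emeasure_mono) auto
    also have "\<dots> < \<infinity>" by (rule emeasure_bounded_cylinder)
    finally show "(\<integral>\<^sup>+ x. indicator G x \<partial>\<mu>) < \<infinity>" by simp
    show "AE x in \<mu>. ennreal ((indicator G x - g n x)\<^sup>2) \<le> indicator G x" for n
      using F_G[of n] by (intro AE_I2) (auto simp: g indicator_def)
    show "AE x in \<mu>. (\<lambda>n. ennreal ((indicator G x - g n x)\<^sup>2)) \<longlonglongrightarrow> 0"
    proof (rule AE_I2)
      fix x
      have "\<exists>n0. \<forall>n\<ge>n0. indicator G x = g n x"
      proof (cases "x \<in> G")
        case True
        then show ?thesis using ev[of x] by (auto simp: g)
      next
        case False
        then show ?thesis using F_G[of _ x] by (auto simp: g)
      qed
      then have "eventually (\<lambda>n. ennreal ((indicator G x - g n x)\<^sup>2) = 0) sequentially"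
        unfolding eventually_sequentially by (elim ex_forward) auto
      then show "(\<lambda>n. ennreal ((indicator G x - g n x)\<^sup>2)) \<longlonglongrightarrow> 0" by (rule tendsto_eventually)
    qed
  qed auto
  then have "approximable \<mu> widx wav (indicator G)"
    by (intro approximable_tendsto[OF measurable_widx _ ap]) (auto cong: measurable_cong_sets)
  then show ?thesis by (simp add: G_def)
qed

lemma depends_on_mother: "depends_on S (mother a)"
proof -
  have "label (A *v x) = label (A *v y)" if "\<forall>i\<in>S. x $ i = y $ i" for x y
  proof -
    have "proj S x = proj S y" using that by (simp add: cart_eq_iff)
    then have "proj S (A *v x) = proj S (A *v y)" by (simp add: proj_A)
    then have "\<forall>i\<in>S. (A *v x) $ i = (A *v y) $ i" by (metis proj_nth)
    then show ?thesis using depends_on_label by (simp add: depends_on_def)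
  qed
  then show ?thesis unfolding depends_on_def mother_def case_prod_unfold by metis
qed

end

subsection \<open>Wavelet bases in the coordinates of one block\<close>

definition scaled ::
  "real^'n^'n \<Rightarrow> ('a \<Rightarrow> real^'n \<Rightarrow> real) \<Rightarrow> int \<times> (real^'n) \<times> 'a \<Rightarrow> real^'n \<Rightarrow> real" where
  "scaled A u = (\<lambda>(m, k, a) x. sqrt \<bar>mdet (mpow A m)\<bar> *
     u a (mpow A m *v x + k))"

text \<open>The set \<open>Z\<close> of exponents is \<open>{0}\<close> when the block is empty and all powers of \<open>A\<close> coincide.\<close>

definition directional_basis ::
  "'n set \<Rightarrow> real^'n^'n \<Rightarrow> int set \<Rightarrow> 'a set \<Rightarrow> ('a \<Rightarrow> real^'n \<Rightarrow> real) \<Rightarrow> bool" where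
  "directional_basis S A Z X u \<longleftrightarrow>
     (\<forall>a\<in>X. u a \<in> borel_measurable borel \<and> depends_on S (u a)) \<and>
     (\<forall>p\<in>Z \<times> int_lattice S \<times> X. \<forall>q\<in>Z \<times> int_lattice S \<times> X.
       integrable (slab S) (\<lambda>x. scaled A u p x * scaled A u q x) \<and>
       (\<integral>x. scaled A u p x * scaled A u q x \<partial>slab S) = of_bool (p = q)) \<and>
     (\<forall>l r. approximable (slab S) (Z \<times> int_lattice S \<times> X) (scaled A u)
       (indicator {x. \<forall>i\<in>S. l $ i < x $ i \<and> x $ i < r $ i}))"

lemma approximable_reindex:
  assumes g: "bij_betw g J I" and f: "approximable M I e f"
  shows "approximable M J (\<lambda>j. e (g j)) f"
  unfolding approximable_def
proof (intro conjI allI impI)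
  show "f \<in> borel_measurable M" using f by (simp add: approximable_def)
  fix \<epsilon> :: real assume "\<epsilon> > 0"
  then obtain F c where F: "finite F" "F \<subseteq> I"
    "sqint M (\<lambda>x. f x - (\<Sum>i\<in>F. c i * e i x)) < ennreal \<epsilon>"
    using f unfolding approximable_def by blast
  define G where "G = inv_into J g ` F"
  have gG: "g (inv_into J g i) = i" if "i \<in> F" for i
    using that F(2) g by (metis bij_betw_inv_into_right subsetD)
  have "(\<Sum>j\<in>G. c (g j) * e (g j) x) = (\<Sum>i\<in>F. c i * e i x)" for x
    unfolding G_def using gG by (subst sum.reindex) (auto intro: inj_on_inverseI[where g = g])
  moreover have "G \<subseteq> J"
    unfolding G_def using F(2) g by (metis bij_betw_def image_subsetI inv_into_into subsetD)
  moreover have "finite G" unfolding G_def using F(1) by simp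
  ultimately show "\<exists>F c. finite F \<and> F \<subseteq> J \<and>
      sqint M (\<lambda>x. f x - (\<Sum>i\<in>F. c i * e (g i) x)) < ennreal \<epsilon>"
    using F(3) by (intro exI[of _ G] exI[of _ "\<lambda>j. c (g j)"]) simp
qed

lemma directional_basis_reindex:
  fixes A :: "real^'n^'n"
  assumes b: "bij_betw b Y X" and u: "directional_basis S A Z X u"
  shows "directional_basis S A Z Y (\<lambda>y. u (b y))"
proof -
  let ?I = "Z \<times> int_lattice S \<times> X" and ?J = "Z \<times> int_lattice S \<times> Y"
  define g where "g = (\<lambda>(m :: int, k :: real^'n, y). (m, k, b y))"
  have bX: "b y \<in> X" if "y \<in> Y" for y using b that by (auto simp: bij_betw_def)
  have g: "bij_betw g ?J ?I"
    unfolding bij_betw_def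
  proof
    show "inj_on g ?J" using b by (auto simp: inj_on_def bij_betw_def g_def)
    have "(m, k, x) \<in> g ` ?J" if "(m, k, x) \<in> ?I" for m k x
    proof -
      obtain y where "y \<in> Y" "x = b y" using b \<open>(m, k, x) \<in> ?I\<close> by (auto simp: bij_betw_def)
      then have "(m, k, x) = g (m, k, y)" "(m, k, y) \<in> ?J" using that by (auto simp: g_def)
      then show ?thesis by blast
    qed
    then have "?I \<subseteq> g ` ?J" by (intro subsetI) (metis prod_cases3)
    moreover have "g ` ?J \<subseteq> ?I"
      using bX by (auto simp: g_def)
    ultimately show "g ` ?J = ?I" by (rule equalityI[rotated])
  qed
  have e: "scaled A (\<lambda>y. u (b y)) p = scaled A u (g p)" for p
    by (cases p) (simp add: scaled_def g_def)
  have gI: "g p \<in> ?I" if "p \<in> ?J" for p using g that by (auto simp: bij_betw_def)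
  have inj: "g p = g q \<longleftrightarrow> p = q" if "p \<in> ?J" "q \<in> ?J" for p q
    using g that by (auto simp: bij_betw_def inj_on_def)
  let ?e = "scaled A (\<lambda>y. u (b y))"
  have 1: "\<forall>p\<in>?J. \<forall>q\<in>?J. integrable (slab S) (\<lambda>x. ?e p x * ?e q x) \<and>
      (\<integral>x. ?e p x * ?e q x \<partial>slab S) = of_bool (p = q)"
  proof (intro ballI)
    fix p q assume pq: "p \<in> ?J" "q \<in> ?J"
    show "integrable (slab S) (\<lambda>x. ?e p x * ?e q x) \<and>
        (\<integral>x. ?e p x * ?e q x \<partial>slab S) = of_bool (p = q)"
      using u[unfolded directional_basis_def, THEN conjunct2, THEN conjunct1, rule_format, OF gI[OF pq(1)] gI[OF pq(2)]]
      unfolding e inj[OF pq] .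
  qed
  have 2: "\<forall>l r. approximable (slab S) ?J (scaled A (\<lambda>y. u (b y)))
       (indicator {x. \<forall>i\<in>S. l $ i < x $ i \<and> x $ i < r $ i})"
    using approximable_reindex[OF g] u unfolding directional_basis_def e[abs_def] by blast
  show ?thesis
    unfolding directional_basis_def using 1 2 u bX by (simp add: directional_basis_def)
qed

lemma (in block_dilation) ex_directional_basis:
  "\<exists>(N :: nat) u. directional_basis S A UNIV {..<N} u"
proof -
  \<comment> \<open>The weights weight L / D are the measures of the preimages under A of the cells
    of the children; unit norm for them means square sum D for \<open>weight\<close>, as
    \<open>haar_system\<close> demands.\<close>
  define Q where "Q R p \<longleftrightarrow> (\<forall>j<fst p. (\<Sum>L\<in>children R. weight L / D * snd p j L) = 0) \<and>
    (\<forall>j<fst p. \<forall>k<fst p. (\<Sum>L\<in>children R. weight L / D * (snd p j L * snd p k L)) = (if j = k then 1 else 0)) \<and>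
    (\<forall>g. (\<Sum>L\<in>children R. weight L / D * g L) = 0 \<longrightarrow>
      (\<exists>c. \<forall>L\<in>children R. g L = (\<Sum>j<fst p. c j * snd p j L)))"
    for R and p :: "nat \<times> (nat \<Rightarrow> (real^'n) set \<Rightarrow> real)"
  have "\<exists>p. Q R p" if "R \<in> Reps" for R
  proof -
    have "(\<Sum>L\<in>children R. weight L) > 0"
      using Reps(2)[OF that] D_pos by (simp add: sum_children)
    then have "children R \<noteq> {}" by auto
    have "weight L / D > 0" if "L \<in> children R" for L
      using that D_pos by (simp add: children_def)
    with finite_children \<open>children R \<noteq> {}\<close> have "\<exists>N h. Q R (N, h)"
      unfolding Q_def fst_conv snd_conv by (rule weighted_haar_functions)
    then show ?thesis by blast
  qed
  note ex = this
  define p where "p R = (SOME p. Q R p)" for R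
  have p: "Q R (p R)" if "R \<in> Reps" for R
    unfolding p_def using ex[OF that] by (rule someI_ex)
  define N where "N R = fst (p R)" for R
  define h where "h R j L = (if L \<in> children R then snd (p R) j L else 0)" for R j L
  have scale: "(\<Sum>L\<in>children R. weight L / D * g L) = (\<Sum>L\<in>children R. weight L * g L) / D" for R g
    by (simp add: sum_divide_distrib)
  interpret haar_system S A lam N h
  proof
    fix R j L assume "R \<in> Reps" "L \<notin> children R"
    then show "h R j L = 0" by (simp add: h_def)
  next
    fix R j assume R: "R \<in> Reps" "j < N R"
    have "(\<Sum>L\<in>children R. weight L * h R j L) = (\<Sum>L\<in>children R. weight L * snd (p R) j L)"
      by (intro sum.cong) (auto simp: h_def)
    moreover have "(\<Sum>L\<in>children R. weight L * snd (p R) j L) / D = 0"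
      using p[OF R(1), unfolded Q_def scale, THEN conjunct1, rule_format, of j] R(2) unfolding N_def by blast
    ultimately show "(\<Sum>L\<in>children R. weight L * h R j L) = 0" using D_pos by simp
  next
    fix R j k assume R: "R \<in> Reps" "j < N R" "k < N R"
    have "(\<Sum>L\<in>children R. weight L * (h R j L * h R k L)) = (\<Sum>L\<in>children R. weight L * (snd (p R) j L * snd (p R) k L))"
      by (intro sum.cong) (auto simp: h_def)
    moreover have "(\<Sum>L\<in>children R. weight L * (snd (p R) j L * snd (p R) k L)) / D = (if j = k then 1 else 0)"
      using p[OF R(1), unfolded Q_def scale, THEN conjunct2, THEN conjunct1, rule_format, of j k] R(2,3)
      unfolding N_def by simp
    ultimately show "(\<Sum>L\<in>children R. weight L * (h R j L * h R k L)) = (if j = k then D else 0)"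
      using D_pos by (auto split: if_splits)
  next
    fix R g assume R: "R \<in> Reps" and "(\<Sum>L\<in>children R. weight L * g L) = 0"
    then have "(\<Sum>L\<in>children R. weight L * g L) / D = 0" by simp
    then obtain c where "\<forall>L\<in>children R. g L = (\<Sum>j<N R. c j * snd (p R) j L)"
      using p[OF R, unfolded Q_def scale, THEN conjunct2, THEN conjunct2, rule_format, of g]
      unfolding N_def by blast
    then show "\<exists>c. \<forall>L\<in>children R. g L = (\<Sum>j<N R. c j * h R j L)"
      by (intro exI[of _ c]) (simp add: h_def)
  qed
  have wav: "wav = scaled A mother"
    by (simp add: wav_def scaled_def)
  have "directional_basis S A UNIV idx mother"
    unfolding directional_basis_def wav[symmetric] widx_def[symmetric]
  proof (intro conjI ballI allI)
    fix a assume "a \<in> idx"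
    then show "mother a \<in> borel_measurable borel" by (rule measurable_mother)
    show "depends_on S (mother a)" by (rule depends_on_mother)
  next
    fix i j assume i: "i \<in> widx" and j: "j \<in> widx"
    obtain m k a where i': "i = (m, k, a)" "k \<in> \<Lambda>" "a \<in> idx" using i by (auto simp: widx_def)
    obtain n l b where j': "j = (n, l, b)" "l \<in> \<Lambda>" "b \<in> idx" using j by (auto simp: widx_def)
    show "integrable \<mu> (\<lambda>x. wav i x * wav j x)"
      unfolding i' j' by (rule wav_orthonormal(1)[OF i'(3) j'(3) i'(2) j'(2)])
    show "(\<integral>x. wav i x * wav j x \<partial>\<mu>) = of_bool (i = j)"
      unfolding i' j' wav_orthonormal(2)[OF i'(3) j'(3) i'(2) j'(2)] by simp
  qed (rule approximable_box)
  moreover obtain b where "bij_betw b {..<card idx} idx"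
    using ex_bij_betw_nat_finite[OF finite_idx] by (auto simp: atLeast0LessThan)
  ultimately show ?thesis using directional_basis_reindex by blast
qed

text \<open>For an empty block the slab is a probability measure, the lattice is {0} and the box
  condition is void, so the constant 1 is the whole basis.\<close>

lemma directional_basis_trivial:
  "directional_basis {} (id_mat :: real^'n^'n) {0} {..<1 :: nat} (\<lambda>_ _. 1)"
proof -
  have lat: "int_lattice {} = {0 :: real^'n}"
    by (auto simp: int_lattice_def cart_eq_iff)
  have "emeasure (slab {}) (UNIV :: (real^'n) set) = 1"
    using emeasure_slab_box[of "{}" "0 :: real^'n" 1] by simp
  then interpret prob: finite_measure "slab {} :: (real^'n) measure"
    by (intro finite_measureI) simp
  have m: "measure (slab {}) (UNIV :: (real^'n) set) = 1"
    using \<open>emeasure (slab {}) (UNIV :: (real^'n) set) = 1\<close> by (simp add: measure_def)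
  have e: "scaled (id_mat :: real^'n^'n) (\<lambda>_ _. 1) (0, k, a) = (\<lambda>x. 1)" for k and a :: nat
    by (simp add: scaled_def)
  have "approximable (slab {}) ({0} \<times> {0 :: real^'n} \<times> {..<1 :: nat})
      (scaled (id_mat) (\<lambda>_ _. 1)) (\<lambda>x. \<Sum>i\<in>{(0, 0, 0 :: nat)}. 1 * scaled (id_mat :: real^'n^'n) (\<lambda>_ _. 1) i x)"
    by (rule approximable_span) (auto simp: e)
  then have "approximable (slab {}) ({0} \<times> {0 :: real^'n} \<times> {..<1 :: nat})
      (scaled (id_mat) (\<lambda>_ _. 1)) (indicator UNIV)"
    by (simp add: e indicator_def[abs_def])
  then show ?thesis
    unfolding directional_basis_def lat by (auto simp: e m depends_on_def)
qed

subsection \<open>Tensor products\<close>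

lemma emeasure_slab_box_finite:
  fixes l r :: "real^'n"
  shows "emeasure (slab S) {x. \<forall>i\<in>S. l $ i < x $ i \<and> x $ i < r $ i} < \<infinity>"
proof (cases "\<forall>i\<in>S. l $ i \<le> r $ i")
  case True
  then show ?thesis by (subst emeasure_slab_box) auto
next
  case False
  then obtain i where "i \<in> S" "r $ i < l $ i" by (auto simp: not_le)
  then have "{x. \<forall>i\<in>S. l $ i < x $ i \<and> x $ i < r $ i} = {}"
    by (auto intro!: bexI[of _ i])
  then show ?thesis by (simp only: emeasure_empty) simp
qed

lemma ennreal_mult_small:
  fixes K :: ennreal
  assumes "K < \<infinity>" "\<epsilon> > 0"
  shows "\<exists>\<delta>>0. \<forall>a < ennreal \<delta>. K * a < ennreal \<epsilon>"
proof -
  obtain k where k: "K = ennreal k" "k \<ge> 0" using assms(1) by (cases K) auto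
  define \<delta> where "\<delta> = \<epsilon> / (k + 1)"
  have "\<delta> > 0" using k assms(2) by (simp add: \<delta>_def)
  moreover have "K * a < ennreal \<epsilon>" if "a < ennreal \<delta>" for a
  proof -
    have "K * a \<le> ennreal k * ennreal \<delta>"
      using that k by (intro mult_mono) auto
    also have "\<dots> = ennreal (k * \<delta>)" using k \<open>\<delta> > 0\<close> by (simp add: ennreal_mult)
    also have "\<dots> < ennreal \<epsilon>"
      using k assms(2) by (intro ennreal_lessI) (auto simp: \<delta>_def field_simps)
    finally show ?thesis .
  qed
  ultimately show ?thesis by blast
qed

lemma depends_on_sum:
  fixes e :: "'i \<Rightarrow> real^'n \<Rightarrow> real"
  assumes "\<And>i. i \<in> F \<Longrightarrow> depends_on S (e i)"
  shows "depends_on S (\<lambda>x. \<Sum>i\<in>F. c i * e i x :: real)"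
  unfolding depends_on_def
proof (intro allI impI sum.cong refl)
  fix x y :: "real^'n" and i assume "\<forall>i\<in>S. x $ i = y $ i" "i \<in> F"
  then have "e i x = e i y" using assms unfolding depends_on_def by blast
  then show "c i * e i x = c i * e i y" by simp
qed

text \<open>f g - f' g' = f (g - g') + (f - f') g', and by Fubini the squared norm of each summand
  factors over the two blocks.\<close>

lemma approximable_tensor:
  fixes e :: "'i \<Rightarrow> real^'n \<Rightarrow> real" and e' :: "'j \<Rightarrow> real^'n \<Rightarrow> real"
  assumes e: "\<And>i. i \<in> I \<Longrightarrow> e i \<in> borel_measurable borel \<and> depends_on S (e i)"
    and e': "\<And>j. j \<in> J \<Longrightarrow> e' j \<in> borel_measurable borel \<and> depends_on (- S) (e' j)"
    and f: "approximable (slab S) I e f" "depends_on S f"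
    and g: "approximable (slab (- S)) J e' g" "depends_on (- S) g"
    and fin: "sqint (slab S) f < \<infinity>"
      "sqint (slab (- S)) g < \<infinity>"
  shows "approximable lborel (I \<times> J) (\<lambda>(i, j) x. e i x * e' j x) (\<lambda>x. f x * g x)"
  unfolding approximable_def
proof (intro conjI allI impI)
  have f_m [measurable]: "f \<in> borel_measurable borel" and g_m [measurable]: "g \<in> borel_measurable borel"
    using f(1) g(1) by (simp_all add: approximable_def cong: measurable_cong_sets)
  show "(\<lambda>x. f x * g x) \<in> borel_measurable lborel" by simp
  fix \<epsilon> :: real assume "\<epsilon> > 0"
  then have pos: "\<epsilon> / 4 > 0" by simp
  obtain \<delta> where \<delta>: "\<delta> > 0"
    "\<And>a. a < ennreal \<delta> \<Longrightarrow> sqint (slab S) f * a < ennreal (\<epsilon> / 4)"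
    using ennreal_mult_small[OF fin(1) pos] by blast
  obtain G d where G: "finite G" "G \<subseteq> J"
    "sqint (slab (- S)) (\<lambda>x. g x - (\<Sum>j\<in>G. d j * e' j x)) < ennreal \<delta>"
    using g(1) \<delta>(1) unfolding approximable_def by blast
  define g' where "g' x = (\<Sum>j\<in>G. d j * e' j x)" for x
  have g'_m [measurable]: "g' \<in> borel_measurable borel"
    unfolding g'_def using G e' by (intro borel_measurable_sum borel_measurable_times) auto
  have g'_d: "depends_on (- S) g'"
    unfolding g'_def using G e' by (intro depends_on_sum) auto
  have "sqint (slab (- S)) g' =
      sqint (slab (- S)) (\<lambda>x. g x + - (g x - g' x))" by simp
  also have "\<dots> \<le> 2 * sqint (slab (- S)) g +
      2 * sqint (slab (- S)) (\<lambda>x. - (g x - g' x))"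
    by (rule nn_integral_square_add_le) (simp_all cong: measurable_cong_sets)
  also have "\<dots> < \<infinity>"
  proof -
    have "sqint (slab (- S)) (\<lambda>x. - (g x - g' x)) < \<infinity>"
      using G(3) unfolding g'_def[symmetric] power2_minus by (rule less_trans) simp
    then show ?thesis using fin(2) by (simp add: ennreal_mult_less_top)
  qed
  finally have fin': "sqint (slab (- S)) g' < \<infinity>" .
  \<comment> \<open>The accuracy for f is fixed only now, since it depends on the norm of the
    approximant g'.\<close>
  obtain \<delta>' where \<delta>': "\<delta>' > 0"
    "\<And>a. a < ennreal \<delta>' \<Longrightarrow> sqint (slab (- S)) g' * a < ennreal (\<epsilon> / 4)"
    using ennreal_mult_small[OF fin' pos] by blast
  obtain F c where F: "finite F" "F \<subseteq> I"
    "sqint (slab S) (\<lambda>x. f x - (\<Sum>i\<in>F. c i * e i x)) < ennreal \<delta>'"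
    using f(1) \<delta>'(1) unfolding approximable_def by blast
  define f' where "f' x = (\<Sum>i\<in>F. c i * e i x)" for x
  have f'_m [measurable]: "f' \<in> borel_measurable borel"
    unfolding f'_def using F e by (intro borel_measurable_sum borel_measurable_times) auto
  have f'_d: "depends_on S f'"
    unfolding f'_def using F e by (intro depends_on_sum) auto
  have tens: "sqint lborel (\<lambda>x. p x * r x) =
      sqint (slab S) p * sqint (slab (- S)) r"
    if "depends_on S p" "depends_on (- S) r" and [measurable]: "p \<in> borel_measurable borel" "r \<in> borel_measurable borel"
    for p r :: "real^'n \<Rightarrow> real"
  proof -
    have "sqint lborel (\<lambda>x. p x * r x) = (\<integral>\<^sup>+x. ennreal ((p x)\<^sup>2) * ennreal ((r x)\<^sup>2) \<partial>lborel)"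
      by (simp add: power_mult_distrib ennreal_mult)
    also have "\<dots> = sqint (slab S) p * sqint (slab (- S)) r"
    proof (rule nn_integral_tensor)
      show "depends_on S (\<lambda>x. ennreal ((p x)\<^sup>2))" "depends_on (- S) (\<lambda>x. ennreal ((r x)\<^sup>2))"
        using that(1,2) unfolding depends_on_def by metis+
    qed measurable
    finally show ?thesis .
  qed
  have d1: "depends_on (- S) (\<lambda>x. g x - g' x)" "depends_on S (\<lambda>x. f x - f' x)"
    using g(2) g'_d f(2) f'_d unfolding depends_on_def by metis+
  have 1: "sqint lborel (\<lambda>x. f x * (g x - g' x)) < ennreal (\<epsilon> / 4)"
    using \<delta>(2)[OF G(3)[folded g'_def]] by (subst tens[OF f(2) d1(1)]) simp_all
  have 2: "sqint lborel (\<lambda>x. (f x - f' x) * g' x) < ennreal (\<epsilon> / 4)"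
    using \<delta>'(2)[OF F(3)[folded f'_def]] by (subst tens[OF d1(2) g'_d]) (simp_all add: mult.commute)
  have fg: "f' x * g' x = (\<Sum>p\<in>F \<times> G. (c (fst p) * d (snd p)) * (case p of (i, j) \<Rightarrow> \<lambda>x. e i x * e' j x) x)" for x
    unfolding f'_def g'_def sum_product sum.cartesian_product by (intro sum.cong) auto
  have "sqint lborel (\<lambda>x. f x * g x - f' x * g' x) =
      sqint lborel (\<lambda>x. f x * (g x - g' x) + (f x - f' x) * g' x)"
    by (simp add: algebra_simps)
  also have "\<dots> \<le> 2 * sqint lborel (\<lambda>x. f x * (g x - g' x)) +
      2 * sqint lborel (\<lambda>x. (f x - f' x) * g' x)"
    by (rule nn_integral_square_add_le) simp_all
  also have "\<dots> < ennreal \<epsilon>"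
    using 1 2 \<open>\<epsilon> > 0\<close> by (rule two_ennreal_less)
  finally show "\<exists>K k. finite K \<and> K \<subseteq> I \<times> J \<and> sqint lborel (\<lambda>x. f x * g x -
      (\<Sum>p\<in>K. k p * (case p of (i, j) \<Rightarrow> \<lambda>x. e i x * e' j x) x)) < ennreal \<epsilon>"
    unfolding fg using F(1,2) G(1,2)
    by (intro exI[of _ "F \<times> G"] exI[of _ "\<lambda>p. c (fst p) * d (snd p)"]) auto
qed

subsection \<open>Complex orthonormal bases from real ones\<close>

text \<open>Real and imaginary parts are approximated separately, each with half of the squared
  error; the two real coefficient families become the real and imaginary parts of one complex
  family.\<close>

lemma approximable_complex:
  fixes E :: "'i \<Rightarrow> real^'n \<Rightarrow> real"
  assumes E: "\<And>p. p \<in> J \<Longrightarrow> E p \<in> borel_measurable borel"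
    and box: "\<And>l r. approximable lborel J E (indicator (box l r))"
    and f: "f \<in> L2" and "\<epsilon> > 0"
  shows "\<exists>F c. finite F \<and> F \<subseteq> J \<and> L2_dist f (\<lambda>x. \<Sum>p\<in>F. c p * complex_of_real (E p x)) < \<epsilon>"
proof -
  have fm[measurable]: "f \<in> borel_measurable lebesgue" and fi: "integrable lebesgue (\<lambda>x. (cmod (f x))\<^sup>2)"
    using f by (auto simp: L2_def)
  have El: "E p \<in> borel_measurable lborel" if "p \<in> J" for p
    using E[OF that] by simp
  have part: "\<exists>F c. finite F \<and> F \<subseteq> J \<and>
      sqint lebesgue (\<lambda>x. g x - (\<Sum>p\<in>F. c p * E p x)) < ennreal (\<epsilon>\<^sup>2 / 2)"
    if gm: "g \<in> borel_measurable lebesgue" and gf: "\<And>x. \<bar>g x\<bar> \<le> cmod (f x)" for g :: "real^'n \<Rightarrow> real"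
  proof -
    \<comment> \<open>A Lebesgue measurable function agrees almost everywhere with a Borel function,
      to which the density result for \<open>lborel\<close> applies.\<close>
    obtain g' where g': "g' \<in> borel_measurable lborel" "AE x in lborel. g x = g' x"
      using completion_ex_borel_measurable_real[OF gm] by blast
    have AE: "AE x in lebesgue. g x = g' x" using g'(2) by (rule AE_completion)
    have "sqint lborel g' = sqint lebesgue g'"
      by (rule nn_integral_completion[symmetric])
    also have "\<dots> = sqint lebesgue g"
      using AE by (intro nn_integral_cong_AE) auto
    also have "\<dots> \<le> sqint lebesgue (\<lambda>x. cmod (f x))"
    proof (intro nn_integral_mono ennreal_leI)
      show "(g x)\<^sup>2 \<le> (cmod (f x))\<^sup>2" for x
        using power_mono[OF gf abs_ge_zero, of x 2] by simp
    qed
    also have "\<dots> < \<infinity>"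
      using fi by (simp add: nn_integral_eq_integral)
    finally have "sqint lborel g' < \<infinity>" .
    then have "approximable lborel J E g'"
      using El by (intro approximable_if_boxes[OF _ box g'(1)] ballI) blast+
    moreover have "\<epsilon>\<^sup>2 / 2 > 0" using \<open>\<epsilon> > 0\<close> by simp
    ultimately obtain F c where F: "finite F" "F \<subseteq> J"
      "sqint lborel (\<lambda>x. g' x - (\<Sum>p\<in>F. c p * E p x)) < ennreal (\<epsilon>\<^sup>2 / 2)"
      unfolding approximable_def by blast
    have "sqint lebesgue (\<lambda>x. g x - (\<Sum>p\<in>F. c p * E p x)) =
        sqint lebesgue (\<lambda>x. g' x - (\<Sum>p\<in>F. c p * E p x))"
      using AE by (intro nn_integral_cong_AE) auto
    also have "\<dots> = sqint lborel (\<lambda>x. g' x - (\<Sum>p\<in>F. c p * E p x))"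
      by (rule nn_integral_completion)
    finally show ?thesis using F by (intro exI[of _ F] exI[of _ c] conjI) (simp_all only:)
  qed
  have Re_m: "(\<lambda>x. Re (f x)) \<in> borel_measurable lebesgue" and Im_m: "(\<lambda>x. Im (f x)) \<in> borel_measurable lebesgue"
    by measurable
  obtain F1 c1 where F1: "finite F1" "F1 \<subseteq> J"
    "sqint lebesgue (\<lambda>x. Re (f x) - (\<Sum>p\<in>F1. c1 p * E p x)) < ennreal (\<epsilon>\<^sup>2 / 2)"
    using part[OF Re_m abs_Re_le_cmod] by blast
  obtain F2 c2 where F2: "finite F2" "F2 \<subseteq> J"
    "sqint lebesgue (\<lambda>x. Im (f x) - (\<Sum>p\<in>F2. c2 p * E p x)) < ennreal (\<epsilon>\<^sup>2 / 2)"
    using part[OF Im_m abs_Im_le_cmod] by blast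
  define F where "F = F1 \<union> F2"
  define c where "c p = Complex (if p \<in> F1 then c1 p else 0) (if p \<in> F2 then c2 p else 0)" for p
  define s where "s x = (\<Sum>p\<in>F. c p * complex_of_real (E p x))" for x
  have Re_s: "Re (s x) = (\<Sum>p\<in>F1. c1 p * E p x)" for x
  proof -
    have "Re (s x) = (\<Sum>p\<in>F. if p \<in> F1 then c1 p * E p x else 0)"
      unfolding s_def Re_sum by (rule sum.cong[OF refl]) (simp add: c_def)
    also have "\<dots> = (\<Sum>p\<in>F \<inter> F1. c1 p * E p x)"
      using F1(1) F2(1) by (intro sum.inter_restrict[symmetric]) (simp add: F_def)
    also have "F \<inter> F1 = F1" by (auto simp: F_def)
    finally show ?thesis .
  qed
  have Im_s: "Im (s x) = (\<Sum>p\<in>F2. c2 p * E p x)" for x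
  proof -
    have "Im (s x) = (\<Sum>p\<in>F. if p \<in> F2 then c2 p * E p x else 0)"
      unfolding s_def Im_sum by (rule sum.cong[OF refl]) (simp add: c_def)
    also have "\<dots> = (\<Sum>p\<in>F \<inter> F2. c2 p * E p x)"
      using F1(1) F2(1) by (intro sum.inter_restrict[symmetric]) (simp add: F_def)
    also have "F \<inter> F2 = F2" by (auto simp: F_def)
    finally show ?thesis .
  qed
  have sm: "(\<lambda>x. Re (s x)) \<in> borel_measurable lebesgue" "(\<lambda>x. Im (s x)) \<in> borel_measurable lebesgue"
  proof -
    have m: "(\<lambda>x. \<Sum>p\<in>G. d p * E p x) \<in> borel_measurable lborel" if "G \<subseteq> J" for G and d :: "'i \<Rightarrow> real"
      using that by (intro borel_measurable_sum borel_measurable_times borel_measurable_const El) blast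
    show "(\<lambda>x. Re (s x)) \<in> borel_measurable lebesgue" "(\<lambda>x. Im (s x)) \<in> borel_measurable lebesgue"
      unfolding Re_s Im_s by (rule measurable_completion[OF m[OF F1(2)]] measurable_completion[OF m[OF F2(2)]])+
  qed
  have d1: "(\<lambda>x. (Re (f x) - Re (s x))\<^sup>2) \<in> borel_measurable lebesgue"
    and d2: "(\<lambda>x. (Im (f x) - Im (s x))\<^sup>2) \<in> borel_measurable lebesgue"
    by (intro borel_measurable_power borel_measurable_diff Re_m Im_m sm)+
  have cm: "(cmod (f x - s x))\<^sup>2 = (Re (f x) - Re (s x))\<^sup>2 + (Im (f x) - Im (s x))\<^sup>2" for x
    by (simp add: cmod_power2)
  have "sqint lebesgue (\<lambda>x. cmod (f x - s x)) =
      sqint lebesgue (\<lambda>x. Re (f x) - Re (s x)) + sqint lebesgue (\<lambda>x. Im (f x) - Im (s x))"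
    unfolding cm using d1 d2
    by (subst nn_integral_add[symmetric]) (simp_all add: measurable_compose[OF _ measurable_ennreal])
  also have "\<dots> < ennreal (\<epsilon>\<^sup>2 / 2) + ennreal (\<epsilon>\<^sup>2 / 2)"
    using F1(3) F2(3) unfolding Re_s Im_s by (intro add_strict_mono)
  also have "\<dots> = ennreal (\<epsilon>\<^sup>2)" by (subst ennreal_plus[symmetric]) auto
  finally have nn: "sqint lebesgue (\<lambda>x. cmod (f x - s x)) < ennreal (\<epsilon>\<^sup>2)" .
  have "(LINT x|lebesgue. (cmod (f x - s x))\<^sup>2) = enn2real (sqint lebesgue (\<lambda>x. cmod (f x - s x)))"
  proof (rule integral_eq_nn_integral)
    show "(\<lambda>x. (cmod (f x - s x))\<^sup>2) \<in> borel_measurable lebesgue"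
      unfolding cm by (intro borel_measurable_add d1 d2)
  qed simp
  also have "\<dots> < \<epsilon>\<^sup>2"
    using nn by (cases "sqint lebesgue (\<lambda>x. cmod (f x - s x))") (auto simp: ennreal_less_iff)
  finally have "L2_dist f s < \<epsilon>"
    unfolding L2_dist_def using \<open>\<epsilon> > 0\<close> by (simp add: real_less_lsqrt)
  then show ?thesis
    using F1 F2 unfolding s_def by (intro exI[of _ F] exI[of _ c]) (auto simp: F_def)
qed

text \<open>Serves to pass from real to complex scalars and from indices that contain the exponents
  to indices that contain only the resulting matrix.\<close>

lemma orthonormal_basis_of_realI:
  fixes E :: "'p \<Rightarrow> real^'n \<Rightarrow> real" and \<Psi> :: "'w \<Rightarrow> real^'n \<Rightarrow> complex"
  assumes E: "\<And>p. p \<in> J \<Longrightarrow> E p \<in> borel_measurable borel"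
    and orth: "\<And>p q. p \<in> J \<Longrightarrow> q \<in> J \<Longrightarrow> integrable lborel (\<lambda>x. E p x * E q x)"
      "\<And>p q. p \<in> J \<Longrightarrow> q \<in> J \<Longrightarrow> (\<integral>x. E p x * E q x \<partial>lborel) = of_bool (p = q)"
    and box: "\<And>l r. approximable lborel J E (indicator (box l r))"
    and \<sigma>: "\<sigma> ` J = W" "\<And>p x. p \<in> J \<Longrightarrow> \<Psi> (\<sigma> p) x = complex_of_real (E p x)"
  shows "orthonormal_basis_of L2 W \<Psi>"
proof -
  have inner: "L2_inner (\<Psi> (\<sigma> p)) (\<Psi> (\<sigma> q)) = of_bool (p = q)" if pq: "p \<in> J" "q \<in> J" for p q
  proof -
    have [measurable]: "E p \<in> borel_measurable borel" "E q \<in> borel_measurable borel"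
      using E pq by blast+
    have "L2_inner (\<Psi> (\<sigma> p)) (\<Psi> (\<sigma> q)) = (LINT x|lebesgue. complex_of_real (E p x * E q x))"
      unfolding L2_inner_def using \<sigma>(2) pq by simp
    also have "\<dots> = (LINT x|lborel. complex_of_real (E p x * E q x))"
      by (intro integral_completion) measurable
    also have "\<dots> = complex_of_real (\<integral>x. E p x * E q x \<partial>lborel)"
      by (rule integral_complex_of_real)
    finally show ?thesis using orth(2)[OF pq] by simp
  qed
  \<comment> \<open>If \<open>\<sigma> p = \<sigma> q\<close>, then \<open>E p\<close> and \<open>E q\<close> are the same unit vector, so they are not orthogonal.\<close>
  have inj: "inj_on \<sigma> J"
  proof (rule inj_onI, rule ccontr)
    fix p q assume pq: "p \<in> J" "q \<in> J" "\<sigma> p = \<sigma> q" "p \<noteq> q"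
    have "L2_inner (\<Psi> (\<sigma> p)) (\<Psi> (\<sigma> q)) = 0" using inner[OF pq(1,2)] pq(4) by simp
    moreover have "L2_inner (\<Psi> (\<sigma> p)) (\<Psi> (\<sigma> p)) = 1" using inner[OF pq(1,1)] by simp
    ultimately show False using pq(3) by simp
  qed
  show ?thesis unfolding orthonormal_basis_of_def
  proof (intro conjI ballI allI impI)
    fix w assume "w \<in> W"
    then obtain p where p: "p \<in> J" "w = \<sigma> p" using \<sigma>(1) by blast
    have [measurable]: "E p \<in> borel_measurable borel" using E p by blast
    have "integrable lebesgue (\<lambda>x. E p x * E p x)"
      using orth(1)[OF p(1) p(1)] by (subst integrable_completion) auto
    moreover have "\<Psi> w = (\<lambda>x. complex_of_real (E p x))" unfolding p(2) using \<sigma>(2)[OF p(1)] by (rule ext)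
    moreover have "(\<lambda>x. complex_of_real (E p x)) \<in> borel_measurable lebesgue"
      by (rule measurable_completion) measurable
    moreover have "(cmod (complex_of_real (E p x)))\<^sup>2 = E p x * E p x" for x
      by (simp add: power2_eq_square)
    ultimately show "\<Psi> w \<in> L2"
      unfolding L2_def by simp
  next
    fix v w assume "v \<in> W" "w \<in> W"
    then obtain p q where pq: "p \<in> J" "v = \<sigma> p" "q \<in> J" "w = \<sigma> q" using \<sigma>(1) by blast
    show "L2_inner (\<Psi> v) (\<Psi> w) = (if v = w then 1 else 0)"
      unfolding pq(2,4) inner[OF pq(1,3)] inj_on_eq_iff[OF inj pq(1,3)] by simp
  next
    fix f :: "real^'n \<Rightarrow> complex" and \<epsilon> :: real assume "f \<in> L2" "\<epsilon> > 0"
    then have "\<exists>F c. finite F \<and> F \<subseteq> J \<and> L2_dist f (\<lambda>x. \<Sum>p\<in>F. c p * complex_of_real (E p x)) < \<epsilon>"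
      using approximable_complex[of J E f \<epsilon>] E box by blast
    then obtain F c where F: "finite F" "F \<subseteq> J" "L2_dist f (\<lambda>x. \<Sum>p\<in>F. c p * complex_of_real (E p x)) < \<epsilon>"
      by blast
    have "(\<Sum>w\<in>\<sigma> ` F. c (inv_into J \<sigma> w) * \<Psi> w x) = (\<Sum>p\<in>F. c p * complex_of_real (E p x))" for x
    proof -
      have "(\<Sum>w\<in>\<sigma> ` F. c (inv_into J \<sigma> w) * \<Psi> w x) = (\<Sum>p\<in>F. c (inv_into J \<sigma> (\<sigma> p)) * \<Psi> (\<sigma> p) x)"
        by (subst sum.reindex[OF inj_on_subset[OF inj F(2)]]) (simp add: o_def)
      also have "\<dots> = (\<Sum>p\<in>F. c p * complex_of_real (E p x))"
      proof (rule sum.cong[OF refl])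
        fix p assume "p \<in> F"
        then have p: "p \<in> J" using F(2) by blast
        show "c (inv_into J \<sigma> (\<sigma> p)) * \<Psi> (\<sigma> p) x = c p * complex_of_real (E p x)"
          unfolding inv_into_f_f[OF inj p] \<sigma>(2)[OF p] ..
      qed
      finally show ?thesis .
    qed
    then show "\<exists>F c. finite F \<and> F \<subseteq> W \<and> L2_dist f (\<lambda>x. \<Sum>i\<in>F. c i * \<Psi> i x) < \<epsilon>"
      using F by (intro exI[of _ "\<sigma> ` F"] exI[of _ "\<lambda>w. c (inv_into J \<sigma> w)"])
        (simp add: \<sigma>(1)[symmetric] image_mono)
  qed
qed

subsection \<open>Combining the two blocks\<close>

lemma scaled_measurable:
  assumes "u a \<in> borel_measurable borel"
  shows "scaled A u (m, k, a) \<in> borel_measurable borel"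
  unfolding scaled_def prod.case
  by (intro borel_measurable_times borel_measurable_const measurable_compose[OF measurable_affine assms])

lemma depends_on_scaled:
  fixes A :: "real^'n^'n"
  assumes A: "block_matrix S A" and u: "depends_on S (u a)"
  shows "depends_on S (scaled A u (m, k, a))"
  unfolding depends_on_def
proof (intro allI impI)
  fix x y :: "real^'n" assume xy: "\<forall>i\<in>S. x $ i = y $ i"
  then have "proj S x = proj S y" by (simp add: cart_eq_iff)
  then have "proj S (mpow A m *v x) = proj S (mpow A m *v y)"
    by (simp add: block_matrix_power(2)[OF A])
  then have "\<forall>i\<in>S. (mpow A m *v x) $ i = (mpow A m *v y) $ i"
    by (metis proj_nth)
  then have "u a (mpow A m *v x + k) = u a (mpow A m *v y + k)"
    using u by (simp add: depends_on_def)
  then show "scaled A u (m, k, a) x = scaled A u (m, k, a) y"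
    by (simp add: scaled_def)
qed

text \<open>A fixes the coordinates outside S and B those inside. So A^m B^n x + k + l agrees on S
  with A^m x + k and off S with B^n x + l, and a product of one wavelet from each block is a dilated
  translate of the product of their mother functions.\<close>

lemma tensor_wavelet_set:
  fixes A B :: "real^'n^'n" and N1 N2 :: nat
  assumes A: "block_matrix S A" and B: "block_matrix (- S) B"
    and u: "directional_basis S A Z1 {..<N1} u" and v: "directional_basis (- S) B Z2 {..<N2} v"
    and Z1: "\<And>m. \<exists>m'\<in>Z1. mpow A m' = mpow A m"
    and Z2: "\<And>m. \<exists>m'\<in>Z2. mpow B m' = mpow B m"
  shows "\<exists>s \<psi>. finite_wavelet_set A B s \<psi>"
proof -
  let ?P = "mpow A" and ?Q = "mpow B"
  define I where "I = Z1 \<times> int_lattice S \<times> {..<N1}"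
  define J where "J = Z2 \<times> int_lattice (- S) \<times> {..<N2}"
  define e where "e = scaled A u"
  define e' where "e' = scaled B v"
  have e: "e p \<in> borel_measurable borel \<and> depends_on S (e p)" if "p \<in> I" for p
    using that u A by (auto simp: I_def e_def directional_basis_def intro!: scaled_measurable depends_on_scaled)
  have e': "e' p \<in> borel_measurable borel \<and> depends_on (- S) (e' p)" if "p \<in> J" for p
    using that v B by (auto simp: J_def e'_def directional_basis_def intro!: scaled_measurable depends_on_scaled)
  have oe: "integrable (slab S) (\<lambda>x. e p x * e q x)" "(\<integral>x. e p x * e q x \<partial>slab S) = of_bool (p = q)"
    if "p \<in> I" "q \<in> I" for p q
    using u[unfolded directional_basis_def, THEN conjunct2, THEN conjunct1, folded I_def e_def] that by blast+
  have oe': "integrable (slab (- S)) (\<lambda>x. e' p x * e' q x)" "(\<integral>x. e' p x * e' q x \<partial>slab (- S)) = of_bool (p = q)"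
    if "p \<in> J" "q \<in> J" for p q
    using v[unfolded directional_basis_def, THEN conjunct2, THEN conjunct1, folded J_def e'_def] that by blast+
  define E where "E = (\<lambda>(p, q) x. e p x * e' q x)"
  have E_tensor: "integrable lborel (\<lambda>x. E p x * E q x)" "(\<integral>x. E p x * E q x \<partial>lborel) = of_bool (p = q)"
    if pq: "p \<in> I \<times> J" "q \<in> I \<times> J" for p q
  proof -
    obtain p1 p2 q1 q2 where p: "p = (p1, p2)" "p1 \<in> I" "p2 \<in> J" and q: "q = (q1, q2)" "q1 \<in> I" "q2 \<in> J"
      using pq by auto
    have eq: "E p x * E q x = (e p1 x * e q1 x) * (e' p2 x * e' q2 x)" for x
      by (simp add: E_def p q)
    have d: "depends_on S (\<lambda>x. e p1 x * e q1 x)" "depends_on (- S) (\<lambda>x. e' p2 x * e' q2 x)"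
      using e[OF p(2)] e[OF q(2)] e'[OF p(3)] e'[OF q(3)] unfolding depends_on_def by metis+
    note t = integral_tensor[OF d oe(1)[OF p(2) q(2)] oe'(1)[OF p(3) q(3)]]
    show "integrable lborel (\<lambda>x. E p x * E q x)" unfolding eq by (rule t(1))
    show "(\<integral>x. E p x * E q x \<partial>lborel) = of_bool (p = q)"
      unfolding eq t(2) oe(2)[OF p(2) q(2)] oe'(2)[OF p(3) q(3)] by (simp add: p q)
  qed
  have E_box: "approximable lborel (I \<times> J) E (indicator (box l r))" for l r :: "real^'n"
  proof -
    define f where "f = (indicator {x. \<forall>i\<in>S. l $ i < x $ i \<and> x $ i < r $ i} :: real^'n \<Rightarrow> real)"
    define g where "g = (indicator {x. \<forall>i\<in>- S. l $ i < x $ i \<and> x $ i < r $ i} :: real^'n \<Rightarrow> real)"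
    have sq: "ennreal ((indicator X x)\<^sup>2) = indicator X x" for X and x :: "real^'n"
      by (simp add: indicator_def)
    have sets: "{x :: real^'n. \<forall>i\<in>T. l $ i < x $ i \<and> x $ i < r $ i} \<in> sets borel" for T
      using slab_eq_box[of "- T" l r] by (simp add: Ball_def)
    have "approximable lborel (I \<times> J) (\<lambda>(p, q) x. e p x * e' q x) (\<lambda>x. f x * g x)"
    proof (rule approximable_tensor[OF e e'])
      show "approximable (slab S) I e f"
        using u unfolding directional_basis_def I_def e_def f_def by blast
      show "approximable (slab (- S)) J e' g"
        using v unfolding directional_basis_def J_def e'_def g_def by blast
      show "depends_on S f" "depends_on (- S) g"
        by (auto simp: depends_on_def f_def g_def indicator_def)
      show "sqint (slab S) f < \<infinity>"
        using emeasure_slab_box_finite[of S l r] sets by (simp add: f_def sq)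
      show "sqint (slab (- S)) g < \<infinity>"
        using emeasure_slab_box_finite[of "- S" l r] sets[of "- S"] by (simp only: g_def sq) simp
    qed
    moreover have "(\<lambda>x. f x * g x) = indicator (box l r)"
      by (auto simp: f_def g_def mem_box_cart indicator_def fun_eq_iff)
    ultimately show ?thesis by (simp add: E_def)
  qed
  define ik :: "real^'n \<Rightarrow> int^'n" where "ik z = (\<chi> i. \<lfloor>z $ i\<rfloor>)" for z
  have ik: "int_vec (ik (x + y)) = x + y" if "x \<in> int_lattice S" "y \<in> int_lattice (- S)" for x y :: "real^'n"
  proof -
    have "(x + y) $ i \<in> \<int>" for i using that by (auto simp: int_lattice_def)
    then have "real_of_int \<lfloor>(x + y) $ i\<rfloor> = (x + y) $ i" for i
      by (metis Ints_cases floor_of_int)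
    then show ?thesis
      by (simp only: int_vec_def ik_def cart_eq_iff vec_lambda_beta simp_thms)
  qed
  have ik': "ik (int_vec k) = k" for k by (simp add: ik_def int_vec_def cart_eq_iff)
  have split: "proj S x + proj (- S) x = x" for x :: "real^'n"
    by (simp add: cart_eq_iff)
  \<comment> \<open>The pair i, j gets the number i * N2 + j + 1, since the wavelets are numbered
    from 1; \<open>div\<close> and \<open>mod\<close> recover the pair.\<close>
  define \<psi> where "\<psi> i x = complex_of_real (u ((i - 1) div N2) x * v ((i - 1) mod N2) x)" for i x
  define \<sigma> where "\<sigma> = (\<lambda>((m, k, i), (n, l, j)). (?P m ** ?Q n, ik (k + l), Suc (i * N2 + j)))"
  have \<sigma>_eq: "wavelet_system \<psi> (\<sigma> p) x = complex_of_real (E p x)" if p: "p \<in> I \<times> J" for p x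
  proof -
    obtain m k i n l j where p': "p = ((m, k, i), (n, l, j))" "k \<in> int_lattice S" "i < N1"
      "l \<in> int_lattice (- S)" "j < N2"
      using p by (auto simp: I_def J_def)
    have uv: "depends_on S (u i)" "depends_on (- S) (v j)"
      using u v p'(3,5) by (auto simp: directional_basis_def)
    let ?y = "(?P m ** ?Q n) *v x + (k + l)"
    have "proj S (?Q n *v x) = proj S x"
      using block_matrix_power(1)[OF B] by (simp add: cart_eq_iff)
    then have "proj S (?P m *v (?Q n *v x)) = proj S (?P m *v x)"
      by (simp add: block_matrix_power(2)[OF A])
    then have "(?P m *v (?Q n *v x)) $ a = (?P m *v x) $ a" if "a \<in> S" for a
      using that by (metis proj_nth)
    moreover have "l $ a = 0" if "a \<in> S" for a using p'(4) that by (auto simp: int_lattice_def)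
    ultimately have "u i ?y = u i (?P m *v x + k)"
      using uv(1) by (simp add: depends_on_def matrix_vector_mul_assoc[symmetric])
    moreover have "(?P m *v (?Q n *v x)) $ a = (?Q n *v x) $ a" "k $ a = 0" if "a \<in> - S" for a
      using that p'(2) block_matrix_power(1)[OF A] by (auto simp: int_lattice_def)
    then have "v j ?y = v j (?Q n *v x + l)"
      using uv(2) by (simp add: depends_on_def matrix_vector_mul_assoc[symmetric])
    moreover have "(i * N2 + j) div N2 = i" "(i * N2 + j) mod N2 = j" using p'(5) by auto
    ultimately show ?thesis
      by (simp add: wavelet_system_def \<sigma>_def p'(1) ik[OF p'(2,4)] \<psi>_def E_def e_def e'_def
          scaled_def det_mul abs_mult real_sqrt_mult)
  qed
  have \<sigma>_image: "\<sigma> ` (I \<times> J) = wavelet_index A B (N1 * N2)"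
  proof (intro equalityI subsetI)
    fix t assume "t \<in> \<sigma> ` (I \<times> J)"
    then obtain m k i n l j where t: "t = (?P m ** ?Q n, ik (k + l), Suc (i * N2 + j))" "i < N1" "j < N2"
      by (auto simp: \<sigma>_def I_def J_def)
    have "i * N2 + j < Suc i * N2" using t(3) by simp
    also have "\<dots> \<le> N1 * N2" using t(2) by (intro mult_right_mono) auto
    finally have "Suc (i * N2 + j) \<in> {1..N1 * N2}" by simp
    then show "t \<in> wavelet_index A B (N1 * N2)" unfolding t(1) wavelet_index_def by blast
  next
    fix t assume "t \<in> wavelet_index A B (N1 * N2)"
    then obtain m n k i where t: "t = (?P m ** ?Q n, k, i)" "i \<in> {1..N1 * N2}"
      unfolding wavelet_index_def by blast
    obtain m' n' where mn: "m' \<in> Z1" "?P m' = ?P m" "n' \<in> Z2" "?Q n' = ?Q n" using Z1 Z2 by metis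
    have N2: "N2 > 0" using t(2) by (cases N2) auto
    define p where "p = ((m', proj S (int_vec k), (i - 1) div N2), (n', proj (- S) (int_vec k), (i - 1) mod N2))"
    have "(i - 1) div N2 < N1" using t(2) N2 by (subst div_less_iff_less_mult) auto
    then have "p \<in> I \<times> J"
      using mn N2 by (auto simp: p_def I_def J_def int_lattice_def int_vec_def)
    moreover have "t = \<sigma> p"
      using mn t(2) unfolding t(1) by (simp add: \<sigma>_def p_def split ik')
    ultimately show "t \<in> \<sigma> ` (I \<times> J)" by blast
  qed
  have basis: "orthonormal_basis_of L2 (wavelet_index A B (N1 * N2)) (wavelet_system \<psi>)"
  proof (rule orthonormal_basis_of_realI[OF _ E_tensor E_box \<sigma>_image \<sigma>_eq])
    fix p assume "p \<in> I \<times> J"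
    then obtain p1 p2 where p: "p = (p1, p2)" "p1 \<in> I" "p2 \<in> J" by blast
    show "E p \<in> borel_measurable borel"
      using e[OF p(2)] e'[OF p(3)] unfolding E_def p(1) prod.case
      by (intro borel_measurable_times) blast+
  qed
  \<comment> \<open>Each mother function is itself the member of the system with m = n = 0 and k =
    0, so the basis property already puts it into \<open>L2\<close>.\<close>
  have "\<psi> i \<in> L2" if "i \<in> {1..N1 * N2}" for i
  proof -
    have "(?P 0 ** ?Q 0, 0, i) \<in> wavelet_index A B (N1 * N2)"
      unfolding wavelet_index_def using that by blast
    then have "wavelet_system \<psi> (?P 0 ** ?Q 0, 0, i) \<in> L2"
      using basis by (simp add: orthonormal_basis_of_def)
    moreover have "int_vec 0 = (0 :: real^'n)"
      by (simp add: int_vec_def cart_eq_iff)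
    then have "wavelet_system \<psi> (?P 0 ** ?Q 0, 0, i) = \<psi> i"
      by (simp add: wavelet_system_def)
    ultimately show ?thesis by simp
  qed
  then have "finite_wavelet_set A B (N1 * N2) \<psi>"
    using basis unfolding finite_wavelet_set_def by blast
  then show ?thesis by blast
qed

subsection \<open>Symmetric dilation matrices expand\<close>

text \<open>Let s be the minimum of |A v| over the unit sphere of the block and w a minimizer. The
  form q v = |A v|^2 - s^2 |v|^2 is nonnegative on the block and vanishes at w, so its gradient
  there vanishes too; by symmetry this says A^2 w = s^2 w. Then (A - s)(A + s) w = 0 makes s or - s
  an eigenvalue, and \<open>eig\<close> gives s > 1.\<close>

lemma symmetric_matrix_expands:
  fixes A :: "real^'n^'n"
  assumes sym: "Finite_Cartesian_Product.transpose A = A" and "S \<noteq> {}"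
    and inv: "\<And>v i. i \<notin> S \<Longrightarrow> v $ i = 0 \<Longrightarrow> (A *v v) $ i = 0"
    and eig: "\<And>v c. v \<noteq> 0 \<Longrightarrow> (\<And>i. i \<notin> S \<Longrightarrow> v $ i = 0) \<Longrightarrow> A *v v = c *\<^sub>R v \<Longrightarrow> \<bar>c\<bar> > 1"
  shows "\<exists>lam>1. \<forall>v. (\<forall>i. i \<notin> S \<longrightarrow> v $ i = 0) \<longrightarrow> lam * norm v \<le> norm (A *v v)"
proof -
  define V where "V = {v :: real^'n. \<forall>i. i \<notin> S \<longrightarrow> v $ i = 0}"
  have V_add: "v + w \<in> V" and V_diff: "v - w \<in> V" if "v \<in> V" "w \<in> V" for v w
    using that by (auto simp: V_def)
  have V_scale: "c *\<^sub>R v \<in> V" and V_A: "A *v v \<in> V" if "v \<in> V" for v c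
    using that inv by (auto simp: V_def)
  have inner: "(A *v x) \<bullet> y = x \<bullet> (A *v y)" for x y
    by (metis dot_lmul_matrix sym transpose_matrix_vector)
  have "V = (\<Inter>i\<in>-S. {v. v $ i = 0})" by (auto simp: V_def)
  moreover have "closed \<dots>" by (intro closed_INT ballI closed_Collect_eq continuous_intros)
  ultimately have cmp: "compact (sphere 0 1 \<inter> V)" by (intro compact_Int_closed) auto
  obtain a where "a \<in> S" using assms(2) by blast
  then have "axis a 1 \<in> V" by (auto simp: V_def axis_def)
  moreover have "axis a 1 \<in> sphere (0 :: real^'n) 1" by (simp add: norm_axis_1)
  ultimately have ne: "sphere 0 1 \<inter> V \<noteq> {}" by blast
  have cont: "continuous_on (sphere 0 1 \<inter> V) (\<lambda>v. norm (A *v v))"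
    by (intro continuous_intros matrix_vector_mult_linear_continuous_on)
  obtain w where "w \<in> sphere 0 1 \<inter> V" "\<forall>v\<in>sphere 0 1 \<inter> V. norm (A *v w) \<le> norm (A *v v)"
    using continuous_attains_inf[OF cmp ne cont] by blast
  then have w: "norm w = 1" "w \<in> V" "\<And>v. norm v = 1 \<Longrightarrow> v \<in> V \<Longrightarrow> norm (A *v w) \<le> norm (A *v v)"
    by auto
  define s where "s = norm (A *v w)"
  have s: "s * norm v \<le> norm (A *v v)" if "v \<in> V" for v
  proof (cases "v = 0")
    case False
    have "s \<le> norm (A *v ((1 / norm v) *\<^sub>R v))"
      unfolding s_def using False V_scale[OF that] by (intro w(3)) auto
    also have "\<dots> = norm (A *v v) / norm v"
      by (simp add: matrix_vector_mult_scaleR)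
    finally show ?thesis using False by (simp add: field_simps)
  qed simp
  define q where "q v = (A *v v) \<bullet> (A *v v) - s\<^sup>2 * (v \<bullet> v)" for v
  have q: "q v \<ge> 0" if "v \<in> V" for v
    using power_mono[OF s[OF that], of 2] by (simp add: q_def s_def power_mult_distrib power2_norm_eq_inner)
  have qw: "q w = 0" using w(1) by (simp add: q_def s_def dot_square_norm)
  define r where "r = A *v (A *v w) - s\<^sup>2 *\<^sub>R w"
  have rV: "r \<in> V" unfolding r_def by (intro V_diff V_scale V_A w(2))
  define b where "b = q r"
  \<comment> \<open>A step against the gradient that would make 2 t |r|^2 + t^2 b negative unless r
    = 0; b + 1 in place of b avoids a division by 0.\<close>
  define t where "t = - (r \<bullet> r) / (b + 1)"
  have b: "b \<ge> 0" unfolding b_def by (rule q[OF rV])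
  have "0 \<le> q (w + t *\<^sub>R r)" by (intro q V_add V_scale w(2) rV)
  also have "q (w + t *\<^sub>R r) = q w + 2 * t * ((A *v w) \<bullet> (A *v r) - s\<^sup>2 * (w \<bullet> r)) + t\<^sup>2 * q r"
    by (simp add: q_def matrix_vector_right_distrib matrix_vector_mult_scaleR inner_add_left inner_add_right
        inner_commute power2_eq_square algebra_simps)
  also have "(A *v w) \<bullet> (A *v r) - s\<^sup>2 * (w \<bullet> r) = r \<bullet> r"
  proof -
    have "(A *v w) \<bullet> (A *v r) = (A *v (A *v w)) \<bullet> r" by (simp add: inner)
    then show ?thesis by (simp add: r_def inner_diff_left)
  qed
  finally have t_nonneg: "0 \<le> 2 * t * (r \<bullet> r) + t\<^sup>2 * b" by (simp add: qw b_def)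
  have tb: "t * (b + 1) = - (r \<bullet> r)" using b by (simp add: t_def)
  have "(b + 1)\<^sup>2 * (2 * t * (r \<bullet> r) + t\<^sup>2 * b) = 2 * (t * (b + 1)) * (b + 1) * (r \<bullet> r) + (t * (b + 1))\<^sup>2 * b"
    by (simp add: power2_eq_square algebra_simps)
  also have "\<dots> = - ((r \<bullet> r)\<^sup>2 * (b + 2))"
    unfolding tb by (simp add: power2_eq_square algebra_simps)
  finally have "(r \<bullet> r)\<^sup>2 * (b + 2) \<le> 0"
    using mult_nonneg_nonneg[OF zero_le_power2[of "b + 1"] t_nonneg] by linarith
  then have "(r \<bullet> r)\<^sup>2 \<le> 0"
    using b by (simp add: mult_le_0_iff)
  then have "r = 0" by simp
  then have AA: "A *v (A *v w) = s\<^sup>2 *\<^sub>R w" by (simp add: r_def)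
  define y where "y = A *v w + s *\<^sub>R w"
  have "\<bar>s\<bar> > 1"
  proof (cases "y = 0")
    case True
    then have "A *v w = (- s) *\<^sub>R w" by (simp add: y_def eq_neg_iff_add_eq_0)
    moreover have "w \<noteq> 0" using w(1) by auto
    ultimately have "\<bar>- s\<bar> > 1" using w(2) by (intro eig) (auto simp: V_def)
    then show ?thesis by simp
  next
    case False
    have "A *v y = s *\<^sub>R y"
      by (simp add: y_def matrix_vector_right_distrib matrix_vector_mult_scaleR AA scaleR_add_right power2_eq_square)
    moreover have "y \<in> V" unfolding y_def by (intro V_add V_scale V_A w(2))
    ultimately show ?thesis using False by (intro eig) (auto simp: V_def)
  qed
  then have "s > 1" by (simp add: s_def)
  then show ?thesis using s by (auto simp: V_def)
qed

text \<open>A real eigenvector of A supported on S, listed along \<rho>, is an eigenvector of the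
  complexified block, whose eigenvalues have modulus greater than 1.\<close>

lemma dilation_mat_block:
  fixes A :: "real^'n^'n"
  assumes \<rho>: "bij_betw \<rho> {..<r} S" and M: "M \<in> carrier_mat r r" "dilation_mat M"
    and entries: "\<And>i j. i < r \<Longrightarrow> j < r \<Longrightarrow> M $$ (i, j) = A $ \<rho> i $ \<rho> j"
  shows "i \<in> S \<Longrightarrow> j \<in> S \<Longrightarrow> A $ i $ j \<in> \<int>"
    and "v \<noteq> 0 \<Longrightarrow> (\<And>i. i \<notin> S \<Longrightarrow> v $ i = 0) \<Longrightarrow> A *v v = c *\<^sub>R v \<Longrightarrow> \<bar>c\<bar> > 1"
proof -
  have S: "\<exists>a<r. \<rho> a = i" if "i \<in> S" for i using \<rho> that by (auto simp: bij_betw_def)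
  show "A $ i $ j \<in> \<int>" if ij: "i \<in> S" "j \<in> S"
  proof -
    obtain a where a: "a < r" "\<rho> a = i" using S[OF ij(1)] by blast
    obtain b where b: "b < r" "\<rho> b = j" using S[OF ij(2)] by blast
    have "M $$ (a, b) \<in> elements_mat M" using M(1) a(1) b(1) refl by (rule elements_matI)
    moreover have "elements_mat M \<subseteq> \<int>" using M(2) by (simp add: dilation_mat_def)
    ultimately show ?thesis using entries[OF a(1) b(1)] a(2) b(2) by auto
  qed
  show "\<bar>c\<bar> > 1" if v: "v \<noteq> 0" "\<And>i. i \<notin> S \<Longrightarrow> v $ i = 0" "A *v v = c *\<^sub>R v"
  proof -
    define w where "w = Matrix.vec r (\<lambda>a. complex_of_real (v $ \<rho> a))"
    obtain i where i: "v $ i \<noteq> 0" using v(1) by (auto simp: cart_eq_iff)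
    then obtain a where a: "a < r" "\<rho> a = i" using v(2) S by blast
    have "w \<noteq> 0\<^sub>v r"
    proof
      assume "w = 0\<^sub>v r"
      then have "vec_index w a = 0" using a by simp
      then show False using a i by (simp add: w_def)
    qed
    moreover have "map_mat complex_of_real M *\<^sub>v w = complex_of_real c \<cdot>\<^sub>v w"
    proof (rule eq_vecI)
      show "dim_vec (map_mat complex_of_real M *\<^sub>v w) = dim_vec (complex_of_real c \<cdot>\<^sub>v w)"
        using M(1) by (simp add: w_def)
      fix a assume "a < dim_vec (complex_of_real c \<cdot>\<^sub>v w)"
      then have a: "a < r" by (simp add: w_def)
      have "vec_index (map_mat complex_of_real M *\<^sub>v w) a =
          (\<Sum>b<r. complex_of_real (M $$ (a, b)) * complex_of_real (v $ \<rho> b))"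
        using a M(1) by (simp add: w_def scalar_prod_def atLeast0LessThan)
      also have "\<dots> = complex_of_real (\<Sum>b<r. A $ \<rho> a $ \<rho> b * v $ \<rho> b)"
        using a entries by simp
      also have "(\<Sum>b<r. A $ \<rho> a $ \<rho> b * v $ \<rho> b) = (\<Sum>j\<in>S. A $ \<rho> a $ j * v $ j)"
        by (rule sum.reindex_bij_betw[OF \<rho>])
      also have "\<dots> = (\<Sum>j\<in>UNIV. A $ \<rho> a $ j * v $ j)"
        using v(2) by (intro sum.mono_neutral_left) auto
      also have "\<dots> = (A *v v) $ \<rho> a" by (simp add: matrix_vector_mult_def)
      also have "\<dots> = c * v $ \<rho> a" by (simp add: v(3))
      finally show "vec_index (map_mat complex_of_real M *\<^sub>v w) a = vec_index (complex_of_real c \<cdot>\<^sub>v w) a"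
        using a by (simp add: w_def)
    qed
    ultimately have "eigenvalue (map_mat complex_of_real M) (complex_of_real c)"
      using M(1) unfolding eigenvalue_def eigenvector_def by (intro exI[of _ w]) (auto simp: w_def)
    then show ?thesis using M(2) by (auto simp: dilation_mat_def)
  qed
qed

text \<open>For an empty block A is the identity and the single exponent 0 stands for all powers;
  otherwise all exponents occur, and symmetry supplies the expansion constant of
  \<open>block_dilation\<close>.\<close>

lemma block_directional_basis:
  fixes A :: "real^'n^'n"
  assumes sym: "Finite_Cartesian_Product.transpose A = A"
    and \<rho>: "bij_betw \<rho> {..<r} S" and M: "M \<in> carrier_mat r r" "dilation_mat M"
    and entries: "\<And>i j. i < r \<Longrightarrow> j < r \<Longrightarrow> M $$ (i, j) = A $ \<rho> i $ \<rho> j"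
    and block: "\<And>i j. i \<notin> S \<or> j \<notin> S \<Longrightarrow> A $ i $ j = (if i = j then 1 else 0)"
  shows "block_matrix S A \<and> (\<exists>Z (N :: nat) u. directional_basis S A Z {..<N} u \<and>
    (\<forall>m. \<exists>m'\<in>Z. mpow A m' = mpow A m))"
proof (cases "S = {}")
  case True
  have A: "A = id_mat"
    using block True by (simp add: cart_eq_iff Finite_Cartesian_Product.mat_def)
  have det: "mdet A \<noteq> 0" by (simp add: A)
  have "mpow A m = id_mat" for m
    by (induction rule: matrix_int_power_induct[OF det]) (simp_all add: A)
  then have "directional_basis S A {0} {..<1 :: nat} (\<lambda>_ _. 1) \<and>
      (\<forall>m. \<exists>m'\<in>{0}. mpow A m' = mpow A m)"
    using directional_basis_trivial unfolding True A by simp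
  then show ?thesis using det block unfolding block_matrix_def by blast
next
  case False
  have ints: "A $ i $ j \<in> \<int>" if "i \<in> S" "j \<in> S" for i j
    using \<rho> M entries that by (rule dilation_mat_block(1))
  have eig: "\<bar>c\<bar> > 1" if "v \<noteq> 0" "\<And>i. i \<notin> S \<Longrightarrow> v $ i = 0" "A *v v = c *\<^sub>R v" for v c
    using \<rho> M entries that by (rule dilation_mat_block(2))
  have inv: "(A *v v) $ i = 0" if "i \<notin> S" "v $ i = 0" for v i
  proof -
    have "(\<Sum>j\<in>UNIV. A $ i $ j * v $ j) = 0"
      using that block[of i] by (intro sum.neutral) auto
    then show ?thesis by (simp add: matrix_vector_mult_def)
  qed
  have "\<exists>lam>1. \<forall>v. (\<forall>i. i \<notin> S \<longrightarrow> v $ i = 0) \<longrightarrow> lam * norm v \<le> norm (A *v v)"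
    using sym False inv eig by (rule symmetric_matrix_expands)
  then obtain lam where lam: "lam > 1" "\<forall>v. (\<forall>i. i \<notin> S \<longrightarrow> v $ i = 0) \<longrightarrow> lam * norm v \<le> norm (A *v v)"
    by blast
  interpret block_dilation S A lam
  proof
    show "A $ i $ j \<in> \<int>" for i j
      using ints[of i j] block[of i j] by (cases "i \<in> S \<and> j \<in> S") auto
    show "lam * norm v \<le> norm (A *v v)" if "\<And>i. i \<notin> S \<Longrightarrow> v $ i = 0" for v
      using lam(2) that by blast
    show "A $ i $ j = (if i = j then 1 else 0)" if "i \<notin> S \<or> j \<notin> S" for i j
      using that by (rule block)
  qed (use lam(1) False in blast)+
  note block_matrix_A
  moreover obtain N :: nat and u where "directional_basis S A UNIV {..<N} u"
    using ex_directional_basis by blast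
  ultimately show ?thesis by blast
qed

theorem theorem3p4:
  fixes A B :: "real^'n^'n"
    and \<phi> :: "real^'n \<Rightarrow> complex"
    and V :: "int \<Rightarrow> int \<Rightarrow> (real^'n \<Rightarrow> complex) set"
  assumes "commuting_dilation_pair A B"
    and "Finite_Cartesian_Product.transpose A = A"
    and "Finite_Cartesian_Product.transpose B = B"
    and "bmra A B \<phi> V"
  shows "\<exists>(s::nat) (\<psi> :: nat \<Rightarrow> real^'n \<Rightarrow> complex). finite_wavelet_set A B s \<psi>"
proof -
  obtain \<sigma> p q A' B' where \<sigma>: "bij_betw \<sigma> {..<CARD('n)} (UNIV :: 'n set)" and pq: "p + q = CARD('n)"
    and A': "A' \<in> carrier_mat p p" "dilation_mat A'" and B': "B' \<in> carrier_mat q q" "dilation_mat B'"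
    and A: "reindexed_mat \<sigma> A = four_block_mat A' (0\<^sub>m p q) (0\<^sub>m q p) (1\<^sub>m q)"
    and B: "reindexed_mat \<sigma> B = four_block_mat (1\<^sub>m p) (0\<^sub>m p q) (0\<^sub>m q p) B'"
    using assms(1) unfolding commuting_dilation_pair_def by blast
  \<comment> \<open>\<sigma> lists the coordinates of the block of A first and then those of the
    block of B; hence S and its complement, the latter listed by \<rho>.\<close>
  define S where "S = \<sigma> ` {..<p}"
  define \<rho> where "\<rho> i = \<sigma> (p + i)" for i
  have inj: "inj_on \<sigma> {..<CARD('n)}" and surj: "\<sigma> ` {..<CARD('n)} = UNIV"
    using \<sigma> by (auto simp: bij_betw_def)
  have ex_index: "\<exists>a<CARD('n). i = \<sigma> a" for i
    using surj by (metis UNIV_I imageE lessThan_iff)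
  have S: "bij_betw \<sigma> {..<p} S"
  proof -
    have "{..<p} \<subseteq> {..<CARD('n)}" using pq by auto
    then have "inj_on \<sigma> {..<p}" by (rule inj_on_subset[OF inj])
    then show ?thesis unfolding S_def by (rule inj_on_imp_bij_betw)
  qed
  have mem_S: "\<sigma> i \<in> S \<longleftrightarrow> i < p" if "i < CARD('n)" for i
  proof
    assume "\<sigma> i \<in> S"
    then obtain j where "j < p" "\<sigma> i = \<sigma> j" unfolding S_def by blast
    then show "i < p" using inj_onD[OF inj, of i j] that pq by simp
  qed (simp add: S_def)
  have S': "bij_betw \<rho> {..<q} (- S)"
    unfolding bij_betw_def
  proof
    show "inj_on \<rho> {..<q}"
    proof (rule inj_onI)
      fix i j assume "i \<in> {..<q}" "j \<in> {..<q}" "\<rho> i = \<rho> j"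
      then show "i = j" using inj_onD[OF inj, of "p + i" "p + j"] pq by (simp add: \<rho>_def)
    qed
    show "\<rho> ` {..<q} = - S"
    proof (intro equalityI subsetI)
      fix i assume "i \<in> - S"
      obtain a where a: "a < CARD('n)" "i = \<sigma> a" using ex_index by blast
      then have "p \<le> a" using mem_S[OF a(1)] \<open>i \<in> - S\<close> by simp
      then have "i = \<rho> (a - p)" "a - p \<in> {..<q}" using a pq by (auto simp: \<rho>_def)
      then show "i \<in> \<rho> ` {..<q}" by blast
    next
      fix i assume "i \<in> \<rho> ` {..<q}"
      then obtain j where "j < q" "i = \<sigma> (p + j)" unfolding \<rho>_def by blast
      then show "i \<in> - S" using mem_S[of "p + j"] pq by simp
    qed
  qed
  have entry: "A $ \<sigma> a $ \<sigma> b = (if a < p \<and> b < p then A' $$ (a, b) else if a = b then 1 else 0)"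
    "B $ \<sigma> a $ \<sigma> b = (if p \<le> a \<and> p \<le> b then B' $$ (a - p, b - p) else if a = b then 1 else 0)"
    if ab: "a < CARD('n)" "b < CARD('n)" for a b
  proof -
    have "A $ \<sigma> a $ \<sigma> b = reindexed_mat \<sigma> A $$ (a, b)" "B $ \<sigma> a $ \<sigma> b = reindexed_mat \<sigma> B $$ (a, b)"
      using ab by (simp_all add: reindexed_mat_def)
    then show "A $ \<sigma> a $ \<sigma> b = (if a < p \<and> b < p then A' $$ (a, b) else if a = b then 1 else 0)"
      "B $ \<sigma> a $ \<sigma> b = (if p \<le> a \<and> p \<le> b then B' $$ (a - p, b - p) else if a = b then 1 else 0)"
      using ab pq A'(1) B'(1) unfolding A B by auto
  qed
  have blockA: "A $ i $ j = (if i = j then 1 else 0)" if "i \<notin> S \<or> j \<notin> S" for i j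
  proof -
    obtain a where a: "a < CARD('n)" "i = \<sigma> a" using ex_index by blast
    obtain b where b: "b < CARD('n)" "j = \<sigma> b" using ex_index by blast
    have "i = j \<longleftrightarrow> a = b" using inj_onD[OF inj, of a b] a b by auto
    then show ?thesis
      using that entry(1)[OF a(1) b(1)] mem_S[OF a(1)] mem_S[OF b(1)] unfolding a(2) b(2) by auto
  qed
  have blockB: "B $ i $ j = (if i = j then 1 else 0)" if "i \<notin> - S \<or> j \<notin> - S" for i j
  proof -
    obtain a where a: "a < CARD('n)" "i = \<sigma> a" using ex_index by blast
    obtain b where b: "b < CARD('n)" "j = \<sigma> b" using ex_index by blast
    have "i = j \<longleftrightarrow> a = b" using inj_onD[OF inj, of a b] a b by auto
    then show ?thesis
      using that entry(2)[OF a(1) b(1)] mem_S[OF a(1)] mem_S[OF b(1)] unfolding a(2) b(2) by auto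
  qed
  have entryA: "A' $$ (a, b) = A $ \<sigma> a $ \<sigma> b" if "a < p" "b < p" for a b
    using that entry(1)[of a b] pq by simp
  have 1: "block_matrix S A \<and> (\<exists>Z (N :: nat) u. directional_basis S A Z {..<N} u \<and>
      (\<forall>m. \<exists>m'\<in>Z. mpow A m' = mpow A m))"
    using assms(2) S A' entryA blockA by (rule block_directional_basis)
  have entryB: "B' $$ (a, b) = B $ \<rho> a $ \<rho> b" if "a < q" "b < q" for a b
    using that entry(2)[of "p + a" "p + b"] pq by (simp add: \<rho>_def)
  have 2: "block_matrix (- S) B \<and> (\<exists>Z (N :: nat) u. directional_basis (- S) B Z {..<N} u \<and>
      (\<forall>m. \<exists>m'\<in>Z. mpow B m' = mpow B m))"
    using assms(3) S' B' entryB blockB by (rule block_directional_basis)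
  obtain Z1 u and N1 :: nat where u: "directional_basis S A Z1 {..<N1} u"
    "\<forall>m. \<exists>m'\<in>Z1. mpow A m' = mpow A m" using 1 by blast
  obtain Z2 v and N2 :: nat where v: "directional_basis (- S) B Z2 {..<N2} v"
    "\<forall>m. \<exists>m'\<in>Z2. mpow B m' = mpow B m" using 2 by blast
  show ?thesis
    using tensor_wavelet_set[OF 1[THEN conjunct1] 2[THEN conjunct1] u(1) v(1) u(2)[rule_format] v(2)[rule_format]] .
qed

end
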